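(* Let $\rho(\mathbf x,t)$ be the solution of the Fokker-Planck equation $\partial_t\rho=\mathcal L_t\rho$ on $[t_i,t_f]$ starting from the equilibrium state $\rho(\mathbf x,t_i)=e^{-\beta V(\mathbf x,\mathbf a_{t_i})}/\mathcal Z(\mathbf a_{t_i})$, and let $W=\int_{t_i}^{t_f}dt\int d^D\mathbf x\,\rho(\mathbf x,t)\,\partial_tV(\mathbf x,\mathbf a_t)$ be the mean work. Then $$W=\int_{t_i}^{t_f}dt\sum_{n\ge0}\sum_{\boldsymbol\alpha_n,\boldsymbol\beta_n}e^{-\int_{t_i}^tds\,\lambda_n(s)}\,[\mathbf M^{(n)}(t)]_{\boldsymbol\alpha_n,\boldsymbol\beta_n}\,D_{n,\boldsymbol\beta_n}(t)\int d^D\mathbf x\,\overline\rho_{0,\mathbf 0}(\mathbf x,\mathbf a_{t_i})\,(\partial_tV(\mathbf x,\mathbf a_t))\,\underline\rho_{n,\boldsymbol\alpha_n}(\mathbf x,\mathbf a_t),$$ where the coefficients $D_{n,\boldsymbol\alpha_n}(t)$ are determined by $$D_{n,\boldsymbol\alpha_n}(t)=D_{n,\boldsymbol\alpha_n}(t_i)-\int_{t_i}^tds\sum_{\boldsymbol\beta_n}\ \sum_{m\ge0,\,m\neq n}\ \sum_{\boldsymbol\gamma_m,\boldsymbol\delta_m}e^{\int_{t_i}^sds'(\lambda_n(s')-\lambda_m(s'))}\,\frac{[\mathbf M^{(n)}(s)]^{-1}_{\boldsymbol\alpha_n,\boldsymbol\beta_n}[\dot{\mathbf L}^{(n,m)}(s)]_{\boldsymbol\beta_n,\boldsymbol\gamma_m}[\mathbf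 M^{(m)}(s)]_{\boldsymbol\gamma_m,\boldsymbol\delta_m}}{\lambda_n(s)-\lambda_m(s)}\,D_{m,\boldsymbol\delta_m}(s)$$ with $D_{n,\boldsymbol\alpha_n}(t_i)=\delta_{n,0}\,\delta_{\boldsymbol\alpha_n,\mathbf 0}$.
   Context: Let $\nu,\beta>0$, let $V(\mathbf x,\mathbf a)$ be a smooth confining potential on $\mathbb R^D$ depending on control parameters $\mathbf a$, and let $t\mapsto\mathbf a_t$ be smooth on $[t_i,t_f]$. Set $\mathcal Z(\mathbf a)=\int d^D\mathbf x\,e^{-\beta V(\mathbf x,\mathbf a)}$. The Fokker-Planck operator is $\mathcal L_t f=\nabla\cdot\{\frac1{\nu\beta}\nabla f+\frac1\nu(\nabla V(\cdot,\mathbf a_t))f\}$ and its adjoint is $\mathcal L_t^\dagger g=\frac1{\nu\beta}\nabla^2g-\frac1\nu(\nabla V(\cdot,\mathbf a_t))\cdot\nabla g$. Solutions $\rho(\mathbf x,t)$ vanish rapidly as $|\mathbf x|\to\infty$. The self-adjoint operator $\mathcal H_t=-\frac1{\nu\beta}\nabla^2-\frac1{2\nu}(\nabla^2V)+\frac\beta{4\nu}(\nabla V)^2$ (with $V=V(\cdot,\mathbf a_t)$) has distinct eigenvalues $0=\lambda_0(t)<\lambda_1(t)<\lambda_2(t)<\cdots$ and a complete orthonormal system of real eigenfunctions $u_{n,\boldsymbol\alpha_n}(\mathbf x,\mathbf a_t)$, $\mathcal H_tu_{n,\boldsymbol\alpha_n}=\lambda_n(t)u_{n,\boldsymbol\alpha_n}$,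 where the finite multi-index $\boldsymbol\alpha_n$ labels the degeneracy of $\lambda_n(t)$; $\lambda_0$ is non-degenerate ($\boldsymbol\alpha_0=\mathbf 0$), with $u_{0,\mathbf 0}=\mathcal Z(\mathbf a_t)^{-1/2}e^{-\beta V/2}$. The range of the indices $n,\boldsymbol\alpha_n$ is assumed independent of $t$. For arbitrary positive real factors $\mathcal N_{n,\boldsymbol\alpha_n}(\mathbf a_t)$, the foot and head states are $$\underline\rho_{n,\boldsymbol\alpha_n}=\sqrt{\mathcal N_{n,\boldsymbol\alpha_n}}\,e^{-\beta V/2}u_{n,\boldsymbol\alpha_n},\qquad \overline\rho_{n,\boldsymbol\alpha_n}=\frac1{\sqrt{\mathcal N_{n,\boldsymbol\alpha_n}}}\,e^{\beta V/2}u_{n,\boldsymbol\alpha_n},$$ so that $\mathcal L_t\underline\rho_{n,\boldsymbol\alpha_n}=-\lambda_n\underline\rho_{n,\boldsymbol\alpha_n}$, $\mathcal L_t^\dagger\overline\rho_{n,\boldsymbol\alpha_n}=-\lambda_n\overline\rho_{n,\boldsymbol\alpha_n}$, $\int d^D\mathbf x\,\overline\rho_{n,\boldsymbol\alpha_n}\underline\rho_{m,\boldsymbol\beta_m}=\delta_{n,m}\delta_{\boldsymbol\alpha_n,\boldsymbol\beta_m}$, and the two families form a complete bi-orthogonal system. The matrices $\mathbf M^{(n)}(t)$ solve $$\partial_t[\mathbf M^{(n)}(t)]_{\boldsymbol\alpha_n,\boldsymbol\beta_n}=-\sum_{\boldsymbol\gamma_n}\Big(\int d^D\mathbf x\,\overline\rho_{n,\boldsymbol\alpha_n}(\mathbf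 x,\mathbf a_t)\,\partial_t\underline\rho_{n,\boldsymbol\gamma_n}(\mathbf x,\mathbf a_t)\Big)[\mathbf M^{(n)}(t)]_{\boldsymbol\gamma_n,\boldsymbol\beta_n},\qquad [\mathbf M^{(n)}(t_i)]_{\boldsymbol\alpha_n,\boldsymbol\beta_n}=\delta_{\boldsymbol\alpha_n,\boldsymbol\beta_n},$$ and $$[\dot{\mathbf L}^{(n,m)}(t)]_{\boldsymbol\alpha_n,\boldsymbol\beta_m}=\int d^D\mathbf x\,\overline\rho_{n,\boldsymbol\alpha_n}(\mathbf x,\mathbf a_t)\,(\partial_t\mathcal L_t)\,\underline\rho_{m,\boldsymbol\beta_m}(\mathbf x,\mathbf a_t),$$ where $\partial_t\mathcal L_t f=\frac1\nu\nabla\cdot\{(\nabla\partial_tV(\cdot,\mathbf a_t))f\}$. All sums over multi-indices run over the full degeneracy range. As usual in such spectral expansions, the eigenvalues and eigenfunctions are assumed to depend smoothly on $t$, with enough decay and convergence that the series may be differentiated and integrated term by term. *)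

theory Defs
  imports "HOL-Analysis.Analysis"
begin

section \<open>Smooth functions\<close>

text \<open>All iterated derivatives exist on \<^term>\<open>S\<close>. Derivatives are taken within \<^term>\<open>S\<close>, hence they are
  one-sided at the end points of a time interval.\<close>

coinductive smooth_on ::
    "'e::euclidean_space set \<Rightarrow> ('e \<Rightarrow> 'f::real_normed_vector) \<Rightarrow> bool"
  for S where
  smooth_onI: "(\<forall>p\<in>S. (f has_derivative f' p) (at p within S)) \<Longrightarrow>
    (\<forall>b\<in>Basis. smooth_on S (\<lambda>p. f' p b)) \<Longrightarrow> smooth_on S f"

definition time_deriv :: "real set \<Rightarrow> (real \<Rightarrow> real) \<Rightarrow> real \<Rightarrow> real" where
  "time_deriv T f t = vector_derivative f (at t within T)"


section \<open>Differential operators on \<open>\<real>\<^sup>D\<close>\<close>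

definition partial_deriv :: "'d::finite \<Rightarrow> (real^'d \<Rightarrow> real) \<Rightarrow> real^'d \<Rightarrow> real" where
  "partial_deriv i f x = deriv (\<lambda>h. f (x + h *\<^sub>R axis i 1)) 0"

definition grad :: "(real^'d \<Rightarrow> real) \<Rightarrow> real^'d \<Rightarrow> real^'d::finite" where
  "grad f x = (\<chi> i. partial_deriv i f x)"

definition divergence :: "(real^'d \<Rightarrow> real^'d) \<Rightarrow> real^'d::finite \<Rightarrow> real" where
  "divergence F x = (\<Sum>i\<in>UNIV. partial_deriv i (\<lambda>y. F y $ i) x)"

definition laplacian :: "(real^'d \<Rightarrow> real) \<Rightarrow> real^'d::finite \<Rightarrow> real" where
  "laplacian f = divergence (grad f)"

text \<open>In the following operators \<^term>\<open>U\<close> is the potential at a fixed time and \<open>Udot\<close> its time derivative.\<close>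

definition fokker_planck ::
    "real \<Rightarrow> real \<Rightarrow> (real^'d::finite \<Rightarrow> real) \<Rightarrow> (real^'d \<Rightarrow> real) \<Rightarrow> real^'d \<Rightarrow> real" where
  "fokker_planck \<nu> \<beta> U f =
     divergence (\<lambda>y. (1 / (\<nu> * \<beta>)) *\<^sub>R grad f y + (1 / \<nu>) *\<^sub>R (f y *\<^sub>R grad U y))"

definition fokker_planck_dot ::
    "real \<Rightarrow> (real^'d::finite \<Rightarrow> real) \<Rightarrow> (real^'d \<Rightarrow> real) \<Rightarrow> real^'d \<Rightarrow> real" where
  "fokker_planck_dot \<nu> Udot f x = 1 / \<nu> * divergence (\<lambda>y. f y *\<^sub>R grad Udot y) x"

definition hamiltonian ::
    "real \<Rightarrow> real \<Rightarrow> (real^'d::finite \<Rightarrow> real) \<Rightarrow> (real^'d \<Rightarrow> real) \<Rightarrow> real^'d \<Rightarrow> real" where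
  "hamiltonian \<nu> \<beta> U f x =
     - 1 / (\<nu> * \<beta>) * laplacian f x - 1 / (2 * \<nu>) * laplacian U x * f x
     + \<beta> / (4 * \<nu>) * (grad U x \<bullet> grad U x) * f x"

definition partition_fun :: "real \<Rightarrow> (real^'d::finite \<Rightarrow> real) \<Rightarrow> real" where
  "partition_fun \<beta> U = (LINT x|lborel. exp (- \<beta> * U x))"

definition confining :: "(real^'d::finite \<Rightarrow> real) \<Rightarrow> bool" where
  "confining U \<longleftrightarrow> filterlim U at_top at_infinity"


section \<open>Rapid decay\<close>

text \<open>The Schwartz space adapted to a potential \<^term>\<open>U\<close>: every operator composed of derivatives,
  multiplications by coordinates and multiplications by first derivatives of \<^term>\<open>U\<close> maps \<^term>\<open>f\<close> to
  a differentiable function that is bounded on \<^term>\<open>S\<close>. It is used for functions of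
  \<open>(x, t)\<close> on \<open>\<real>\<^sup>D \<times> [t\<^sub>i, t\<^sub>f]\<close>, where it expresses smoothness in \<open>(x, t)\<close> together with decay
  in \<open>x\<close> that is uniform in \<open>t\<close>.\<close>

coinductive rapidly_vanishing ::
    "'e::euclidean_space set \<Rightarrow> ('e \<Rightarrow> real) \<Rightarrow> ('e \<Rightarrow> real) \<Rightarrow> bool"
  for S U where
  rapidly_vanishingI: "bounded (f ` S) \<Longrightarrow>
    (\<forall>p\<in>S. (f has_derivative f' p) (at p within S)) \<Longrightarrow>
    (\<forall>b\<in>Basis. rapidly_vanishing S U (\<lambda>p. f' p b)) \<Longrightarrow>
    (\<forall>b\<in>Basis. rapidly_vanishing S U (\<lambda>p. (p \<bullet> b) * f p)) \<Longrightarrow>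
    (\<forall>b\<in>Basis. rapidly_vanishing S U (\<lambda>p. frechet_derivative U (at p within S) b * f p)) \<Longrightarrow>
    rapidly_vanishing S U f"

definition vanishing_on ::
    "real set \<Rightarrow> (real^'d::finite \<Rightarrow> real \<Rightarrow> real) \<Rightarrow> (real^'d \<Rightarrow> real \<Rightarrow> real) \<Rightarrow> bool" where
  "vanishing_on T U f \<longleftrightarrow> rapidly_vanishing (UNIV \<times> T) (\<lambda>(x, t). U x t) (\<lambda>(x, t). f x t)"


section \<open>Complete orthonormal systems with degeneracy labels\<close>

definition square_integrable :: "(real^'d::finite \<Rightarrow> real) \<Rightarrow> bool" where
  "square_integrable f \<longleftrightarrow>
     f \<in> borel_measurable lborel \<and> integrable lborel (\<lambda>x. (f x)\<^sup>2)"

definition complete_orthonormal ::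
    "(nat \<Rightarrow> 'i set) \<Rightarrow> (nat \<Rightarrow> 'i \<Rightarrow> real^'d::finite \<Rightarrow> real) \<Rightarrow> bool" where
  "complete_orthonormal Idx w \<longleftrightarrow>
     (\<forall>n. \<forall>\<alpha>\<in>Idx n. square_integrable (w n \<alpha>)) \<and>
     (\<forall>n m. \<forall>\<alpha>\<in>Idx n. \<forall>\<gamma>\<in>Idx m.
        (LINT x|lborel. w n \<alpha> x * w m \<gamma> x) = (if n = m \<and> \<alpha> = \<gamma> then 1 else 0)) \<and>
     (\<forall>f. square_integrable f \<longrightarrow>
        (\<lambda>k. LINT x|lborel.
           (f x - (\<Sum>n<k. \<Sum>\<alpha>\<in>Idx n. (LINT y|lborel. w n \<alpha> y * f y) * w n \<alpha> x))\<^sup>2)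
        \<longlonglongrightarrow> 0)"


section \<open>Matrices over a finite index set\<close>

definition matrix_inv_on :: "'i set \<Rightarrow> ('i \<Rightarrow> 'i \<Rightarrow> real) \<Rightarrow> 'i \<Rightarrow> 'i \<Rightarrow> real" where
  "matrix_inv_on I A = (THE B.
     (\<forall>\<alpha> \<gamma>. \<alpha> \<notin> I \<or> \<gamma> \<notin> I \<longrightarrow> B \<alpha> \<gamma> = 0) \<and>
     (\<forall>\<alpha>\<in>I. \<forall>\<gamma>\<in>I.
        (\<Sum>\<delta>\<in>I. A \<alpha> \<delta> * B \<delta> \<gamma>) = (if \<alpha> = \<gamma> then 1 else 0) \<and>
        (\<Sum>\<delta>\<in>I. B \<alpha> \<delta> * A \<delta> \<gamma>) = (if \<alpha> = \<gamma> then 1 else 0)))"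


section \<open>The expansion coefficients\<close>

text \<open>The coefficients of \<open>D\<close> are those of a series
  \<open>\<Sum>n. \<Sum>\<alpha>,\<gamma>. exp (- \<integral>\<lambda>\<^sub>n) M\<^sup>n \<alpha> \<gamma> D n \<gamma> foot n \<alpha>\<close>. Such a family is admissible if at each time the
  series converges to a function \<open>r\<close>, and \<open>exp (\<beta> U / 2) r\<close> vanishes rapidly. Since the foot
  states are \<open>exp (- \<beta> U / 2)\<close> times (multiples of) orthonormal functions, the natural mode of
  convergence is that of the L2 space with weight \<open>exp (\<beta> U)\<close>.\<close>

definition admissible_coeffs ::
    "real \<Rightarrow> real \<Rightarrow> real \<Rightarrow> (real^'d::finite \<Rightarrow> real \<Rightarrow> real) \<Rightarrow> (nat \<Rightarrow> 'i set) \<Rightarrow>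
     (nat \<Rightarrow> real \<Rightarrow> real) \<Rightarrow> (nat \<Rightarrow> real \<Rightarrow> 'i \<Rightarrow> 'i \<Rightarrow> real) \<Rightarrow>
     (nat \<Rightarrow> 'i \<Rightarrow> real^'d \<Rightarrow> real \<Rightarrow> real) \<Rightarrow> (nat \<Rightarrow> 'i \<Rightarrow> real \<Rightarrow> real) \<Rightarrow> bool" where
  "admissible_coeffs ti tf \<beta> U Idx lam M foot D \<longleftrightarrow>
     (\<exists>r. vanishing_on {ti..tf} U (\<lambda>x t. exp (\<beta> * U x t / 2) * r x t) \<and>
        (\<forall>t\<in>{ti..tf}.
           (\<lambda>k. LINT x|lborel. exp (\<beta> * U x t) *
              (r x t - (\<Sum>n<k. \<Sum>\<alpha>\<in>Idx n. \<Sum>\<gamma>\<in>Idx n.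
                 exp (- integral {ti..t} (lam n)) * M n t \<alpha> \<gamma> * D n \<gamma> t * foot n \<alpha> x t))\<^sup>2)
           \<longlonglongrightarrow> 0))"

text \<open>The summand with index \<open>m \<noteq> n\<close> in the equation for \<open>D n \<alpha>\<close>.\<close>

definition coupling ::
    "real \<Rightarrow> (nat \<Rightarrow> 'i set) \<Rightarrow> (nat \<Rightarrow> real \<Rightarrow> real) \<Rightarrow>
     (nat \<Rightarrow> real \<Rightarrow> 'i \<Rightarrow> 'i \<Rightarrow> real) \<Rightarrow> (nat \<Rightarrow> nat \<Rightarrow> real \<Rightarrow> 'i \<Rightarrow> 'i \<Rightarrow> real) \<Rightarrow>
     (nat \<Rightarrow> 'i \<Rightarrow> real \<Rightarrow> real) \<Rightarrow> nat \<Rightarrow> 'i \<Rightarrow> 'i \<Rightarrow> real \<Rightarrow> nat \<Rightarrow> real" where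
  "coupling ti Idx lam M Ldot D n \<alpha> \<eta> s m =
     (if m = n then 0 else
        \<Sum>\<gamma>\<in>Idx m. \<Sum>\<delta>\<in>Idx m.
          exp (integral {ti..s} (\<lambda>s'. lam n s' - lam m s')) *
          (matrix_inv_on (Idx n) (M n s) \<alpha> \<eta> * Ldot n m s \<eta> \<gamma> * M m s \<gamma> \<delta>
             / (lam n s - lam m s)) *
          D m \<delta> s)"

definition coeff_equation ::
    "real \<Rightarrow> real \<Rightarrow> (nat \<Rightarrow> 'i::zero set) \<Rightarrow> (nat \<Rightarrow> real \<Rightarrow> real) \<Rightarrow>
     (nat \<Rightarrow> real \<Rightarrow> 'i \<Rightarrow> 'i \<Rightarrow> real) \<Rightarrow> (nat \<Rightarrow> nat \<Rightarrow> real \<Rightarrow> 'i \<Rightarrow> 'i \<Rightarrow> real) \<Rightarrow>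
     (nat \<Rightarrow> 'i \<Rightarrow> real \<Rightarrow> real) \<Rightarrow> bool" where
  "coeff_equation ti tf Idx lam M Ldot D \<longleftrightarrow>
     (\<forall>n. \<forall>\<alpha>\<in>Idx n. D n \<alpha> ti = (if n = 0 \<and> \<alpha> = 0 then 1 else 0)) \<and>
     (\<forall>n. \<forall>\<alpha>\<in>Idx n. \<forall>\<eta>\<in>Idx n. \<forall>s\<in>{ti..tf}. summable (coupling ti Idx lam M Ldot D n \<alpha> \<eta> s)) \<and>
     (\<forall>n. \<forall>\<alpha>\<in>Idx n. \<forall>t\<in>{ti..tf}.
        (\<lambda>s. \<Sum>\<eta>\<in>Idx n. \<Sum>m. coupling ti Idx lam M Ldot D n \<alpha> \<eta> s m) integrable_on {ti..t} \<and>
        D n \<alpha> t = D n \<alpha> ti -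
          integral {ti..t} (\<lambda>s. \<Sum>\<eta>\<in>Idx n. \<Sum>m. coupling ti Idx lam M Ldot D n \<alpha> \<eta> s m))"

end

theory Submission
  imports Defs "HOL-Probability.Sinc_Integral"
begin

text \<open>
  In the ground state representation \<open>\<rho> = exp (- \<beta> V / 2) \<psi>\<close> the Fokker-Planck equation reads
  \<open>\<psi>' = \<beta>/2 V' \<psi> - H \<psi>\<close> with \<open>H\<close> the symmetric Hamiltonian. Expanding \<open>\<psi>\<close> in the eigenfunctions
  and differentiating under the integral sign yields a linear system for the components
  \<open>\<langle>head n \<alpha>, \<rho>\<rangle>\<close>; its off-diagonal part is \<open>\<langle>head n, foot m'\<rangle>\<close>, which the time derivative of the
  eigenvalue equation turns into \<open>Ldot n m / (lam n - lam m)\<close>, and its diagonal part is removed by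
  \<open>exp (\<integral> lam n)\<close> and the inverse of \<open>M n\<close>. Parseval's identity gives the work.

  The factor \<open>\<kappa> = head 0 0 x ti\<close> does not depend on \<open>x\<close>, and it is \<open>\<rho> / \<kappa>\<close> whose coefficients have
  the initial values \<open>\<delta>\<close>; this is why \<open>head 0 0 x ti\<close> appears in the formula for the work.

  Uniqueness of the coefficients: tested against all eigenfunctions, the equation for \<open>D\<close> says that
  the sum of its series solves the Fokker-Planck equation, and solutions are unique by the \<open>L\<^sup>1\<close>
  contraction property. (An \<open>L\<^sup>2\<close> energy estimate is not available, as neither \<open>V'\<close> nor \<open>\<nabla>V\<close>
  is bounded.)
\<close>

section \<open>Smooth functions\<close>

text \<open>No eigenfunction series is ever differentiated or integrated term by term. Each
  coefficient is a space integral, differentiated under the integral sign, and the sum over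
  \<open>m\<close> is Parseval's identity at one fixed time. Hence the right-hand side of the
  equation for \<open>D\<close> has the closed form \<open>Y\<close>, continuous in time; this gives
  its integrability and, in the converse direction, allows the integral equation to be
  differentiated. All interchanges rest on one bound: a rapidly vanishing function stays bounded
  after multiplication by any polynomial in the coordinates, so it is dominated, uniformly in time,
  by a multiple of one integrable \<open>weight\<close>. To carry this from \<psi> to
  \<open>expU\<close> times \<psi>, \<open>expU\<close> must be bounded uniformly in time; that is
  extracted from the ground state, of which \<open>expU\<close> is a multiple at each time.
  Admissibility lets the uniqueness argument return from a family of numbers to a function: it
  supplies the \<psi> to which uniqueness for the partial differential equation applies.\<close>

inductive_set sum_closure :: "('e \<Rightarrow> 'f::comm_monoid_add) set \<Rightarrow> ('e \<Rightarrow> 'f) set" for X where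
  base: "f \<in> X \<Longrightarrow> f \<in> sum_closure X"
| zero: "(\<lambda>_. 0) \<in> sum_closure X"
| add: "f \<in> sum_closure X \<Longrightarrow> g \<in> sum_closure X \<Longrightarrow> (\<lambda>p. f p + g p) \<in> sum_closure X"

lemma sum_closure_sum:
  assumes "finite I" "\<And>i. i \<in> I \<Longrightarrow> f i \<in> sum_closure X"
  shows "(\<lambda>p. \<Sum>i\<in>I. f i p) \<in> sum_closure X"
  using assms by (induction I) (auto intro: sum_closure.intros)

text \<open>Coinduction up to finite sums. A class such as the products of two smooth functions is
  not stable under differentiation, since the product rule yields a sum; its sum closure is stable,
  because derivatives add. The actual invariant \<open>E\<close> asks for agreement on
  \<open>S\<close> only, as a derivative is prescribed at the points of \<open>S\<close>
  alone.\<close>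

lemma smooth_on_coinduct_sum:
  fixes X :: "('e::euclidean_space \<Rightarrow> 'f::real_normed_vector) set"
  assumes step: "\<And>f. f \<in> X \<Longrightarrow> \<exists>f'. (\<forall>p\<in>S. (f has_derivative f' p) (at p within S)) \<and>
                   (\<forall>b\<in>Basis. \<exists>g\<in>sum_closure X. \<forall>p\<in>S. f' p b = g p)"
    and "f \<in> X"
  shows "smooth_on S f"
proof -
  define E where "E h \<longleftrightarrow> (\<exists>g\<in>sum_closure X. \<forall>p\<in>S. h p = g p)" for h
  define Q where "Q f f' \<longleftrightarrow> (\<forall>p\<in>S. (f has_derivative f' p) (at p within S)) \<and>
                   (\<forall>b\<in>Basis. E (\<lambda>p. f' p b))" for f f'
  have Eadd: "E (\<lambda>p. h p + k p)" if "E h" "E k" for h k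
  proof -
    obtain h' k' where "h' \<in> sum_closure X" "\<forall>p\<in>S. h p = h' p" "k' \<in> sum_closure X" "\<forall>p\<in>S. k p = k' p"
      using \<open>E h\<close> \<open>E k\<close> unfolding E_def by blast
    then show ?thesis
      unfolding E_def by (intro bexI[OF _ sum_closure.add[of h' _ k']]) auto
  qed
  have cl: "\<exists>f'. Q f f'" if "f \<in> sum_closure X" for f
    using that
  proof induction
    case (base f)
    then show ?case unfolding Q_def E_def by (rule step)
  next
    case zero
    have "E (\<lambda>_. 0)" unfolding E_def by (intro bexI[OF _ sum_closure.zero]) simp
    then have "Q (\<lambda>_. 0) (\<lambda>_ _. 0)" unfolding Q_def by simp
    then show ?case by (rule exI[of _ "\<lambda>_ _. 0"])
  next
    case (add f g)
    obtain f' where f': "Q f f'" using add.IH(1) ..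
    obtain g' where g': "Q g g'" using add.IH(2) ..
    have "Q (\<lambda>p. f p + g p) (\<lambda>p b. f' p b + g' p b)"
      using f' g' Eadd unfolding Q_def by (auto intro!: has_derivative_add)
    then show ?case by (rule exI[of _ "\<lambda>p b. f' p b + g' p b"])
  qed
  have "E f" using assms unfolding E_def by (auto intro: sum_closure.intros)
  then show ?thesis
  proof (coinduction arbitrary: f)
    case (smooth_on f)
    then obtain g where g: "g \<in> sum_closure X" "\<forall>p\<in>S. f p = g p" unfolding E_def by blast
    obtain f' where f': "Q g f'" using cl[OF g(1)] ..
    then have "\<forall>p\<in>S. (f has_derivative f' p) (at p within S)"
      using g(2) unfolding Q_def by (auto intro: has_derivative_transform)
    then show ?case using f' unfolding Q_def by (intro exI[of _ f] exI[of _ f']) auto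
  qed
qed

text \<open>The derivative witness serves both functions unchanged, so one unfolding is enough and
  no coinduction takes place.\<close>

lemma smooth_on_cong:
  assumes "smooth_on S f" "\<And>p. p \<in> S \<Longrightarrow> g p = f p"
  shows "smooth_on S g"
  using assms(1)
proof cases
  case (smooth_onI f')
  then have "\<forall>p\<in>S. (g has_derivative f' p) (at p within S)"
    using assms(2) by (auto intro: has_derivative_transform)
  then show ?thesis using smooth_onI(2) by (rule smooth_on.smooth_onI)
qed

lemma smooth_onE:
  assumes "smooth_on S f"
  obtains f' where "\<And>p. p \<in> S \<Longrightarrow> (f has_derivative f' p) (at p within S)"
    "\<And>b. b \<in> Basis \<Longrightarrow> smooth_on S (\<lambda>p. f' p b)"
  using assms by cases blast

lemma smooth_onE_real:
  fixes f :: "real \<Rightarrow> 'f::real_normed_vector"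
  assumes "smooth_on T f"
  obtains f' where "\<And>t. t \<in> T \<Longrightarrow> (f has_derivative f' t) (at t within T)" "smooth_on T (\<lambda>t. f' t 1)"
  using assms by cases (simp, blast)

lemma smooth_on_mult:
  fixes f g :: "'e::euclidean_space \<Rightarrow> real"
  assumes "smooth_on S f" "smooth_on S g"
  shows "smooth_on S (\<lambda>p. f p * g p)"
proof (rule smooth_on_coinduct_sum[where X = "{\<lambda>p. f p * g p | f g. smooth_on S f \<and> smooth_on S g}"])
  fix h :: "'e \<Rightarrow> real" assume "h \<in> {\<lambda>p. f p * g p | f g. smooth_on S f \<and> smooth_on S g}"
  then obtain f g :: "'e \<Rightarrow> real" where h: "h = (\<lambda>p. f p * g p)" "smooth_on S f" "smooth_on S g"
    by blast
  obtain f' where f': "\<And>p. p \<in> S \<Longrightarrow> (f has_derivative f' p) (at p within S)"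
    "\<And>b. b \<in> Basis \<Longrightarrow> smooth_on S (\<lambda>p. f' p b)" using h(2) by (rule smooth_onE) blast
  obtain g' where g': "\<And>p. p \<in> S \<Longrightarrow> (g has_derivative g' p) (at p within S)"
    "\<And>b. b \<in> Basis \<Longrightarrow> smooth_on S (\<lambda>p. g' p b)" using h(3) by (rule smooth_onE) blast
  have dh: "(h has_derivative (\<lambda>b. f p * g' p b + f' p b * g p)) (at p within S)" if "p \<in> S" for p
    unfolding h(1) using that by (intro has_derivative_mult f'(1) g'(1))
  show "\<exists>f'. (\<forall>p\<in>S. (h has_derivative f' p) (at p within S)) \<and>
        (\<forall>b\<in>Basis. \<exists>h\<in>sum_closure {\<lambda>p. f p * g p | f g. smooth_on S f \<and> smooth_on S g}. \<forall>p\<in>S. f' p b = h p)"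
  proof (intro exI[of _ "\<lambda>p b. f p * g' p b + f' p b * g p"] conjI ballI)
    fix b :: 'e assume b: "b \<in> Basis"
    have "(\<lambda>p. f p * g' p b) \<in> {\<lambda>p. f p * g p | f g. smooth_on S f \<and> smooth_on S g}"
      using h(2) g'(2)[OF b] by (intro CollectI exI[of _ f] exI[of _ "\<lambda>p. g' p b"]) simp
    moreover have "(\<lambda>p. f' p b * g p) \<in> {\<lambda>p. f p * g p | f g. smooth_on S f \<and> smooth_on S g}"
      using h(3) f'(2)[OF b] by (intro CollectI exI[of _ "\<lambda>p. f' p b"] exI[of _ g]) simp
    ultimately show "\<exists>h\<in>sum_closure {\<lambda>p. f p * g p | f g. smooth_on S f \<and> smooth_on S g}.
        \<forall>p\<in>S. f p * g' p b + f' p b * g p = h p"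
      by (intro bexI[OF _ sum_closure.add[OF sum_closure.base sum_closure.base,
            of "\<lambda>p. f p * g' p b" _ "\<lambda>p. f' p b * g p"]] ballI refl)
  qed (fact dh)
qed (use assms in \<open>intro CollectI exI[of _ f] exI[of _ g] conjI refl\<close>)

lemma smooth_on_const: "smooth_on S (\<lambda>p. c)"
proof -
  \<comment> \<open>The zero function joins the invariant because it is the derivative of the
    constant.\<close>
  have "smooth_on S f" if "f = (\<lambda>p. c) \<or> f = (\<lambda>p. 0)" for f :: "'a \<Rightarrow> 'b"
    using that
  proof (coinduction arbitrary: f)
    case (smooth_on f)
    then show ?case
      by (intro exI[of _ f] exI[of _ "\<lambda>_ _. 0"]) auto
  qed
  then show ?thesis by blast
qed

text \<open>The derivative of \<open>(x, t) \<mapsto> V x (a t) * h t\<close> is a sum of functions of the same shape.\<close>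

lemma smooth_on_compose:
  fixes V :: "'d::euclidean_space \<Rightarrow> 'p::euclidean_space \<Rightarrow> real" and a :: "real \<Rightarrow> 'p"
  assumes V: "smooth_on (UNIV \<times> A) (\<lambda>(x, b). V x b)"
    and a: "smooth_on T a" and aA: "a ` T \<subseteq> A"
  shows "smooth_on (UNIV \<times> T) (\<lambda>(x, t). V x (a t))"
proof -
  define X where "X = {\<lambda>p. G (fst p, a (snd p)) * h (snd p) | G h.
      smooth_on (UNIV \<times> A) (G :: 'd \<times> 'p \<Rightarrow> real) \<and> smooth_on T (h :: real \<Rightarrow> real)}"
  obtain a' where a': "\<And>t. t \<in> T \<Longrightarrow> (a has_derivative a' t) (at t within T)"
    and a1: "smooth_on T (\<lambda>t. a' t 1)"
    using smooth_onE_real[OF a] by blast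
  \<comment> \<open>The protocol is vector-valued but the factor \<open>h\<close> in
    \<open>X\<close> is real, so the components of the velocity need a coinduction of their
    own.\<close>
  have a1j: "smooth_on T (\<lambda>t. a' t 1 \<bullet> j)" for j
  proof (rule smooth_on_coinduct_sum[where X="{\<lambda>t. k t \<bullet> j | k. smooth_on T (k :: real \<Rightarrow> 'p)}"])
    fix f assume "f \<in> {\<lambda>t. k t \<bullet> j | k. smooth_on T (k :: real \<Rightarrow> 'p)}"
    then obtain k :: "real \<Rightarrow> 'p" where f: "f = (\<lambda>t. k t \<bullet> j)" and k: "smooth_on T k"
      by (elim CollectE exE conjE)
    obtain k' where k': "\<And>t. t \<in> T \<Longrightarrow> (k has_derivative k' t) (at t within T)"
      "smooth_on T (\<lambda>t. k' t 1)"
      using smooth_onE_real[OF k] by blast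
    have "(\<lambda>t. k' t 1 \<bullet> j) \<in> {\<lambda>t. k t \<bullet> j | k. smooth_on T (k :: real \<Rightarrow> 'p)}"
      using k' by (intro CollectI exI[of _ "\<lambda>t. k' t 1"] conjI refl)
    then have "\<forall>b\<in>Basis. \<exists>h\<in>sum_closure {\<lambda>t. k t \<bullet> j | k. smooth_on T (k :: real \<Rightarrow> 'p)}.
        \<forall>p\<in>T. k' p b \<bullet> j = h p"
      unfolding Basis_real_def by (simp only: ball_simps) (intro bexI[OF _ sum_closure.base] conjI; simp)
    then show "\<exists>f'. (\<forall>p\<in>T. (f has_derivative f' p) (at p within T)) \<and>
        (\<forall>b\<in>Basis. \<exists>h\<in>sum_closure {\<lambda>t. k t \<bullet> j | k. smooth_on T (k :: real \<Rightarrow> 'p)}. \<forall>p\<in>T. f' p b = h p)"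
      unfolding f using k'(1)
      by (intro exI[of _ "\<lambda>p b. k' p b \<bullet> j"] conjI) (auto intro: has_derivative_inner_left)
  qed (use a1 in \<open>intro CollectI exI[of _ "\<lambda>t. a' t 1"] conjI refl\<close>)
  have "smooth_on (UNIV \<times> T) f" if "f \<in> X" for f
  proof (rule smooth_on_coinduct_sum[where X = X])
    fix f assume "f \<in> X"
    then obtain G h where f: "f = (\<lambda>p. G (fst p, a (snd p)) * h (snd p))"
      and G: "smooth_on (UNIV \<times> A) (G :: 'd \<times> 'p \<Rightarrow> real)" and h: "smooth_on T (h :: real \<Rightarrow> real)"
      unfolding X_def by (elim CollectE exE conjE)
    obtain G' where G': "\<And>p. p \<in> UNIV \<times> A \<Longrightarrow> (G has_derivative G' p) (at p within UNIV \<times> A)"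
      and G'b: "\<And>b. b \<in> Basis \<Longrightarrow> smooth_on (UNIV \<times> A) (\<lambda>p. G' p b)" using G by (rule smooth_onE) blast
    obtain h' where h': "\<And>p. p \<in> T \<Longrightarrow> (h has_derivative h' p) (at p within T)"
      and h'b: "smooth_on T (\<lambda>p. h' p 1)"
      using smooth_onE_real[OF h] by blast
    define F where "F p b = G (fst p, a (snd p)) * h' (snd p) (snd b)
         + G' (fst p, a (snd p)) (fst b, a' (snd p) (snd b)) * h (snd p)" for p and b :: "'d \<times> real"
    have dF: "(f has_derivative F p) (at p within UNIV \<times> T)" if p: "p \<in> UNIV \<times> T" for p
    proof -
      obtain x t where [simp]: "p = (x, t)" and t: "t \<in> T" using p by auto
      have d0: "(snd has_derivative snd) (at p within UNIV \<times> T)"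
        by (intro derivative_intros)
      have d1: "((\<lambda>p. a (snd p)) has_derivative (\<lambda>b. a' t (snd b))) (at p within UNIV \<times> T)"
        using has_derivative_in_compose2[of T a a' snd "UNIV \<times> T" p snd, OF _ _ _ d0] a' t by auto
      have d2: "((\<lambda>p. h (snd p)) has_derivative (\<lambda>b. h' t (snd b))) (at p within UNIV \<times> T)"
        using has_derivative_in_compose2[of T h h' snd "UNIV \<times> T" p snd, OF _ _ _ d0] h' t by auto
      have d3: "((\<lambda>p. (fst p, a (snd p))) has_derivative (\<lambda>b. (fst b, a' t (snd b)))) (at p within UNIV \<times> T)"
        by (intro has_derivative_Pair d1 derivative_intros)
      have d4: "((\<lambda>p. G (fst p, a (snd p))) has_derivative (\<lambda>b. G' (x, a t) (fst b, a' t (snd b))))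
          (at p within UNIV \<times> T)"
      proof -
        have "(\<lambda>p. (fst p, a (snd p))) ` (UNIV \<times> T) \<subseteq> UNIV \<times> A" using aA by auto
        from has_derivative_in_compose2[of "UNIV \<times> A" G G' "\<lambda>p. (fst p, a (snd p))" "UNIV \<times> T" p,
            OF G' this p d3] show ?thesis by simp
      qed
      show ?thesis unfolding f F_def[abs_def] using has_derivative_mult[OF d4 d2] by simp
    qed
    have Fb: "\<exists>g\<in>sum_closure X. \<forall>p\<in>UNIV \<times> T. F p b = g p" if b: "b \<in> Basis" for b
    proof -
      \<comment> \<open>A spatial direction has time component 0, so the velocity and the derivative
        of \<open>h\<close> contribute nothing along it.\<close>
      have zero: "a' t 0 = 0" "h' t 0 = 0" if "t \<in> T" for t
        using has_derivative_bounded_linear[OF a'[OF that]] has_derivative_bounded_linear[OF h'[OF that]]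
        by (simp_all add: linear_simps)
      consider e where "e \<in> Basis" "b = (e, 0)" | "b = (0, 1)"
        using b by (auto simp: Basis_prod_def)
      then show ?thesis
      proof cases
        case 1
        have "(\<lambda>p. G' (fst p, a (snd p)) (e, 0) * h (snd p)) \<in> X"
          unfolding X_def using G'b[of "(e,0)"] h 1(1)
          by (intro CollectI exI[of _ "\<lambda>p. G' p (e, 0)"] exI[of _ h] conjI refl) (simp_all add: Basis_prod_def)
        moreover have "F p b = G' (fst p, a (snd p)) (e, 0) * h (snd p)" if "p \<in> UNIV \<times> T" for p
          using that 1 zero by (auto simp: F_def)
        ultimately show ?thesis by (intro bexI[OF _ sum_closure.base]) auto
      next
        case 2
        \<comment> \<open>Smoothness of \<open>G\<close> controls its derivative in basis directions
          only. The velocity is therefore expanded in the basis of the parameter space, and its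
          components move into the factor that depends on time alone.\<close>
        define k where "k j p = G' (fst p, a (snd p)) (0, j) * ((a' (snd p) 1 \<bullet> j) * h (snd p))" for j p
        have "k j \<in> X" if "j \<in> Basis" for j
          unfolding X_def k_def using that G'b[of "(0,j)"] h a1j
          by (intro CollectI exI[of _ "\<lambda>p. G' p (0, j)"] exI[of _ "\<lambda>t. (a' t 1 \<bullet> j) * h t"] conjI refl
               smooth_on_mult) (simp_all add: Basis_prod_def)
        then have "(\<lambda>p. \<Sum>j\<in>Basis. k j p) \<in> sum_closure X"
          by (intro sum_closure_sum) (auto intro: sum_closure.base)
        moreover have "(\<lambda>p. G (fst p, a (snd p)) * h' (snd p) 1) \<in> X"
          unfolding X_def using G h'b
          by (intro CollectI exI[of _ G] exI[of _ "\<lambda>t. h' t 1"] conjI refl)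
        ultimately have "(\<lambda>p. G (fst p, a (snd p)) * h' (snd p) 1 + (\<Sum>j\<in>Basis. k j p)) \<in> sum_closure X"
          by (intro sum_closure.add[of "\<lambda>p. G (fst p, a (snd p)) * h' (snd p) 1"]) (auto intro: sum_closure.base)
        moreover have "F p b = G (fst p, a (snd p)) * h' (snd p) 1 + (\<Sum>j\<in>Basis. k j p)" if p: "p \<in> UNIV \<times> T" for p
        proof -
          obtain x t where [simp]: "p = (x, t)" and t: "t \<in> T" using p by auto
          have bl: "bounded_linear (G' (x, a t))"
            using G'[of "(x, a t)"] aA t by (auto intro: has_derivative_bounded_linear)
          have "(0, a' t 1) = (\<Sum>j\<in>Basis. (a' t 1 \<bullet> j) *\<^sub>R (0::'d, j))"
            by (simp add: prod_eq_iff fst_sum snd_sum euclidean_representation)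
          then have "G' (x, a t) (0, a' t 1) = (\<Sum>j\<in>Basis. (a' t 1 \<bullet> j) * G' (x, a t) (0, j))"
            using linear_sum[OF bounded_linear.linear[OF bl], of "\<lambda>j. (a' t 1 \<bullet> j) *\<^sub>R (0, j)" Basis]
            by (simp only: linear_simps[OF bl] real_scaleR_def)
          then show ?thesis using 2 by (simp add: F_def k_def sum_distrib_right sum_distrib_left algebra_simps)
        qed
        ultimately show ?thesis by (intro bexI) auto
      qed
    qed
    show "\<exists>f'. (\<forall>p\<in>UNIV \<times> T. (f has_derivative f' p) (at p within UNIV \<times> T)) \<and>
        (\<forall>b\<in>Basis. \<exists>g\<in>sum_closure X. \<forall>p\<in>UNIV \<times> T. f' p b = g p)"
      using dF Fb by (intro exI[of _ F] conjI ballI)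
  qed (rule that)
  moreover have "(\<lambda>p. (\<lambda>(x, b). V x b) (fst p, a (snd p)) * 1) \<in> X"
    unfolding X_def using V smooth_on_const[of T "1::real"]
    by (intro CollectI exI[of _ "\<lambda>(x, b). V x b"] exI[of _ "\<lambda>_. 1"] conjI refl)
  ultimately have "smooth_on (UNIV \<times> T) (\<lambda>p. (\<lambda>(x, b). V x b) (fst p, a (snd p)) * 1)"
    by blast
  then show ?thesis by (simp add: case_prod_unfold)
qed

text \<open>The relational form also records that the derivative exists;
  \<open>partial_deriv\<close> is built on \<open>deriv\<close>, whose value says nothing without
  existence.\<close>

definition has_partial :: "'d::finite \<Rightarrow> (real^'d \<Rightarrow> real) \<Rightarrow> real^'d \<Rightarrow> real \<Rightarrow> bool" where
  "has_partial i f x d \<longleftrightarrow> ((\<lambda>h. f (x + h *\<^sub>R axis i 1)) has_real_derivative d) (at 0)"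

lemma has_partial_imp_partial_deriv: "has_partial i f x d \<Longrightarrow> partial_deriv i f x = d"
  unfolding has_partial_def partial_deriv_def by (rule DERIV_imp_deriv)

text \<open>The Leibniz rule and the translation argument differentiate along a whole line, not only
  at its base point.\<close>

lemma has_partial_shift:
  assumes "has_partial i f (x + s *\<^sub>R axis i 1) d"
  shows "((\<lambda>h. f (x + h *\<^sub>R axis i 1)) has_real_derivative d) (at s)"
  using assms unfolding has_partial_def
  by (subst DERIV_shift[of _ _ 0 s, simplified]) (simp add: algebra_simps scaleR_add_left)

lemma has_partial_add: "has_partial i f x a \<Longrightarrow> has_partial i g x b \<Longrightarrow> has_partial i (\<lambda>y. f y + g y) x (a + b)"
  unfolding has_partial_def by (rule DERIV_add)

lemma has_partial_diff: "has_partial i f x a \<Longrightarrow> has_partial i g x b \<Longrightarrow> has_partial i (\<lambda>y. f y - g y) x (a - b)"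
  unfolding has_partial_def by (rule DERIV_diff)

lemma has_partial_mult:
  "has_partial i f x a \<Longrightarrow> has_partial i g x b \<Longrightarrow> has_partial i (\<lambda>y. f y * g y) x (a * g x + f x * b)"
  unfolding has_partial_def by (auto intro!: derivative_eq_intros)

lemma has_partial_cmult: "has_partial i f x a \<Longrightarrow> has_partial i (\<lambda>y. c * f y) x (c * a)"
  unfolding has_partial_def by (rule DERIV_cmult)

lemma has_partial_compose:
  assumes "(\<phi> has_real_derivative d) (at (f x))" "has_partial i f x a"
  shows "has_partial i (\<lambda>y. \<phi> (f y)) x (d * a)"
  using DERIV_chain2[of \<phi> d "\<lambda>h. f (x + h *\<^sub>R axis i 1)" 0 a UNIV] assms unfolding has_partial_def by simp

definition dx :: "'d::finite \<Rightarrow> (real^'d \<Rightarrow> real \<Rightarrow> real) \<Rightarrow> real^'d \<Rightarrow> real \<Rightarrow> real" where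
  "dx i f x t = partial_deriv i (\<lambda>y. f y t) x"

section \<open>Functions on spacetime and their partial derivatives\<close>

locale time_interval =
  fixes ti tf :: real
  assumes ti_less_tf: "ti < tf"
begin

definition "dt f x = time_deriv {ti..tf} (f x)" for f :: "real^'d::finite \<Rightarrow> real \<Rightarrow> real"

abbreviation spacetime :: "((real^'d::finite) \<times> real) set" where
  "spacetime \<equiv> UNIV \<times> {ti..tf}"

text \<open>Here \<open>ti < tf\<close> enters: in a nondegenerate interval a one-sided derivative
  at an end point is unique as well, so any derivative that is found is the value of
  \<open>time_deriv\<close>.\<close>

lemma time_deriv_eq:
  assumes "(f has_real_derivative d) (at t within {ti..tf})" "t \<in> {ti..tf}"
  shows "time_deriv {ti..tf} f t = d"
  unfolding time_deriv_def
  by (rule vector_derivative_within_closed_interval[OF ti_less_tf assms(2)])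
     (use assms(1) in \<open>simp add: has_real_derivative_iff_has_vector_derivative\<close>)

lemma dt_eq: "(f x has_real_derivative d) (at t within {ti..tf}) \<Longrightarrow> t \<in> {ti..tf} \<Longrightarrow> dt f x t = d"
  unfolding dt_def by (rule time_deriv_eq)

lemma dx_eq: "has_partial i (\<lambda>y. f y t) x d \<Longrightarrow> dx i f x t = d"
  unfolding dx_def by (rule has_partial_imp_partial_deriv)

text \<open>Differentiability within spacetime restricts to the line in direction \<open>i\<close>,
  which stays in the slice \<open>t\<close> even when \<open>t\<close> is an end point.\<close>

lemma has_partial_of_has_derivative:
  fixes f :: "real^'d::finite \<Rightarrow> real \<Rightarrow> real"
  assumes F: "((\<lambda>(x, t). f x t) has_derivative F) (at (x, t) within spacetime)" and t: "t \<in> {ti..tf}"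
  shows "has_partial i (\<lambda>y. f y t) x (F (axis i 1, 0))"
proof -
  have lin: "((\<lambda>h::real. (x + h *\<^sub>R axis i 1, t)) has_derivative (\<lambda>h. (h *\<^sub>R axis i 1, 0))) (at 0 within UNIV)"
    by (auto intro!: derivative_eq_intros)
  have F0: "((\<lambda>(x, t). f x t) has_derivative F) (at (x + 0 *\<^sub>R axis i 1, t) within
      ((\<lambda>h::real. (x + h *\<^sub>R axis i 1, t)) ` UNIV))"
    using t by simp (rule has_derivative_subset[OF F], auto)
  have "((\<lambda>h. f (x + h *\<^sub>R axis i 1) t) has_derivative (\<lambda>h. F (h *\<^sub>R axis i 1, 0))) (at 0)"
    using has_derivative_in_compose[OF lin F0] by simp
  moreover have "(\<lambda>h. F (h *\<^sub>R axis i 1, 0)) = (*) (F (axis i 1, 0))"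
  proof
    show "F (h *\<^sub>R axis i 1, 0) = F (axis i 1, 0) * h" for h
      using linear_simps(5)[OF has_derivative_bounded_linear[OF F], of h "(axis i 1, 0)"] by simp
  qed
  ultimately show ?thesis unfolding has_partial_def has_field_derivative_def by (simp only:)
qed

lemma has_dt_of_has_derivative:
  fixes f :: "real^'d::finite \<Rightarrow> real \<Rightarrow> real"
  assumes F: "((\<lambda>(x, t). f x t) has_derivative F) (at (x, t) within spacetime)" and t: "t \<in> {ti..tf}"
  shows "(f x has_real_derivative F (0, 1)) (at t within {ti..tf})"
proof -
  have lin: "((\<lambda>s::real. (x, s)) has_derivative (\<lambda>h. (0, h))) (at t within {ti..tf})"
    by (auto intro!: derivative_eq_intros)
  have F0: "((\<lambda>(x, t). f x t) has_derivative F) (at (x, t) within ((\<lambda>s::real. (x, s)) ` {ti..tf}))"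
    by (rule has_derivative_subset[OF F]) auto
  have "((\<lambda>s. f x s) has_derivative (\<lambda>h. F (0, h))) (at t within {ti..tf})"
    using has_derivative_in_compose[OF lin F0] by simp
  moreover have "(\<lambda>h. F (0, h)) = (*) (F (0, 1))"
  proof
    show "F (0, h) = F (0, 1) * h" for h
      using linear_simps(5)[OF has_derivative_bounded_linear[OF F], of h "(0, 1)"] by simp
  qed
  ultimately show ?thesis unfolding has_field_derivative_def by (simp only:)
qed

definition "smooth f \<longleftrightarrow> smooth_on spacetime (\<lambda>(x, t). f x t)" for f :: "real^'d::finite \<Rightarrow> real \<Rightarrow> real"

lemma axis_Basis: "(axis i 1 :: real^'d::finite, 0::real) \<in> Basis" "(0 :: real^'d::finite, 1::real) \<in> Basis"
  by (auto simp: Basis_prod_def)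

lemma smooth_dx_aux:
  fixes f :: "real^'d::finite \<Rightarrow> real \<Rightarrow> real"
  assumes "smooth f"
  shows "smooth (dx i f)" "t \<in> {ti..tf} \<Longrightarrow> has_partial i (\<lambda>y. f y t) x (dx i f x t)"
    and "smooth (dt f)" "t \<in> {ti..tf} \<Longrightarrow> (f x has_real_derivative dt f x t) (at t within {ti..tf})"
    and "continuous_on spacetime (\<lambda>(x, t). f x t)"
proof -
  obtain f' where f': "\<And>p. p \<in> spacetime \<Longrightarrow> ((\<lambda>(x, t). f x t) has_derivative f' p) (at p within spacetime)"
    and sm: "\<And>b. b \<in> Basis \<Longrightarrow> smooth_on spacetime (\<lambda>p. f' p b)"
    using assms unfolding smooth_def by (rule smooth_onE) (rule that)
  have hx: "has_partial i (\<lambda>y. f y t) x (f' (x, t) (axis i 1, 0))" if "t \<in> {ti..tf}" for x t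
    using that by (intro has_partial_of_has_derivative f') auto
  have ht: "(f x has_real_derivative f' (x, t) (0, 1)) (at t within {ti..tf})" if "t \<in> {ti..tf}" for x t
    using that by (intro has_dt_of_has_derivative f') auto
  have ex: "dx i f x t = f' (x, t) (axis i 1, 0)" if "t \<in> {ti..tf}" for x t
    by (intro dx_eq hx that)
  have et: "dt f x t = f' (x, t) (0, 1)" if "t \<in> {ti..tf}" for x t
    by (intro dt_eq ht that)
  show "smooth (dx i f)" unfolding smooth_def
    by (rule smooth_on_cong[OF sm[OF axis_Basis(1)[of i]]]) (auto simp: ex)
  show "smooth (dt f)" unfolding smooth_def
    by (rule smooth_on_cong[OF sm[OF axis_Basis(2)]]) (auto simp: et)
  show "t \<in> {ti..tf} \<Longrightarrow> has_partial i (\<lambda>y. f y t) x (dx i f x t)" using hx by (simp add: ex)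
  show "t \<in> {ti..tf} \<Longrightarrow> (f x has_real_derivative dt f x t) (at t within {ti..tf})" using ht by (simp add: et)
  show "continuous_on spacetime (\<lambda>(x, t). f x t)"
    using f' by (meson continuous_on_eq_continuous_within has_derivative_continuous)
qed

lemmas smooth_dx = smooth_dx_aux(1)
lemmas smooth_has_dx = smooth_dx_aux(2)
lemmas smooth_dt = smooth_dx_aux(3)
lemmas smooth_has_dt = smooth_dx_aux(4)
lemmas smooth_continuous = smooth_dx_aux(5)

lemma smooth_continuous_compose:
  fixes f :: "real^'d::finite \<Rightarrow> real \<Rightarrow> real"
  assumes "smooth f" "continuous_on A g" "continuous_on A s" "s ` A \<subseteq> {ti..tf}"
  shows "continuous_on A (\<lambda>z. f (g z) (s z))"
proof -
  have "(\<lambda>z. (g z, s z)) ` A \<subseteq> spacetime" using assms(4) by auto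
  then have "continuous_on A ((\<lambda>(x, t). f x t) \<circ> (\<lambda>z. (g z, s z)))"
    using continuous_on_compose[OF continuous_on_Pair[OF assms(2,3)]]
      continuous_on_subset[OF smooth_continuous[OF assms(1)]] by blast
  then show ?thesis by (simp add: o_def)
qed

lemma smooth_continuous_t:
  fixes f :: "real^'d::finite \<Rightarrow> real \<Rightarrow> real"
  assumes "smooth f" shows "continuous_on {ti..tf} (f x)"
  using smooth_continuous_compose[OF assms, of "{ti..tf}" "\<lambda>_. x" "\<lambda>t. t"] by (simp add: continuous_on_id)

text \<open>The mixed derivatives agree up to the end points of the time interval: differentiate
  \<open>f x t - f x ti = integral {ti..t} (dt f x)\<close> under the integral sign.\<close>

lemma smooth_mixed:
  fixes f :: "real^'d::finite \<Rightarrow> real \<Rightarrow> real"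
  assumes f: "smooth f" and t: "t \<in> {ti..tf}"
  shows "dt (dx i f) x t = dx i (dt f) x t"
proof -
  let ?e = "axis i 1 :: real^'d"
  have FTC: "((dt f y) has_integral (f y s - f y ti)) {ti..s}" if "s \<in> {ti..tf}" for y s
  proof (rule fundamental_theorem_of_calculus)
    show "(f y has_vector_derivative dt f y r) (at r within {ti..s})" if "r \<in> {ti..s}" for r
      unfolding has_real_derivative_iff_has_vector_derivative[symmetric]
      using that \<open>s \<in> {ti..tf}\<close> by (intro DERIV_subset[OF smooth_has_dt[OF f, of r y], of "{ti..s}"]) auto
  qed (use \<open>s \<in> {ti..tf}\<close> in auto)
  have cont: "continuous_on (UNIV \<times> {ti..tf}) (\<lambda>(h, r). dx i (dt f) (x + h *\<^sub>R ?e) r)"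
    unfolding case_prod_unfold
    by (rule smooth_continuous_compose[OF smooth_dx[OF smooth_dt[OF f]]]) (auto intro!: continuous_intros)
  have eq: "dx i f x s = dx i f x ti + integral {ti..s} (dx i (dt f) x)" if s: "s \<in> {ti..tf}" for s
  proof -
    have "((\<lambda>h. integral (cbox ti s) (\<lambda>r. dt f (x + h *\<^sub>R ?e) r)) has_field_derivative
        integral (cbox ti s) (\<lambda>r. dx i (dt f) (x + 0 *\<^sub>R ?e) r)) (at 0 within UNIV)"
    proof (rule leibniz_rule_field_derivative)
      show "((\<lambda>h. dt f (x + h *\<^sub>R ?e) r) has_field_derivative dx i (dt f) (x + h *\<^sub>R ?e) r) (at h within UNIV)"
        if "r \<in> cbox ti s" for h r
        using that s by (intro has_partial_shift[of i "\<lambda>y. dt f y r"] smooth_has_dx smooth_dt f) auto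
      show "(\<lambda>r. dt f (x + h *\<^sub>R ?e) r) integrable_on cbox ti s" for h
        using FTC[OF s] by (auto simp: has_integral_integrable_integral)
      show "continuous_on (UNIV \<times> cbox ti s) (\<lambda>(h, r). dx i (dt f) (x + h *\<^sub>R ?e) r)"
        using s by (intro continuous_on_subset[OF cont]) auto
    qed auto
    moreover have "integral (cbox ti s) (\<lambda>r. dt f y r) = f y s - f y ti" for y
      using FTC[OF s, of y] by (simp add: integral_unique)
    \<comment> \<open>\<open>h1\<close> and \<open>h2\<close> differentiate the same increment, once
      under the integral and once termwise; uniqueness of partial derivatives equates the
      results.\<close>
    ultimately have h1: "has_partial i (\<lambda>y. f y s - f y ti) x (integral {ti..s} (dx i (dt f) x))"
      unfolding has_partial_def by simp
    have h2: "has_partial i (\<lambda>y. f y s - f y ti) x (dx i f x s - dx i f x ti)"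
      using s by (intro has_partial_diff smooth_has_dx f) auto
    show ?thesis using has_partial_imp_partial_deriv[OF h1] has_partial_imp_partial_deriv[OF h2] by simp
  qed
  have "((\<lambda>s. integral {ti..s} (dx i (dt f) x)) has_real_derivative dx i (dt f) x t) (at t within {ti..tf})"
    by (rule integral_has_real_derivative[OF smooth_continuous_t[OF smooth_dx[OF smooth_dt[OF f]]] t])
  then have "((\<lambda>s. dx i f x ti + integral {ti..s} (dx i (dt f) x)) has_real_derivative 0 + dx i (dt f) x t)
      (at t within {ti..tf})"
    by (rule DERIV_add[OF DERIV_const])
  then have "(dx i f x has_real_derivative 0 + dx i (dt f) x t) (at t within {ti..tf})"
    unfolding has_field_derivative_def
    using has_derivative_transform[of t "{ti..tf}" "dx i f x"
        "\<lambda>s. dx i f x ti + integral {ti..s} (dx i (dt f) x)", OF t eq] by blast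
  then show ?thesis using dt_eq[where f="dx i f" and x=x and d="0 + dx i (dt f) x t", OF _ t] by simp
qed

end

section \<open>Closure properties of rapidly vanishing functions\<close>

lemma rapidly_vanishing_cong:
  assumes "rapidly_vanishing S U f" "\<And>p. p \<in> S \<Longrightarrow> g p = f p"
  shows "rapidly_vanishing S U g"
proof -
  \<comment> \<open>Unlike in \<open>smooth_on_cong\<close>, coinduction is needed: not only the
    derivative but the function itself returns, multiplied by coordinates and by derivatives of
    \<open>U\<close>.\<close>
  have "\<exists>f. rapidly_vanishing S U f \<and> (\<forall>p\<in>S. g p = f p)" using assms by blast
  then show ?thesis
  proof (coinduction arbitrary: g)
    case (rapidly_vanishing g)
    then obtain f where f: "rapidly_vanishing S U f" and gf: "\<forall>p\<in>S. g p = f p" by blast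
    from f show ?case
    proof cases
      case (rapidly_vanishingI f')
      have "g ` S = f ` S" using gf by (intro image_cong) auto
      moreover have "\<forall>p\<in>S. (g has_derivative f' p) (at p within S)"
      proof
        fix p assume p: "p \<in> S"
        have "(f has_derivative f' p) (at p within S)" using rapidly_vanishingI(2) p ..
        then show "(g has_derivative f' p) (at p within S)"
          by (rule has_derivative_transform[OF p, rotated]) (use gf in simp)
      qed
      moreover have "\<exists>h. rapidly_vanishing S U h \<and> (\<forall>p\<in>S. (p \<bullet> b) * g p = h p)" if "b \<in> Basis" for b
        using rapidly_vanishingI(4) that gf by (intro exI[of _ "\<lambda>p. (p \<bullet> b) * f p"]) simp
      moreover have "\<exists>h. rapidly_vanishing S U h \<and>
          (\<forall>p\<in>S. frechet_derivative U (at p within S) b * g p = h p)" if "b \<in> Basis" for b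
        using rapidly_vanishingI(5) that gf
        by (intro exI[of _ "\<lambda>p. frechet_derivative U (at p within S) b * f p"]) simp
      ultimately show ?thesis using rapidly_vanishingI(1,3)
        by (intro exI[of _ g] exI[of _ f']) simp
    qed
  qed
qed

text \<open>Every operation in the definition is linear, so the combinations with these fixed
  \<open>c\<close> and \<open>d\<close> already form an invariant class.\<close>

lemma rapidly_vanishing_lincomb:
  assumes "rapidly_vanishing S U f" "rapidly_vanishing S U g"
  shows "rapidly_vanishing S U (\<lambda>p. c * f p + d * g p)"
proof -
  define P where "P h \<longleftrightarrow> (\<exists>f g. rapidly_vanishing S U f \<and> rapidly_vanishing S U g \<and>
      h = (\<lambda>p. c * f p + d * g p))" for h
  have P: "P (\<lambda>p. c * f p + d * g p)" if "rapidly_vanishing S U f" "rapidly_vanishing S U g" for f g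
    unfolding P_def using that by (intro exI[of _ f] exI[of _ g]) simp
  have "rapidly_vanishing S U h" if "P h" for h
    using that
  proof (coinduction arbitrary: h)
    case (rapidly_vanishing h)
    then obtain f g where f: "rapidly_vanishing S U f" and g: "rapidly_vanishing S U g"
      and h: "h = (\<lambda>p. c * f p + d * g p)" unfolding P_def by (elim exE conjE)
    obtain f' where f1: "bounded (f ` S)" and f2: "\<forall>p\<in>S. (f has_derivative f' p) (at p within S)"
      and f3: "\<forall>b\<in>Basis. rapidly_vanishing S U (\<lambda>p. f' p b)"
      and f4: "\<forall>b\<in>Basis. rapidly_vanishing S U (\<lambda>p. (p \<bullet> b) * f p)"
      and f5: "\<forall>b\<in>Basis. rapidly_vanishing S U (\<lambda>p. frechet_derivative U (at p within S) b * f p)"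
      using f by cases (rule that)
    obtain g' where g1: "bounded (g ` S)" and g2: "\<forall>p\<in>S. (g has_derivative g' p) (at p within S)"
      and g3: "\<forall>b\<in>Basis. rapidly_vanishing S U (\<lambda>p. g' p b)"
      and g4: "\<forall>b\<in>Basis. rapidly_vanishing S U (\<lambda>p. (p \<bullet> b) * g p)"
      and g5: "\<forall>b\<in>Basis. rapidly_vanishing S U (\<lambda>p. frechet_derivative U (at p within S) b * g p)"
      using g by cases (rule that)
    have h1: "bounded (h ` S)"
    proof -
      obtain A B where "\<forall>x\<in>S. \<bar>f x\<bar> \<le> A" "\<forall>x\<in>S. \<bar>g x\<bar> \<le> B"
        using f1 g1 by (auto simp: bounded_real)
      then have "\<bar>c * f x + d * g x\<bar> \<le> \<bar>c\<bar> * A + \<bar>d\<bar> * B" if "x \<in> S" for x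
        using that by (intro order_trans[OF abs_triangle_ineq] add_mono) (simp_all add: abs_mult mult_left_mono)
      then show ?thesis unfolding h bounded_real by auto
    qed
    have h2: "\<forall>p\<in>S. (h has_derivative (\<lambda>b. c * f' p b + d * g' p b)) (at p within S)"
      unfolding h using f2 g2 by (intro ballI has_derivative_add has_derivative_mult_right) auto
    have h3: "P (\<lambda>p. c * f' p b + d * g' p b)" if "b \<in> Basis" for b
      using f3 g3 that by (intro P) auto
    have h4: "P (\<lambda>p. (p \<bullet> b) * h p)" if "b \<in> Basis" for b
      using P[of "\<lambda>p. (p \<bullet> b) * f p" "\<lambda>p. (p \<bullet> b) * g p"] f4 g4 that
      unfolding h by (simp add: algebra_simps)
    have h5: "P (\<lambda>p. frechet_derivative U (at p within S) b * h p)" if "b \<in> Basis" for b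
      using P[of "\<lambda>p. frechet_derivative U (at p within S) b * f p"
          "\<lambda>p. frechet_derivative U (at p within S) b * g p"] f5 g5 that
      unfolding h by (simp add: algebra_simps)
    show ?case
      using h1 h2 h3 h4 h5 by (intro exI[of _ h] exI[of _ "\<lambda>p b. c * f' p b + d * g' p b"]) simp
  qed
  then show ?thesis using P assms by blast
qed

lemma rapidly_vanishing_smooth_on:
  assumes "rapidly_vanishing S U f"
  shows "smooth_on S f"
  using assms
proof (coinduction arbitrary: f)
  case (smooth_on f)
  then show ?case
  proof cases
    case (rapidly_vanishingI f')
    then show ?thesis by (intro exI[of _ f] exI[of _ f']) simp
  qed
qed

locale moving_potential = time_interval +
  fixes U :: "real^'d::finite \<Rightarrow> real \<Rightarrow> real"
  assumes smooth_U: "smooth U"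
begin

definition "van f \<longleftrightarrow> vanishing_on {ti..tf} U f"

lemma van_smooth: "van f \<Longrightarrow> smooth f"
  unfolding van_def smooth_def vanishing_on_def by (rule rapidly_vanishing_smooth_on)

lemma van_cong:
  assumes "van f" "\<And>x t. t \<in> {ti..tf} \<Longrightarrow> g x t = f x t"
  shows "van g"
  using assms(1) unfolding van_def vanishing_on_def
  by (rule rapidly_vanishing_cong) (use assms(2) in auto)

lemma van_lincomb:
  assumes "van f" "van g" shows "van (\<lambda>x t. c * f x t + d * g x t)"
  using rapidly_vanishing_lincomb[of spacetime "\<lambda>(x, t). U x t" "\<lambda>(x, t). f x t" "\<lambda>(x, t). g x t" c d] assms
  unfolding van_def vanishing_on_def by (simp add: case_prod_unfold)

lemma van_add: "van f \<Longrightarrow> van g \<Longrightarrow> van (\<lambda>x t. f x t + g x t)"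
  using van_lincomb[of f g 1 1] by simp

lemma van_diff: "van f \<Longrightarrow> van g \<Longrightarrow> van (\<lambda>x t. f x t - g x t)"
  using van_lincomb[of f g 1 "-1"] by simp

lemma van_cmult: "van f \<Longrightarrow> van (\<lambda>x t. c * f x t)"
  using van_lincomb[of f f c 0] by simp

text \<open>The coinductive conditions are read off at the basis vectors of spacetime. The time
  direction counts among them, which is why multiplication by \<open>dt U\<close> also preserves
  \<open>van\<close>; the work integrand and the equation for \<psi> both rely on this.\<close>

lemma van_aux:
  assumes "van f"
  shows "van (dx i f)" "van (dt f)" "van (\<lambda>x t. x $ i * f x t)" "van (\<lambda>x t. dx i U x t * f x t)"
    "van (\<lambda>x t. dt U x t * f x t)" "\<exists>C. \<forall>x. \<forall>t\<in>{ti..tf}. \<bar>f x t\<bar> \<le> C"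
proof -
  have sm: "smooth f" using assms by (rule van_smooth)
  obtain f' where f1: "bounded ((\<lambda>(x, t). f x t) ` spacetime)"
    and f2: "\<forall>p\<in>spacetime. ((\<lambda>(x, t). f x t) has_derivative f' p) (at p within spacetime)"
    and f3: "\<forall>b\<in>Basis. rapidly_vanishing spacetime (\<lambda>(x, t). U x t) (\<lambda>p. f' p b)"
    and f4: "\<forall>b\<in>Basis. rapidly_vanishing spacetime (\<lambda>(x, t). U x t) (\<lambda>p. (p \<bullet> b) * (\<lambda>(x, t). f x t) p)"
    and f5: "\<forall>b\<in>Basis. rapidly_vanishing spacetime (\<lambda>(x, t). U x t)
        (\<lambda>p. frechet_derivative (\<lambda>(x, t). U x t) (at p within spacetime) b * (\<lambda>(x, t). f x t) p)"
    using assms unfolding van_def vanishing_on_def by cases (rule that)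
  have dx: "dx i f x t = f' (x, t) (axis i 1, 0)" if "t \<in> {ti..tf}" for x t
    using f2 that by (intro dx_eq has_partial_of_has_derivative) auto
  have dt: "dt f x t = f' (x, t) (0, 1)" if "t \<in> {ti..tf}" for x t
    using f2 that by (intro dt_eq has_dt_of_has_derivative) auto
  show "van (dx i f)" unfolding van_def vanishing_on_def
    by (rule rapidly_vanishing_cong[OF bspec[OF f3 axis_Basis(1)[of i]]]) (auto simp: dx)
  show "van (dt f)" unfolding van_def vanishing_on_def
    by (rule rapidly_vanishing_cong[OF bspec[OF f3 axis_Basis(2)]]) (auto simp: dt)
  show "van (\<lambda>x t. x $ i * f x t)" unfolding van_def vanishing_on_def
    by (rule rapidly_vanishing_cong[OF bspec[OF f4 axis_Basis(1)[of i]]]) (auto simp: inner_axis)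
  obtain U' where U': "\<And>p. p \<in> spacetime \<Longrightarrow> ((\<lambda>(x, t). U x t) has_derivative U' p) (at p within spacetime)"
    using smooth_U unfolding smooth_def by (rule smooth_onE) (rule that)
  \<comment> \<open>\<open>frechet_derivative\<close> is a choice that means something only because
    \<open>U\<close> is differentiable within spacetime. Whichever derivative it picks, the values
    at basis vectors are the partial derivatives.\<close>
  have Uf: "((\<lambda>(x, t). U x t) has_derivative frechet_derivative (\<lambda>(x, t). U x t) (at p within spacetime))
      (at p within spacetime)" if "p \<in> spacetime" for p
    using U'[OF that] by (auto simp: frechet_derivative_works[symmetric] differentiable_def)
  have dxU: "dx i U x t = frechet_derivative (\<lambda>(x, t). U x t) (at (x, t) within spacetime) (axis i 1, 0)"
    if "t \<in> {ti..tf}" for x t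
    using Uf[of "(x, t)"] that by (intro dx_eq has_partial_of_has_derivative) auto
  have dtU: "dt U x t = frechet_derivative (\<lambda>(x, t). U x t) (at (x, t) within spacetime) (0, 1)"
    if "t \<in> {ti..tf}" for x t
    using Uf[of "(x, t)"] that by (intro dt_eq has_dt_of_has_derivative) auto
  show "van (\<lambda>x t. dx i U x t * f x t)" unfolding van_def vanishing_on_def
    by (rule rapidly_vanishing_cong[OF bspec[OF f5 axis_Basis(1)[of i]]]) (auto simp: dxU)
  show "van (\<lambda>x t. dt U x t * f x t)" unfolding van_def vanishing_on_def
    by (rule rapidly_vanishing_cong[OF bspec[OF f5 axis_Basis(2)]]) (auto simp: dtU)
  show "\<exists>C. \<forall>x. \<forall>t\<in>{ti..tf}. \<bar>f x t\<bar> \<le> C"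
    using f1 by (fastforce simp: bounded_real)
qed

lemmas van_dx = van_aux(1) and van_dt = van_aux(2) and van_coord = van_aux(3)
  and van_dxU = van_aux(4) and van_dtU = van_aux(5) and van_bounded = van_aux(6)

lemma van_has_dx: "van f \<Longrightarrow> t \<in> {ti..tf} \<Longrightarrow> has_partial i (\<lambda>y. f y t) x (dx i f x t)"
  by (intro smooth_has_dx van_smooth)

lemma van_has_dt: "van f \<Longrightarrow> t \<in> {ti..tf} \<Longrightarrow> (f x has_real_derivative dt f x t) (at t within {ti..tf})"
  by (intro smooth_has_dt van_smooth)

lemma van_sum:
  assumes "\<And>i. i \<in> I \<Longrightarrow> van (f i)" "finite I" "I \<noteq> {}"
  shows "van (\<lambda>x t. \<Sum>i\<in>I. f i x t)"
  using assms(2,3,1) by (induction I rule: finite_ne_induct) (auto intro!: van_add)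

end

section \<open>Dominated integrals\<close>

text \<open>Dominated convergence for the difference quotients. The mean value inequality on the
  convex set \<open>X\<close> bounds them by \<open>B\<close>; taking derivatives within
  \<open>X\<close> includes the end points of an interval.\<close>

lemma has_derivative_LINT:
  fixes f g :: "'a \<Rightarrow> real \<Rightarrow> real"
  assumes X: "convex X" "t0 \<in> X"
    and der: "\<And>x t. t \<in> X \<Longrightarrow> (f x has_real_derivative g x t) (at t within X)"
    and int: "\<And>t. t \<in> X \<Longrightarrow> integrable M (\<lambda>x. f x t)"
    and meas: "(\<lambda>x. g x t0) \<in> borel_measurable M"
    and B: "integrable M B" "\<And>x t. t \<in> X \<Longrightarrow> \<bar>g x t\<bar> \<le> B x"
  shows "((\<lambda>t. LINT x|M. f x t) has_real_derivative (LINT x|M. g x t0)) (at t0 within X)"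
  unfolding has_field_derivative_iff tendsto_at_iff_sequentially
proof (intro allI impI)
  fix s assume s: "\<forall>i. s i \<in> X - {t0}" "s \<longlonglongrightarrow> t0"
  define q where "q i x = (f x (s i) - f x t0) / (s i - t0)" for i x
  have lim: "(\<lambda>i. LINT x|M. q i x) \<longlonglongrightarrow> (LINT x|M. g x t0)"
  proof (rule integral_dominated_convergence[where w = B])
    show "q i \<in> borel_measurable M" for i
      unfolding q_def using s X int by (intro borel_measurable_divide borel_measurable_diff borel_measurable_const
          borel_measurable_integrable) auto
    show "AE x in M. (\<lambda>i. q i x) \<longlonglongrightarrow> g x t0"
    proof (rule AE_I2)
      fix x
      have "((\<lambda>y. (f x y - f x t0) / (y - t0)) \<longlongrightarrow> g x t0) (at t0 within X)"
        using der[OF X(2)] unfolding has_field_derivative_iff .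
      then show "(\<lambda>i. q i x) \<longlonglongrightarrow> g x t0"
        unfolding tendsto_at_iff_sequentially q_def o_def using s by blast
    qed
    show "AE x in M. norm (q i x) \<le> B x" for i
    proof (rule AE_I2)
      fix x
      have "norm (f x (s i) - f x t0) \<le> B x * norm (s i - t0)"
        using s(1) X B(2) by (intro field_differentiable_bound[OF X(1) der]) auto
      then show "norm (q i x) \<le> B x"
        using s(1) unfolding q_def by (simp add: divide_le_eq)
    qed
  qed (use meas B in auto)
  have "(LINT x|M. q i x) = ((LINT x|M. f x (s i)) - (LINT x|M. f x t0)) / (s i - t0)" for i
  proof -
    have "(LINT x|M. f x (s i) - f x t0) = (LINT x|M. f x (s i)) - (LINT x|M. f x t0)"
      using s X int by (intro Bochner_Integration.integral_diff) auto
    then show ?thesis unfolding q_def by simp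
  qed
  then show "((\<lambda>y. ((LINT x|M. f x y) - (LINT x|M. f x t0)) / (y - t0)) \<circ> s) \<longlonglongrightarrow> (LINT x|M. g x t0)"
    using lim by (simp add: o_def)
qed

text \<open>A product of Cauchy densities, up to a constant. It is integrable, yet its reciprocal is
  a polynomial, so that division by it is composed of multiplications by coordinates.\<close>

definition weight :: "'a::euclidean_space \<Rightarrow> real" where
  "weight x = (\<Prod>b\<in>Basis. inverse (1 + (x \<bullet> b)\<^sup>2))"

lemma weight_pos: "0 < weight x"
  unfolding weight_def by (intro prod_pos) (auto intro!: add_pos_nonneg)

lemma weight_le_1: "weight x \<le> 1"
  unfolding weight_def by (intro prod_le_1) (auto intro!: le_imp_inverse_le[of 1, simplified] simp: add_nonneg_nonneg)

lemma continuous_weight: "continuous_on A weight"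
  unfolding weight_def by (intro continuous_intros) (simp add: add_nonneg_eq_0_iff)

lemma integrable_weight: "integrable lborel (weight :: 'a::euclidean_space \<Rightarrow> real)"
proof (rule integrableI_nonneg)
  show "weight \<in> borel_measurable (lborel :: 'a measure)"
    using borel_measurable_continuous_onI[OF continuous_weight] by simp
  show "AE x in (lborel :: 'a measure). 0 \<le> weight x" using weight_pos less_imp_le by (intro AE_I2) blast
  have fin: "(\<integral>\<^sup>+x. ennreal (inverse (1 + x\<^sup>2)) \<partial>(lborel :: real measure)) < \<infinity>"
  proof -
    have "integrable lborel (\<lambda>x::real. inverse (1 + x\<^sup>2))"
      using integrable_inverse_1_plus_square unfolding set_integrable_def by simp
    then show ?thesis unfolding integrable_iff_bounded by simp
  qed
  have "(\<integral>\<^sup>+x. ennreal (weight x) \<partial>(lborel :: 'a measure))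
      = (\<integral>\<^sup>+x. (\<Prod>b\<in>Basis. ennreal (inverse (1 + (x \<bullet> b)\<^sup>2))) \<partial>(lborel :: 'a measure))"
    unfolding weight_def by (simp add: prod_ennreal)
  also have "\<dots> = (\<Prod>b\<in>(Basis :: 'a set). \<integral>\<^sup>+x. ennreal (inverse (1 + x\<^sup>2)) \<partial>lborel)"
    by (rule nn_integral_lborel_prod) auto
  also have "\<dots> < \<infinity>" using fin by (simp add: power_less_top_ennreal)
  finally show "(\<integral>\<^sup>+x. ennreal (weight x) \<partial>(lborel :: 'a measure)) < \<infinity>" .
qed

text \<open>Needed so that one dominating function serves all short translates of a function at
  once.\<close>

lemma weight_shift:
  assumes "norm y \<le> 1" shows "weight (x + y) \<le> 3 ^ DIM('a) * weight (x :: 'a::euclidean_space)"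
proof -
  have *: "inverse (1 + ((x + y) \<bullet> b)\<^sup>2) \<le> 3 * inverse (1 + (x \<bullet> b)\<^sup>2)" if "b \<in> Basis" for b
  proof -
    have "\<bar>y \<bullet> b\<bar> \<le> 1" using Basis_le_norm[OF that, of y] assms by simp
    then have y: "(y \<bullet> b)\<^sup>2 \<le> 1" by (simp add: abs_square_le_1)
    \<comment> \<open>Completing the square: for the components along \<open>b\<close>, 2 + 3 (x +
      y)^2 - x^2 is half of this square plus 2 - (3/2) y^2, and y^2 is at most 1.\<close>
    have "0 \<le> (2 * (x \<bullet> b) + 3 * (y \<bullet> b))\<^sup>2" by simp
    then have "(x \<bullet> b)\<^sup>2 \<le> 2 + 3 * ((x + y) \<bullet> b)\<^sup>2"
      using y by (simp add: inner_add_left power2_eq_square algebra_simps)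
    then have "1 + (x \<bullet> b)\<^sup>2 \<le> 3 * (1 + ((x + y) \<bullet> b)\<^sup>2)" by simp
    moreover have "0 < 1 + (x \<bullet> b)\<^sup>2" "0 < 1 + ((x + y) \<bullet> b)\<^sup>2" by (auto intro: add_pos_nonneg)
    ultimately show ?thesis by (simp add: field_simps)
  qed
  have "weight (x + y) \<le> (\<Prod>b\<in>(Basis :: 'a set). 3 * inverse (1 + (x \<bullet> b)\<^sup>2))"
    unfolding weight_def using * by (intro prod_mono) auto
  then show ?thesis by (simp add: weight_def prod.distrib)
qed

lemma integrable_weight_bound:
  fixes f :: "'a::euclidean_space \<Rightarrow> real"
  assumes "f \<in> borel_measurable lborel" "\<And>x. \<bar>f x\<bar> \<le> C * weight x"
  shows "integrable lborel f"
  by (rule Bochner_Integration.integrable_bound[OF integrable_mult_right[OF integrable_weight, of C] assms(1)])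
     (use assms(2) in \<open>auto intro: order_trans[OF _ abs_ge_self]\<close>)

lemma integral_lborel_translate:
  fixes f :: "'a::euclidean_space \<Rightarrow> real"
  assumes [measurable]: "f \<in> borel_measurable borel"
  shows "(LINT x|lborel. f (x + c)) = (LINT x|lborel. f x)"
proof -
  have "(LINT x|lborel. f x) = (LINT x|distr lborel borel ((+) c). f x)" by (simp add: lborel_distr_plus)
  also have "\<dots> = (LINT x|lborel. f (c + x))" by (rule integral_distr) auto
  finally show ?thesis by (simp add: add.commute)
qed

text \<open>The integral of \<open>x \<mapsto> F (x + h e\<^sub>i)\<close> does not depend on \<open>h\<close>.\<close>

lemma integral_partial_eq_0:
  fixes F G :: "real^'d::finite \<Rightarrow> real"
  assumes der: "\<And>x. has_partial i F x (G x)"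
    and F: "continuous_on UNIV F" "\<And>x. \<bar>F x\<bar> \<le> C * weight x"
    and G: "continuous_on UNIV G" "\<And>x. \<bar>G x\<bar> \<le> C * weight x"
  shows "(LINT x|lborel. G x) = 0"
proof -
  let ?e = "axis i 1 :: real^'d"
  have C: "0 \<le> C" using order_trans[OF abs_ge_zero F(2)[of 0]] weight_pos[of "0::real^'d"]
    by (simp add: zero_le_mult_iff)
  have Fm: "F \<in> borel_measurable borel" and Gm: "G \<in> borel_measurable borel"
    using F(1) G(1) by (auto intro: borel_measurable_continuous_onI)
  have bd: "C * weight (x + h *\<^sub>R ?e) \<le> C * (3 ^ DIM(real^'d) * weight x)" if "h \<in> {-1..1}" for x h
    using that C by (intro mult_left_mono weight_shift) auto
  \<comment> \<open>Shifts are restricted to [-1, 1], where \<open>weight_shift\<close> dominates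
    all translates simultaneously.\<close>
  have "((\<lambda>h. LINT x|lborel. F (x + h *\<^sub>R ?e)) has_real_derivative (LINT x|lborel. G (x + 0 *\<^sub>R ?e)))
      (at 0 within {-1..1})"
  proof (rule has_derivative_LINT[where B = "\<lambda>x. C * (3 ^ DIM(real^'d) * weight x)"])
    show "((\<lambda>h. F (x + h *\<^sub>R ?e)) has_real_derivative G (x + h *\<^sub>R ?e)) (at h within {-1..1})" for x h
      by (rule DERIV_subset[OF has_partial_shift[OF der]]) simp
    show "integrable lborel (\<lambda>x. F (x + h *\<^sub>R ?e))" if "h \<in> {-1..1}" for h
    proof (rule integrable_weight_bound)
      show "(\<lambda>x. F (x + h *\<^sub>R ?e)) \<in> borel_measurable lborel" using Fm by measurable
      show "\<bar>F (x + h *\<^sub>R ?e)\<bar> \<le> (C * 3 ^ DIM(real^'d)) * weight x" for x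
        using order_trans[OF F(2) bd[OF that]] by (simp add: mult.assoc)
    qed
    show "(\<lambda>x. G (x + 0 *\<^sub>R ?e)) \<in> borel_measurable lborel" using Gm by simp
    show "integrable lborel (\<lambda>x::real^'d. C * (3 ^ DIM(real^'d) * weight x))"
      by (intro integrable_mult_right integrable_weight)
    show "\<bar>G (x + h *\<^sub>R ?e)\<bar> \<le> C * (3 ^ DIM(real^'d) * weight x)" if "h \<in> {-1..1}" for x h
      using order_trans[OF G(2) bd[OF that]] .
  qed auto
  moreover have "(LINT x|lborel. F (x + h *\<^sub>R ?e)) = (LINT x|lborel. F x)" for h
    using integral_lborel_translate[OF Fm] .
  ultimately have "((\<lambda>h::real. LINT x|lborel. F x) has_real_derivative (LINT x|lborel. G x)) (at 0 within {-1..1})"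
    by simp
  then have "((\<lambda>h::real. LINT x|lborel. F x) has_real_derivative (LINT x|lborel. G x)) (at 0)"
    by (subst (asm) at_within_interior) auto
  then show ?thesis using DERIV_unique DERIV_const by blast
qed

section \<open>Functions dominated by the weight uniformly in time\<close>

context time_interval
begin

definition bdd :: "(real^'d::finite \<Rightarrow> real \<Rightarrow> real) \<Rightarrow> bool" where
  "bdd f \<longleftrightarrow> continuous_on spacetime (\<lambda>(x, t). f x t) \<and> (\<exists>C. \<forall>x. \<forall>t\<in>{ti..tf}. \<bar>f x t\<bar> \<le> C)"

text \<open>This class is preserved by bounded continuous factors and by composition with continuous
  functions that do not exceed the identity in absolute value. \<open>van\<close> is too rigid for
  the nonlinear test functions of the \<open>L\<^sup>1\<close> estimate, whereas dominated
  convergence needs no more than \<open>dom\<close>.\<close>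

definition dom :: "(real^'d::finite \<Rightarrow> real \<Rightarrow> real) \<Rightarrow> bool" where
  "dom f \<longleftrightarrow> continuous_on spacetime (\<lambda>(x, t). f x t) \<and>
     (\<exists>C. \<forall>x. \<forall>t\<in>{ti..tf}. \<bar>f x t\<bar> \<le> C * weight x)"

lemma domE:
  assumes "dom f"
  obtains C where "0 \<le> C" "\<And>x t. t \<in> {ti..tf} \<Longrightarrow> \<bar>f x t\<bar> \<le> C * weight x"
proof -
  obtain C where C: "\<And>x t. t \<in> {ti..tf} \<Longrightarrow> \<bar>f x t\<bar> \<le> C * weight x" using assms unfolding dom_def by blast
  have "\<bar>f x t\<bar> \<le> max C 0 * weight x" if "t \<in> {ti..tf}" for x t
    using order_trans[OF C[OF that] mult_right_mono[OF max.cobounded1[of C 0]]] weight_pos[of x] by simp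
  then show ?thesis using that[of "max C 0"] by simp
qed

lemma dom_bdd: assumes "dom f" shows "bdd f"
proof -
  obtain C where C: "0 \<le> C" "\<And>x t. t \<in> {ti..tf} \<Longrightarrow> \<bar>f x t\<bar> \<le> C * weight x" using assms by (rule domE) (rule that)
  have "\<bar>f x t\<bar> \<le> C" if "t \<in> {ti..tf}" for x t
    using order_trans[OF C(2)[OF that] mult_left_mono[OF weight_le_1 C(1)]] by simp
  then show ?thesis using assms unfolding dom_def bdd_def by blast
qed

lemma dom_mult_bdd: assumes "dom f" "bdd g" shows "dom (\<lambda>x t. g x t * f x t)"
proof -
  obtain C where C: "0 \<le> C" "\<And>x t. t \<in> {ti..tf} \<Longrightarrow> \<bar>f x t\<bar> \<le> C * weight x" using assms(1) by (rule domE) (rule that)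
  obtain B where B: "\<And>x t. t \<in> {ti..tf} \<Longrightarrow> \<bar>g x t\<bar> \<le> B" using assms(2) unfolding bdd_def by blast
  have "\<bar>g x t * f x t\<bar> \<le> (B * C) * weight x" if "t \<in> {ti..tf}" for x t
    using mult_mono[OF B[OF that] C(2)[OF that], of x] order_trans[OF abs_ge_zero B[OF that]]
    by (simp add: abs_mult mult.assoc)
  moreover have "continuous_on spacetime (\<lambda>(x, t). g x t * f x t)"
    using assms unfolding dom_def bdd_def case_prod_unfold by (intro continuous_on_mult) auto
  ultimately show ?thesis unfolding dom_def by blast
qed

lemma dom_mult: "dom f \<Longrightarrow> dom g \<Longrightarrow> dom (\<lambda>x t. g x t * f x t)"
  by (intro dom_mult_bdd dom_bdd)

lemma bdd_time: assumes "continuous_on {ti..tf} c" shows "bdd (\<lambda>x t. c t)"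
proof -
  have "bounded (c ` {ti..tf})" using assms by (intro compact_imp_bounded compact_continuous_image) auto
  then obtain C where "\<forall>t\<in>{ti..tf}. \<bar>c t\<bar> \<le> C" by (auto simp: bounded_real)
  moreover have "continuous_on spacetime (c \<circ> snd)"
    using assms by (intro continuous_on_compose continuous_on_subset[OF assms] continuous_on_snd continuous_on_id) auto
  ultimately show ?thesis unfolding bdd_def by (auto simp: o_def case_prod_unfold)
qed

lemma dom_tmult: "dom f \<Longrightarrow> continuous_on {ti..tf} c \<Longrightarrow> dom (\<lambda>x t. c t * f x t)"
  by (intro dom_mult_bdd bdd_time)

lemma dom_cmult: "dom f \<Longrightarrow> dom (\<lambda>x t. c * f x t)"
  using dom_tmult[of f "\<lambda>_. c"] by simp

lemma dom_add: assumes "dom f" "dom g" shows "dom (\<lambda>x t. f x t + g x t)"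
proof -
  obtain C where "0 \<le> C" and C: "\<And>x t. t \<in> {ti..tf} \<Longrightarrow> \<bar>f x t\<bar> \<le> C * weight x" using assms(1) by (rule domE) (rule that)
  obtain D where "0 \<le> D" and D: "\<And>x t. t \<in> {ti..tf} \<Longrightarrow> \<bar>g x t\<bar> \<le> D * weight x" using assms(2) by (rule domE) (rule that)
  have "\<bar>f x t + g x t\<bar> \<le> (C + D) * weight x" if "t \<in> {ti..tf}" for x t
    using C[OF that, of x] D[OF that, of x] by (simp add: algebra_simps)
  moreover have "continuous_on spacetime (\<lambda>(x, t). f x t + g x t)"
    using assms unfolding dom_def case_prod_unfold by (intro continuous_on_add) auto
  ultimately show ?thesis unfolding dom_def by blast
qed

lemma dom_diff: "dom f \<Longrightarrow> dom g \<Longrightarrow> dom (\<lambda>x t. f x t - g x t)"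
  using dom_add[of f "\<lambda>x t. - 1 * g x t"] dom_cmult[of g "-1"] by simp

lemma dom_slice:
  assumes "dom f" "t \<in> {ti..tf}"
  shows "continuous_on UNIV (\<lambda>x. f x t)" "(\<lambda>x. f x t) \<in> borel_measurable lborel"
    "integrable lborel (\<lambda>x. f x t)"
proof -
  have "continuous_on UNIV ((\<lambda>(x, t). f x t) \<circ> (\<lambda>x. (x, t)))"
    using assms unfolding dom_def
    by (intro continuous_on_compose continuous_on_Pair continuous_on_id continuous_on_const)
       (auto elim: continuous_on_subset)
  then show 1: "continuous_on UNIV (\<lambda>x. f x t)" by (simp add: o_def)
  then show 2: "(\<lambda>x. f x t) \<in> borel_measurable lborel" by (simp add: borel_measurable_continuous_onI)
  obtain C where "0 \<le> C" and "\<And>x t. t \<in> {ti..tf} \<Longrightarrow> \<bar>f x t\<bar> \<le> C * weight x" using assms(1) by (rule domE) (rule that)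
  then show "integrable lborel (\<lambda>x. f x t)" using 2 assms(2) by (intro integrable_weight_bound)
qed

lemmas dom_integrable = dom_slice(3)

lemma dom_integral_continuous:
  assumes "dom f" shows "continuous_on {ti..tf} (\<lambda>t. LINT x|lborel. f x t)"
proof (rule continuous_on_sequentiallyI)
  fix s t assume s: "\<forall>n. s n \<in> {ti..tf}" "t \<in> {ti..tf}" "s \<longlonglongrightarrow> t"
  obtain C where "0 \<le> C" and C: "\<And>x t. t \<in> {ti..tf} \<Longrightarrow> \<bar>f x t\<bar> \<le> C * weight x" using assms by (rule domE) (rule that)
  show "(\<lambda>n. LINT x|lborel. f x (s n)) \<longlonglongrightarrow> (LINT x|lborel. f x t)"
  proof (rule integral_dominated_convergence[where w = "\<lambda>x. C * weight x"])
    show "AE x in lborel. (\<lambda>n. f x (s n)) \<longlonglongrightarrow> f x t"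
    proof (rule AE_I2)
      fix x :: "real^'a"
      have "continuous_on spacetime (\<lambda>(x, t). f x t)" using assms unfolding dom_def by blast
      moreover have "(\<lambda>n. (x, s n)) \<longlonglongrightarrow> (x, t)" using s(3) by (intro tendsto_intros)
      ultimately show "(\<lambda>n. f x (s n)) \<longlonglongrightarrow> f x t"
        using s(1,2) continuous_on_tendsto_compose[of spacetime "\<lambda>(x, t). f x t" "\<lambda>n. (x, s n)" "(x, t)" sequentially]
        by simp
    qed
    show "integrable lborel (\<lambda>x::real^'a. C * weight x)" by (intro integrable_mult_right integrable_weight)
    show "AE x in lborel. norm (f x (s n)) \<le> C * weight x" for n using C s(1) by (intro AE_I2) simp
  qed (use dom_slice(2)[OF assms] s in auto)
qed

lemma dom_integral_derivative:
  assumes "dom f" "dom g" "t \<in> {ti..tf}"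
    "\<And>x t. t \<in> {ti..tf} \<Longrightarrow> (f x has_real_derivative g x t) (at t within {ti..tf})"
  shows "((\<lambda>t. LINT x|lborel. f x t) has_real_derivative (LINT x|lborel. g x t)) (at t within {ti..tf})"
proof -
  obtain C where "0 \<le> C" and C: "\<And>x t. t \<in> {ti..tf} \<Longrightarrow> \<bar>g x t\<bar> \<le> C * weight x" using assms(2) by (rule domE) (rule that)
  show ?thesis
  proof (rule has_derivative_LINT[where B = "\<lambda>x. C * weight x"])
    show "(\<lambda>x. g x t) \<in> borel_measurable lborel" using assms by (intro dom_slice)
    show "integrable lborel (\<lambda>x. f x s)" if "s \<in> {ti..tf}" for s using assms(1) that by (rule dom_slice)
  qed (use assms C in \<open>auto intro!: integrable_mult_right integrable_weight\<close>)
qed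

lemma dom_integral_partial:
  assumes "dom F" "dom G" "t \<in> {ti..tf}" "\<And>x. has_partial i (\<lambda>y. F y t) x (G x t)"
  shows "(LINT x|lborel. G x t) = 0"
proof -
  obtain C where "0 \<le> C" and C: "\<And>x t. t \<in> {ti..tf} \<Longrightarrow> \<bar>F x t\<bar> \<le> C * weight x" using assms(1) by (rule domE) (rule that)
  obtain D where "0 \<le> D" and D: "\<And>x t. t \<in> {ti..tf} \<Longrightarrow> \<bar>G x t\<bar> \<le> D * weight x" using assms(2) by (rule domE) (rule that)
  have m: "C * weight x \<le> max C D * weight x" "D * weight x \<le> max C D * weight x" for x :: "real^'a"
    using weight_pos[of x] by (auto intro!: mult_right_mono)
  show ?thesis
    by (rule integral_partial_eq_0[OF assms(4), where C = "max C D"])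
       (use assms dom_slice order_trans[OF C m(1)] order_trans[OF D m(2)] in auto)
qed

end

context moving_potential
begin

text \<open>The reciprocal of \<open>weight\<close> is the product of the factors 1 + (x \<bullet>
  b)^2; each factor costs two multiplications by the same coordinate.\<close>

lemma van_divide_weight: assumes "van f" shows "van (\<lambda>x t. f x t / weight x)"
proof -
  have "van (\<lambda>x t. (\<Prod>b\<in>I. 1 + (x \<bullet> b)\<^sup>2) * f x t)" if "finite I" "I \<subseteq> Basis" for I
    using that
  proof (induction I)
    case (insert b I)
    obtain i where b: "b = axis i 1" using insert.prems by (auto simp: Basis_vec_def)
    let ?g = "\<lambda>x t. (\<Prod>b\<in>I. 1 + (x \<bullet> b)\<^sup>2) * f x t"
    have "van (\<lambda>x t. ?g x t + x $ i * (x $ i * ?g x t))"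
      using insert by (intro van_add van_coord) auto
    moreover have "(\<lambda>x t. ?g x t + x $ i * (x $ i * ?g x t))
        = (\<lambda>x t. (\<Prod>b\<in>insert b I. 1 + (x \<bullet> b)\<^sup>2) * f x t)"
      using insert.hyps by (simp add: b inner_axis power2_eq_square algebra_simps)
    ultimately show ?case by simp
  qed (use assms in simp)
  from this[of Basis] have "van (\<lambda>x t. (\<Prod>b\<in>Basis. 1 + (x \<bullet> b)\<^sup>2) * f x t)" by simp
  moreover have "f x t / weight x = (\<Prod>b\<in>Basis. 1 + (x \<bullet> b)\<^sup>2) * f x t" for x t
    unfolding weight_def divide_inverse prod_inversef[symmetric] by simp
  ultimately show ?thesis by simp
qed

lemma van_dom: assumes "van f" shows "dom f"
proof -
  obtain C where C: "\<forall>x. \<forall>t\<in>{ti..tf}. \<bar>f x t / weight x\<bar> \<le> C"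
    using van_bounded[OF van_divide_weight[OF assms]] by blast
  have "\<bar>f x t\<bar> \<le> C * weight x" if "t \<in> {ti..tf}" for x t
    using C[rule_format, OF that, of x] weight_pos[of x] by (simp add: pos_divide_le_eq abs_divide)
  then show ?thesis unfolding dom_def using smooth_continuous[OF van_smooth[OF assms]] by blast
qed

end

section \<open>The Fokker-Planck operator and the Hamiltonian\<close>

context time_interval
begin

definition "ip f g t = (LINT x|lborel. f x t * g x t)" for f g :: "real^'d::finite \<Rightarrow> real \<Rightarrow> real"

lemma ip_commute: "ip f g = ip g f"
  unfolding ip_def by (simp add: mult.commute)

lemma dx_cong: "(\<And>y. f y t = g y t) \<Longrightarrow> dx i f x t = dx i g x t"
  unfolding dx_def by simp

lemma smooth_mixed2:
  fixes f :: "real^'d::finite \<Rightarrow> real \<Rightarrow> real"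
  assumes f: "smooth f" and t: "t \<in> {ti..tf}"
  shows "dt (dx i (dx i f)) x t = dx i (dx i (dt f)) x t"
proof -
  have "dt (dx i (dx i f)) x t = dx i (dt (dx i f)) x t" by (rule smooth_mixed[OF smooth_dx[OF f] t])
  also have "\<dots> = dx i (dx i (dt f)) x t" by (rule dx_cong) (rule smooth_mixed[OF f t])
  finally show ?thesis .
qed

lemma dx_mult:
  assumes "has_partial i (\<lambda>y. f y t) x a" "has_partial i (\<lambda>y. g y t) x b"
  shows "dx i (\<lambda>x t. f x t * g x t) x t = a * g x t + f x t * b"
  by (rule dx_eq) (rule has_partial_mult[OF assms])

end

locale fp_operators = moving_potential ti tf U for ti tf and U :: "real^'d::finite \<Rightarrow> real \<Rightarrow> real" +
  fixes \<nu> \<beta> :: real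
  assumes nu_pos: "0 < \<nu>" and beta_pos: "0 < \<beta>"
begin

definition "ham f x t = hamiltonian \<nu> \<beta> (\<lambda>y. U y t) (\<lambda>y. f y t) x"

lemma ham_eq:
  "ham f x t = - 1 / (\<nu> * \<beta>) * (\<Sum>i\<in>UNIV. dx i (dx i f) x t)
     - 1 / (2 * \<nu>) * (\<Sum>i\<in>UNIV. dx i (dx i U) x t) * f x t
     + \<beta> / (4 * \<nu>) * (\<Sum>i\<in>UNIV. dx i U x t * dx i U x t) * f x t"
  unfolding ham_def hamiltonian_def laplacian_def divergence_def grad_def dx_def
  by (simp add: inner_vec_def)

text \<open>Rapid vanishing speaks of first derivatives of the potential only. Second ones come from
  the product rule: differentiate \<open>dx i U\<close> times f and subtract \<open>dx i U\<close>
  times the derivative of f.\<close>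

lemma van_dxxU: assumes "van f" shows "van (\<lambda>x t. dx i (dx i U) x t * f x t)"
proof (rule van_cong)
  show "van (\<lambda>x t. dx i (\<lambda>x t. dx i U x t * f x t) x t - dx i U x t * dx i f x t)"
    by (intro van_diff van_dx[OF van_dxU] van_dxU[OF van_dx] assms)
  fix x t assume t: "t \<in> {ti..tf}"
  have "dx i (\<lambda>x t. dx i U x t * f x t) x t = dx i (dx i U) x t * f x t + dx i U x t * dx i f x t"
    by (intro dx_mult smooth_has_dx smooth_dx smooth_U van_smooth assms t)
  then show "dx i (dx i U) x t * f x t
      = dx i (\<lambda>x t. dx i U x t * f x t) x t - dx i U x t * dx i f x t" by simp
qed

lemma van_ham: assumes "van f" shows "van (ham f)"
proof -
  have "van (\<lambda>x t. (- 1 / (\<nu> * \<beta>)) * (\<Sum>i\<in>UNIV. dx i (dx i f) x t)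
     + (- 1 / (2 * \<nu>)) * (\<Sum>i\<in>UNIV. dx i (dx i U) x t * f x t)
     + (\<beta> / (4 * \<nu>)) * (\<Sum>i\<in>UNIV. dx i U x t * (dx i U x t * f x t)))"
    by (intro van_add van_cmult van_sum van_dxU van_dxxU van_dx assms) auto
  then show ?thesis
    by (rule van_cong) (simp add: ham_eq sum_distrib_right mult.assoc)
qed

lemma dom_van_mult: "van f \<Longrightarrow> van g \<Longrightarrow> dom (\<lambda>x t. f x t * g x t)"
  by (intro dom_mult van_dom)

lemma van_mult_integrable: "van f \<Longrightarrow> van g \<Longrightarrow> t \<in> {ti..tf} \<Longrightarrow> integrable lborel (\<lambda>x. f x t * g x t)"
  using dom_integrable[OF dom_van_mult] .

lemma ip_lincomb:
  assumes "van f" "van g" "van h" "t \<in> {ti..tf}"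
  shows "ip (\<lambda>x t. c t * f x t + d t * g x t) h t = c t * ip f h t + d t * ip g h t"
proof -
  have "ip (\<lambda>x t. c t * f x t + d t * g x t) h t
      = (LINT x|lborel. c t * (f x t * h x t) + d t * (g x t * h x t))"
    unfolding ip_def by (intro Bochner_Integration.integral_cong) (auto simp: algebra_simps)
  also have "\<dots> = c t * ip f h t + d t * ip g h t"
    unfolding ip_def using assms by (simp add: van_mult_integrable)
  finally show ?thesis .
qed

lemma ip_diff_right:
  assumes "van f" "van g" "van h" "t \<in> {ti..tf}"
  shows "ip h (\<lambda>x t. f x t - g x t) t = ip h f t - ip h g t"
  using ip_lincomb[OF assms(1,2,3,4), of "\<lambda>_. 1" "\<lambda>_. -1"] by (simp add: ip_commute[of h])

lemma ip_add_right:
  assumes "van f" "van g" "van h" "t \<in> {ti..tf}"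
  shows "ip h (\<lambda>x t. f x t + g x t) t = ip h f t + ip h g t"
  using ip_lincomb[OF assms(1,2,3,4), of "\<lambda>_. 1" "\<lambda>_. 1"] by (simp add: ip_commute[of h])

lemma ip_cmult_right: "ip h (\<lambda>x t. c * f x t) t = c * ip h f t"
  unfolding ip_def by (simp add: mult.left_commute)

lemma ip_has_derivative:
  assumes "van f" "van g" "t \<in> {ti..tf}"
  shows "(ip f g has_real_derivative ip (dt f) g t + ip f (dt g) t) (at t within {ti..tf})"
proof -
  have "((\<lambda>t. LINT x|lborel. f x t * g x t) has_real_derivative
      (LINT x|lborel. dt f x t * g x t + dt g x t * f x t)) (at t within {ti..tf})"
    by (intro dom_integral_derivative dom_add dom_van_mult van_dt DERIV_mult van_has_dt assms)
  moreover have "(LINT x|lborel. dt f x t * g x t + dt g x t * f x t) = ip (dt f) g t + ip f (dt g) t"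
    unfolding ip_def using assms by (simp add: van_mult_integrable van_dt mult.commute)
  ultimately show ?thesis unfolding ip_def by simp
qed

lemma ip_continuous: "van f \<Longrightarrow> van g \<Longrightarrow> continuous_on {ti..tf} (ip f g)"
  unfolding ip_def[abs_def] by (intro dom_integral_continuous dom_van_mult)

text \<open>The multiplication terms cancel. The Laplacians leave the divergence of f grad g - g
  grad f, which integrates to 0.\<close>

lemma ham_symmetric:
  assumes f: "van f" and g: "van g" and t: "t \<in> {ti..tf}"
  shows "ip f (ham g) t = ip (ham f) g t"
proof -
  have 0: "(LINT x|lborel. f x t * dx i (dx i g) x t - dx i (dx i f) x t * g x t) = 0" for i
  proof (rule dom_integral_partial[OF _ _ t])
    show "dom (\<lambda>x t. f x t * dx i g x t - dx i f x t * g x t)"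
      by (intro dom_diff dom_van_mult van_dx f g)
    show "dom (\<lambda>x t. f x t * dx i (dx i g) x t - dx i (dx i f) x t * g x t)"
      by (intro dom_diff dom_van_mult van_dx f g)
    fix x
    have "has_partial i (\<lambda>y. f y t * dx i g y t - dx i f y t * g y t) x
        ((dx i f x t * dx i g x t + f x t * dx i (dx i g) x t)
         - (dx i (dx i f) x t * g x t + dx i f x t * dx i g x t))"
      by (intro has_partial_diff has_partial_mult van_has_dx van_dx f g t)
    then show "has_partial i (\<lambda>y. f y t * dx i g y t - dx i f y t * g y t) x
        (f x t * dx i (dx i g) x t - dx i (dx i f) x t * g x t)" by simp
  qed
  have int: "integrable lborel (\<lambda>x. f x t * dx i (dx i g) x t - dx i (dx i f) x t * g x t)" for i
    by (intro Bochner_Integration.integrable_diff van_mult_integrable van_dx f g t)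
  have "ip f (ham g) t - ip (ham f) g t = (LINT x|lborel. f x t * ham g x t - ham f x t * g x t)"
    unfolding ip_def by (intro Bochner_Integration.integral_diff[symmetric] van_mult_integrable van_ham f g t)
  also have "\<dots> = (LINT x|lborel. - 1 / (\<nu> * \<beta>) *
      (\<Sum>i\<in>UNIV. f x t * dx i (dx i g) x t - dx i (dx i f) x t * g x t))"
    by (intro Bochner_Integration.integral_cong)
       (simp_all add: ham_eq algebra_simps sum_subtractf sum_distrib_left sum_distrib_right)
  also have "\<dots> = - 1 / (\<nu> * \<beta>) *
      (\<Sum>i\<in>UNIV. LINT x|lborel. f x t * dx i (dx i g) x t - dx i (dx i f) x t * g x t)"
    unfolding integral_mult_right_zero
    by (subst Bochner_Integration.integral_sum[OF int]) (rule refl)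
  finally show ?thesis by (simp add: 0)
qed

definition "expU x t = exp (- \<beta> * U x t / 2)"

lemma expU_pos: "0 < expU x t"
  unfolding expU_def by simp

lemma expU_inverse: "exp (\<beta> * U x t / 2) * (expU x t * c) = c"
  unfolding expU_def by (simp add: mult.assoc[symmetric] exp_add[symmetric])

lemma has_partial_expU:
  assumes "t \<in> {ti..tf}"
  shows "has_partial i (\<lambda>y. expU y t) x (expU x t * (- \<beta> / 2 * dx i U x t))"
proof -
  have "((\<lambda>v. exp (- \<beta> * v / 2)) has_real_derivative exp (- \<beta> * U x t / 2) * (- \<beta> / 2)) (at (U x t))"
    by (auto intro!: derivative_eq_intros)
  from has_partial_compose[OF this smooth_has_dx[OF smooth_U assms]] show ?thesis
    unfolding expU_def by (simp add: mult.assoc)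
qed

lemma has_partial_expU_mult:
  assumes "t \<in> {ti..tf}" "has_partial i (\<lambda>y. w y t) x a"
  shows "has_partial i (\<lambda>y. expU y t * w y t) x (expU x t * (a - \<beta> / 2 * dx i U x t * w x t))"
  using has_partial_mult[OF has_partial_expU[OF assms(1)] assms(2)] by (simp add: algebra_simps)

lemma has_dt_expU:
  assumes "t \<in> {ti..tf}"
  shows "(expU x has_real_derivative expU x t * (- \<beta> / 2 * dt U x t)) (at t within {ti..tf})"
  unfolding expU_def using smooth_has_dt[OF smooth_U assms, of x]
  by (auto intro!: derivative_eq_intros)

text \<open>The gradient of \<open>expU\<close> absorbs half of the drift in the flux. In the
  divergence of what remains the first-order terms in \<open>w\<close> cancel, since 1 / (\<nu>
  \<beta>) times \<beta> / 2 is 1 / (2 \<nu>), and a Schroedinger operator is left.\<close>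

lemma fokker_planck_expU:
  assumes w: "smooth w" and t: "t \<in> {ti..tf}"
  shows "fokker_planck \<nu> \<beta> (\<lambda>y. U y t) (\<lambda>y. expU y t * w y t) x = - expU x t * ham w x t"
proof -
  have c: "1 / (\<nu> * \<beta>) * (\<beta> / 2) = 1 / (2 * \<nu>)" "1 / (2 * \<nu>) * (\<beta> / 2) = \<beta> / (4 * \<nu>)"
    "1 / (\<nu> * \<beta>) * (\<beta> / 2 * (\<beta> / 2)) = \<beta> / (4 * \<nu>)"
    using nu_pos beta_pos by (auto simp: field_simps)
  have D: "partial_deriv i (\<lambda>y. expU y t * w y t) y = expU y t * (dx i w y t - \<beta> / 2 * dx i U y t * w y t)" for i y
    by (intro has_partial_imp_partial_deriv has_partial_expU_mult smooth_has_dx w t)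
  have F: "1 / (\<nu> * \<beta>) * partial_deriv i (\<lambda>y. expU y t * w y t) y
        + 1 / \<nu> * (expU y t * w y t * partial_deriv i (\<lambda>y. U y t) y)
      = expU y t * (1 / (\<nu> * \<beta>) * dx i w y t + 1 / (2 * \<nu>) * (dx i U y t * w y t))" for i y
    unfolding D dx_def[symmetric] using nu_pos beta_pos by (simp add: field_simps)
  have P: "partial_deriv i (\<lambda>y. expU y t * (1 / (\<nu> * \<beta>) * dx i w y t + 1 / (2 * \<nu>) * (dx i U y t * w y t))) x
      = expU x t * ((1 / (\<nu> * \<beta>) * dx i (dx i w) x t
          + 1 / (2 * \<nu>) * (dx i (dx i U) x t * w x t + dx i U x t * dx i w x t))
          - \<beta> / 2 * dx i U x t * (1 / (\<nu> * \<beta>) * dx i w x t + 1 / (2 * \<nu>) * (dx i U x t * w x t)))" for i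
    by (intro has_partial_imp_partial_deriv
        has_partial_expU_mult[where w = "\<lambda>y t. 1 / (\<nu> * \<beta>) * dx i w y t + 1 / (2 * \<nu>) * (dx i U y t * w y t)"]
        has_partial_add has_partial_cmult has_partial_mult smooth_has_dx smooth_dx smooth_U w t)
  also have "\<dots> i = expU x t * (1 / (\<nu> * \<beta>) * dx i (dx i w) x t + 1 / (2 * \<nu>) * (dx i (dx i U) x t * w x t)
      - \<beta> / (4 * \<nu>) * (dx i U x t * dx i U x t * w x t))" for i
    using nu_pos beta_pos by (simp add: field_simps)
  finally have P: "partial_deriv i (\<lambda>y. expU y t * (1 / (\<nu> * \<beta>) * dx i w y t + 1 / (2 * \<nu>) * (dx i U y t * w y t))) x
      = expU x t * (1 / (\<nu> * \<beta>) * dx i (dx i w) x t + 1 / (2 * \<nu>) * (dx i (dx i U) x t * w x t)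
      - \<beta> / (4 * \<nu>) * (dx i U x t * dx i U x t * w x t))" for i .
  have "fokker_planck \<nu> \<beta> (\<lambda>y. U y t) (\<lambda>y. expU y t * w y t) x
     = (\<Sum>i\<in>UNIV. partial_deriv i (\<lambda>y. 1 / (\<nu> * \<beta>) * partial_deriv i (\<lambda>y. expU y t * w y t) y
        + 1 / \<nu> * (expU y t * w y t * partial_deriv i (\<lambda>y. U y t) y)) x)"
    unfolding fokker_planck_def divergence_def grad_def by simp
  also have "\<dots> = expU x t * (\<Sum>i\<in>UNIV. 1 / (\<nu> * \<beta>) * dx i (dx i w) x t + 1 / (2 * \<nu>) * (dx i (dx i U) x t * w x t)
      - \<beta> / (4 * \<nu>) * (dx i U x t * dx i U x t * w x t))"
    unfolding F P by (simp add: sum_distrib_left)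
  also have "\<dots> = - expU x t * ham w x t"
    unfolding ham_eq
    by (simp add: sum.distrib sum_subtractf sum_negf sum_distrib_left sum_distrib_right algebra_simps)
  finally show ?thesis .
qed

text \<open>The time derivative of the eigenvalue equation \<open>ham u = l u\<close>, expressed for
  \<open>g = exp (\<beta> U / 2) (exp (- \<beta> U / 2) u)'\<close>.\<close>

lemma ham_eigen_dt:
  assumes u: "van u" and t: "t \<in> {ti..tf}"
    and eig: "\<And>x s. s \<in> {ti..tf} \<Longrightarrow> ham u x s = l s * u x s"
    and l: "(l has_real_derivative l') (at t within {ti..tf})"
  shows "ham (\<lambda>x t. dt u x t - \<beta> / 2 * (dt U x t * u x t)) x t =
      l t * (dt u x t - \<beta> / 2 * (dt U x t * u x t)) + l' * u x t
      + exp (\<beta> * U x t / 2) * fokker_planck_dot \<nu> (\<lambda>y. dt U y t) (\<lambda>y. expU y t * u y t) x"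
proof -
  define g where "g = (\<lambda>x t. dt u x t - \<beta> / 2 * (dt U x t * u x t))"
  note su = van_smooth[OF u]
  define Lu' where "Lu' = (\<Sum>i\<in>UNIV. dx i (dx i (dt u)) x t)"
  define Lu where "Lu = (\<Sum>i\<in>UNIV. dx i (dx i u) x t)"
  define LU where "LU = (\<Sum>i\<in>UNIV. dx i (dx i U) x t)"
  define LU' where "LU' = (\<Sum>i\<in>UNIV. dx i (dx i (dt U)) x t)"
  define G2 where "G2 = (\<Sum>i\<in>UNIV. dx i U x t * dx i U x t)"
  define GG where "GG = (\<Sum>i\<in>UNIV. dx i U x t * dx i (dt U) x t)"
  define Gu where "Gu = (\<Sum>i\<in>UNIV. dx i (dt U) x t * dx i u x t)"
  have d: "(dx i f x has_real_derivative dx i (dt f) x t) (at t within {ti..tf})"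
    "(dx i (dx i f) x has_real_derivative dx i (dx i (dt f)) x t) (at t within {ti..tf})" if "smooth f" for f i
    using smooth_has_dt[OF smooth_dx[OF that] t, of i x] smooth_mixed[OF that t, of i x]
      smooth_has_dt[OF smooth_dx[OF smooth_dx[OF that]] t, of i i x] smooth_mixed2[OF that t, of i x] by simp_all
  have d1: "((\<lambda>s. \<Sum>i\<in>UNIV. dx i (dx i u) x s) has_real_derivative Lu') (at t within {ti..tf})"
    unfolding Lu'_def by (intro DERIV_sum d su)
  have d2: "((\<lambda>s. \<Sum>i\<in>UNIV. dx i (dx i U) x s) has_real_derivative LU') (at t within {ti..tf})"
    unfolding LU'_def by (intro DERIV_sum d smooth_U)
  have "((\<lambda>s. \<Sum>i\<in>UNIV. dx i U x s * dx i U x s) has_real_derivative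
      (\<Sum>i\<in>UNIV. dx i (dt U) x t * dx i U x t + dx i (dt U) x t * dx i U x t)) (at t within {ti..tf})"
    by (intro DERIV_sum DERIV_mult d smooth_U)
  moreover have "(\<Sum>i\<in>UNIV. dx i (dt U) x t * dx i U x t + dx i (dt U) x t * dx i U x t) = 2 * GG"
    unfolding GG_def sum_distrib_left by (intro sum.cong) auto
  ultimately have d3: "((\<lambda>s. \<Sum>i\<in>UNIV. dx i U x s * dx i U x s) has_real_derivative 2 * GG) (at t within {ti..tf})"
    by simp
  have du: "(u x has_real_derivative dt u x t) (at t within {ti..tf})" by (rule van_has_dt[OF u t])
  have "((\<lambda>s. ham u x s) has_real_derivative (- 1 / (\<nu> * \<beta>) * Lu' - 1 / (2 * \<nu>) * (LU' * u x t + LU * dt u x t)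
     + \<beta> / (4 * \<nu>) * (2 * GG * u x t + G2 * dt u x t))) (at t within {ti..tf})"
    unfolding ham_eq mult.assoc
    by (rule derivative_eq_intros d1 d2 d3 du refl)+ (simp add: LU_def G2_def algebra_simps)
  moreover have "((\<lambda>s. ham u x s) has_real_derivative l' * u x t + l t * dt u x t) (at t within {ti..tf})"
  proof -
    have "((\<lambda>s. l s * u x s) has_real_derivative l' * u x t + dt u x t * l t) (at t within {ti..tf})"
      by (rule DERIV_mult[OF l du])
    then have "((\<lambda>s. ham u x s) has_real_derivative l' * u x t + dt u x t * l t) (at t within {ti..tf})"
      unfolding has_field_derivative_def
      using has_derivative_transform[of t "{ti..tf}" "\<lambda>s. ham u x s" "\<lambda>s. l s * u x s", OF t eig] by blast
    then show ?thesis by (simp add: mult.commute)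
  qed
  ultimately have e1: "- 1 / (\<nu> * \<beta>) * Lu' - 1 / (2 * \<nu>) * (LU' * u x t + LU * dt u x t)
     + \<beta> / (4 * \<nu>) * (2 * GG * u x t + G2 * dt u x t) = l' * u x t + l t * dt u x t"
    using time_deriv_eq[OF _ t] by metis
  \<comment> \<open>The equation itself is needed besides its time derivative: the Laplacian of
    \<open>dt U\<close> times u contains \<open>dt U\<close> times the Laplacian of u.\<close>
  have e2: "l t * u x t = - 1 / (\<nu> * \<beta>) * Lu - 1 / (2 * \<nu>) * LU * u x t + \<beta> / (4 * \<nu>) * G2 * u x t"
    using eig[OF t, of x] unfolding ham_eq Lu_def LU_def G2_def by simp
  have g1: "dx i g y t = dx i (dt u) y t - \<beta> / 2 * (dx i (dt U) y t * u y t + dt U y t * dx i u y t)" for i y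
    unfolding g_def by (intro dx_eq has_partial_diff has_partial_cmult has_partial_mult smooth_has_dx
        smooth_dt smooth_dx smooth_U su t)
  have "has_partial i (\<lambda>y. dx i g y t) x (dx i (dx i (dt u)) x t -
      \<beta> / 2 * ((dx i (dx i (dt U)) x t * u x t + dx i (dt U) x t * dx i u x t)
        + (dx i (dt U) x t * dx i u x t + dt U x t * dx i (dx i u) x t)))" for i
    unfolding g1 by (intro has_partial_diff has_partial_cmult has_partial_add has_partial_mult smooth_has_dx
        smooth_dt smooth_dx smooth_U su t)
  then have g2: "dx i (dx i g) x t = dx i (dx i (dt u)) x t -
      \<beta> / 2 * ((dx i (dx i (dt U)) x t * u x t + dx i (dt U) x t * dx i u x t)
        + (dx i (dt U) x t * dx i u x t + dt U x t * dx i (dx i u) x t))" for i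
    by (rule dx_eq)
  have Lg: "(\<Sum>i\<in>UNIV. dx i (dx i g) x t) = Lu' - \<beta> / 2 * (LU' * u x t + 2 * Gu + dt U x t * Lu)"
    unfolding g2 Lu'_def LU'_def Gu_def Lu_def
    by (simp add: sum.distrib sum_subtractf sum_distrib_left sum_distrib_right algebra_simps)
  have "has_partial i (\<lambda>y. expU y t * (u y t * dx i (dt U) y t)) x
      (expU x t * ((dx i u x t * dx i (dt U) x t + u x t * dx i (dx i (dt U)) x t)
        - \<beta> / 2 * dx i U x t * (u x t * dx i (dt U) x t)))" for i
    by (rule has_partial_expU_mult[OF t, where w = "\<lambda>y t. u y t * dx i (dt U) y t"])
       (intro has_partial_mult smooth_has_dx smooth_dt smooth_dx smooth_U su t)
  then have pd: "partial_deriv i (\<lambda>y. expU y t * u y t * dx i (dt U) y t) x =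
      (expU x t * ((dx i u x t * dx i (dt U) x t + u x t * dx i (dx i (dt U)) x t)
        - \<beta> / 2 * dx i U x t * (u x t * dx i (dt U) x t)))" for i
    unfolding mult.assoc by (rule has_partial_imp_partial_deriv)
  have "fokker_planck_dot \<nu> (\<lambda>y. dt U y t) (\<lambda>y. expU y t * u y t) x
     = 1 / \<nu> * (\<Sum>i\<in>UNIV. partial_deriv i (\<lambda>y. expU y t * u y t * dx i (dt U) y t) x)"
    unfolding fokker_planck_dot_def divergence_def grad_def dx_def by simp
  also have "\<dots> = expU x t * (1 / \<nu> * (Gu + u x t * LU' - \<beta> / 2 * (u x t * GG)))"
    unfolding pd Gu_def LU'_def GG_def
    by (simp add: sum.distrib sum_subtractf sum_distrib_left sum_distrib_right algebra_simps)
  finally have fd0: "fokker_planck_dot \<nu> (\<lambda>y. dt U y t) (\<lambda>y. expU y t * u y t) x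
      = expU x t * (1 / \<nu> * (Gu + u x t * LU' - \<beta> / 2 * (u x t * GG)))" .
  have fd: "exp (\<beta> * U x t / 2) * fokker_planck_dot \<nu> (\<lambda>y. dt U y t) (\<lambda>y. expU y t * u y t) x
      = 1 / \<nu> * (Gu + u x t * LU' - \<beta> / 2 * (u x t * GG))"
    unfolding fd0 by (rule expU_inverse)
  have hg: "ham g x t = - 1 / (\<nu> * \<beta>) * (Lu' - \<beta> / 2 * (LU' * u x t + 2 * Gu + dt U x t * Lu))
      - 1 / (2 * \<nu>) * LU * g x t + \<beta> / (4 * \<nu>) * G2 * g x t"
    unfolding ham_eq Lg LU_def G2_def by simp
  have "ham g x t = l t * g x t + l' * u x t + 1 / \<nu> * (Gu + u x t * LU' - \<beta> / 2 * (u x t * GG))"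
  proof -
    \<comment> \<open>Multiplication by \<nu> \<beta> clears all denominators and leaves a
      polynomial identity in the abbreviations.\<close>
    have "\<nu> * \<beta> * (ham g x t) = - (Lu' - \<beta> / 2 * (LU' * u x t + 2 * Gu + dt U x t * Lu))
      - \<beta> / 2 * LU * g x t + \<beta> * \<beta> / 4 * G2 * g x t"
      unfolding hg using nu_pos beta_pos by (simp add: field_simps)
    moreover have "\<nu> * \<beta> * (l' * u x t + l t * dt u x t) = - Lu' - \<beta> / 2 * (LU' * u x t + LU * dt u x t)
      + \<beta> * \<beta> / 4 * (2 * GG * u x t + G2 * dt u x t)"
      unfolding e1[symmetric] using nu_pos beta_pos by (simp add: field_simps)
    moreover have "\<nu> * \<beta> * (l t * u x t) = - Lu - \<beta> / 2 * LU * u x t + \<beta> * \<beta> / 4 * G2 * u x t"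
      unfolding e2 using nu_pos beta_pos by (simp add: field_simps)
    moreover have "\<nu> * \<beta> * (1 / \<nu> * (Gu + u x t * LU' - \<beta> / 2 * (u x t * GG))) =
        \<beta> * (Gu + u x t * LU' - \<beta> / 2 * (u x t * GG))"
      using nu_pos by simp
    moreover have "g x t = dt u x t - \<beta> / 2 * (dt U x t * u x t)" by (simp add: g_def)
    ultimately have "\<nu> * \<beta> * ham g x t =
        \<nu> * \<beta> * (l t * g x t + l' * u x t + 1 / \<nu> * (Gu + u x t * LU' - \<beta> / 2 * (u x t * GG)))"
      by algebra
    then show ?thesis using nu_pos beta_pos by simp
  qed
  then show ?thesis unfolding fd g_def by simp
qed

end

section \<open>Uniqueness for the Fokker-Planck equation\<close>

definition smooth_abs :: "real \<Rightarrow> real \<Rightarrow> real" where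
  "smooth_abs e s = sqrt (s\<^sup>2 + e\<^sup>2) - e"

definition smooth_abs1 :: "real \<Rightarrow> real \<Rightarrow> real" where
  "smooth_abs1 e s = s / sqrt (s\<^sup>2 + e\<^sup>2)"

definition smooth_abs2 :: "real \<Rightarrow> real \<Rightarrow> real" where
  "smooth_abs2 e s = e\<^sup>2 / sqrt (s\<^sup>2 + e\<^sup>2) ^ 3"

context
  fixes e :: real
  assumes e: "0 < e"
begin

lemma smooth_abs_sqrt: "0 < s\<^sup>2 + e\<^sup>2" "0 < sqrt (s\<^sup>2 + e\<^sup>2)" "e \<le> sqrt (s\<^sup>2 + e\<^sup>2)" "\<bar>s\<bar> \<le> sqrt (s\<^sup>2 + e\<^sup>2)"
proof -
  show 1: "0 < s\<^sup>2 + e\<^sup>2" using e by (simp add: add_nonneg_pos)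
  then show "0 < sqrt (s\<^sup>2 + e\<^sup>2)" by simp
  show "e \<le> sqrt (s\<^sup>2 + e\<^sup>2)" by (rule real_le_rsqrt) simp
  show "\<bar>s\<bar> \<le> sqrt (s\<^sup>2 + e\<^sup>2)" by (rule real_le_rsqrt) simp
qed

lemma DERIV_smooth_abs: "(smooth_abs e has_real_derivative smooth_abs1 e s) (at s)"
  unfolding smooth_abs_def[abs_def] smooth_abs1_def using smooth_abs_sqrt[of s]
  by (auto intro!: derivative_eq_intros simp: field_simps)

lemma DERIV_smooth_abs1: "(smooth_abs1 e has_real_derivative smooth_abs2 e s) (at s)"
proof -
  let ?q = "sqrt (s\<^sup>2 + e\<^sup>2)"
  have q: "0 < ?q" "?q * ?q = s\<^sup>2 + e\<^sup>2" using smooth_abs_sqrt[of s] by auto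
  have "((\<lambda>s. sqrt (s\<^sup>2 + e\<^sup>2)) has_real_derivative s / ?q) (at s)"
    using smooth_abs_sqrt[of s] by (auto intro!: derivative_eq_intros simp: field_simps)
  from DERIV_divide[OF DERIV_ident this less_imp_neq[OF q(1), symmetric]]
  have "((\<lambda>s. s / sqrt (s\<^sup>2 + e\<^sup>2)) has_real_derivative (1 * ?q - s * (s / ?q)) / (?q * ?q)) (at s)" .
  moreover have "(1 * q - s * (s / q)) / (q * q) = (q * q - s\<^sup>2) / q ^ 3" if "0 < q" for q
    using that by (simp add: field_simps power2_eq_square power3_eq_cube)
  from this[OF q(1)] have "(1 * ?q - s * (s / ?q)) / (?q * ?q) = smooth_abs2 e s"
    unfolding smooth_abs2_def q(2) by simp
  ultimately show ?thesis unfolding smooth_abs1_def[abs_def] by simp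
qed

text \<open>The shift by \<open>e\<close> in \<open>smooth_abs\<close> serves this bound: without it
  the composition with a decaying function would tend to \<open>e\<close> at infinity and not be
  integrable.\<close>

lemma smooth_abs_bound: "\<bar>smooth_abs e s\<bar> \<le> \<bar>s\<bar>"
proof -
  have "sqrt (s\<^sup>2 + e\<^sup>2) \<le> sqrt (s\<^sup>2) + sqrt (e\<^sup>2)" by (rule sqrt_add_le_add_sqrt) auto
  then show ?thesis unfolding smooth_abs_def using smooth_abs_sqrt(3)[of s] e by simp
qed

lemma smooth_abs1_bound: "\<bar>smooth_abs1 e s\<bar> \<le> 1"
  unfolding smooth_abs1_def using smooth_abs_sqrt[of s] by (simp add: abs_divide divide_le_eq)

lemma smooth_abs2_nonneg: "0 \<le> smooth_abs2 e s"
  unfolding smooth_abs2_def using smooth_abs_sqrt[of s] by simp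

lemma smooth_abs2_bound: "\<bar>smooth_abs2 e s\<bar> \<le> 1 / e"
proof -
  have "e ^ 3 \<le> sqrt (s\<^sup>2 + e\<^sup>2) ^ 3" using smooth_abs_sqrt[of s] e by (intro power_mono) auto
  then have "smooth_abs2 e s \<le> e\<^sup>2 / e ^ 3"
    unfolding smooth_abs2_def using e by (intro divide_left_mono) (auto intro!: mult_pos_pos simp: smooth_abs_sqrt)
  then show ?thesis using smooth_abs2_nonneg[of s] e by (simp add: power2_eq_square power3_eq_cube)
qed

text \<open>The root q of s^2 + e^2 is at least \<open>e\<close> and at least |s|, so q^2 is at
  least e |s|; the cube of this inequality bounds the denominator of the squared claim. The power
  sqrt |s| left on the right is what will compensate the growth of the squared gradient of the
  potential.\<close>

lemma smooth_abs2_square: "smooth_abs2 e s * s\<^sup>2 \<le> sqrt (e * \<bar>s\<bar>)"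
proof (rule real_le_rsqrt)
  let ?q = "sqrt (s\<^sup>2 + e\<^sup>2)"
  have q: "0 < ?q" "e * \<bar>s\<bar> \<le> ?q\<^sup>2"
    using smooth_abs_sqrt[of s] mult_mono[OF smooth_abs_sqrt(3)[of s] smooth_abs_sqrt(4)[of s]] e
    by (auto simp: power2_eq_square)
  have "(e\<^sup>2 / q ^ 3 * s\<^sup>2)\<^sup>2 \<le> e * \<bar>s\<bar>" if q: "0 < q" "e * \<bar>s\<bar> \<le> q\<^sup>2" for q
  proof -
    have "(e * \<bar>s\<bar>) * (e * \<bar>s\<bar>) ^ 3 \<le> (e * \<bar>s\<bar>) * (q\<^sup>2) ^ 3"
      using e q by (intro mult_left_mono power_mono) auto
    moreover have "(e * \<bar>s\<bar>) * (e * \<bar>s\<bar>) ^ 3 = (e\<^sup>2 * s\<^sup>2)\<^sup>2"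
      by (simp add: power_mult_distrib power2_eq_square power3_eq_cube abs_if)
    moreover have "(q\<^sup>2) ^ 3 = (q ^ 3)\<^sup>2" by (simp add: power_mult[symmetric])
    ultimately have "(e\<^sup>2 * s\<^sup>2)\<^sup>2 \<le> (e * \<bar>s\<bar>) * (q ^ 3)\<^sup>2" by simp
    moreover have "0 < (q ^ 3)\<^sup>2" using q(1) by simp
    ultimately have "(e\<^sup>2 * s\<^sup>2)\<^sup>2 / (q ^ 3)\<^sup>2 \<le> e * \<bar>s\<bar>" by (simp add: pos_divide_le_eq)
    then show ?thesis by (simp add: power_divide power_mult_distrib)
  qed
  from this[OF q] show "(smooth_abs2 e s * s\<^sup>2)\<^sup>2 \<le> e * \<bar>s\<bar>"
    unfolding smooth_abs2_def .
qed

text \<open>With q the root of s^2 + e^2, s^2 factors as (q + e) (q - e), and the second factor is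
  \<open>smooth_abs e s\<close>. This lets an estimate for \<open>smooth_abs e\<close> control the
  square integral of a bounded function.\<close>

lemma smooth_abs_lower:
  assumes "e \<le> 1" "\<bar>s\<bar> \<le> R" shows "s\<^sup>2 \<le> (R + 2) * smooth_abs e s"
proof -
  let ?q = "sqrt (s\<^sup>2 + e\<^sup>2)"
  have q: "?q * ?q = s\<^sup>2 + e\<^sup>2" "0 < ?q" using smooth_abs_sqrt[of s] by auto
  have "?q \<le> \<bar>s\<bar> + e" using smooth_abs_bound[of s] unfolding smooth_abs_def by simp
  then have "?q + e \<le> R + 2" using assms by simp
  moreover have "0 \<le> smooth_abs e s" unfolding smooth_abs_def using smooth_abs_sqrt(3)[of s] by simp
  ultimately have "(?q + e) * smooth_abs e s \<le> (R + 2) * smooth_abs e s" by (rule mult_right_mono)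
  moreover have "(?q + e) * smooth_abs e s = s\<^sup>2"
    unfolding smooth_abs_def using q(1) by (simp add: algebra_simps power2_eq_square)
  ultimately show ?thesis by simp
qed

end

context time_interval
begin

lemma continuous_spacetime_compose:
  assumes "continuous_on spacetime (\<lambda>(x, t). f x t)" "continuous_on UNIV \<phi>"
  shows "continuous_on spacetime (\<lambda>(x, t). \<phi> (f x t))"
proof -
  have "continuous_on spacetime (\<phi> \<circ> (\<lambda>(x, t). f x t))"
    using continuous_on_compose[OF assms(1)] continuous_on_subset[OF assms(2) subset_UNIV] by blast
  then show ?thesis by (simp add: o_def case_prod_unfold)
qed

lemma dom_compose:
  assumes "dom f" "continuous_on UNIV \<phi>" "\<And>s. \<bar>\<phi> s\<bar> \<le> \<bar>s\<bar>"
  shows "dom (\<lambda>x t. \<phi> (f x t))"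
proof -
  obtain C where "0 \<le> C" and C: "\<And>x t. t \<in> {ti..tf} \<Longrightarrow> \<bar>f x t\<bar> \<le> C * weight x"
    using assms(1) by (rule domE) (rule that)
  have "\<bar>\<phi> (f x t)\<bar> \<le> C * weight x" if "t \<in> {ti..tf}" for x t
    using order_trans[OF assms(3) C[OF that]] .
  moreover have "continuous_on spacetime (\<lambda>(x, t). \<phi> (f x t))"
    using continuous_spacetime_compose[of f, OF _ assms(2)] assms(1) unfolding dom_def by blast
  ultimately show ?thesis unfolding dom_def by blast
qed

lemma bdd_compose:
  assumes "dom f" "continuous_on UNIV \<phi>" "\<And>s. \<bar>\<phi> s\<bar> \<le> B"
  shows "bdd (\<lambda>x t. \<phi> (f x t))"
proof -
  have "continuous_on spacetime (\<lambda>(x, t). \<phi> (f x t))"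
    using continuous_spacetime_compose[of f, OF _ assms(2)] assms(1) unfolding dom_def by blast
  then show ?thesis unfolding bdd_def using assms(3) by blast
qed

end

text \<open>The added assumption says that the potential is bounded below uniformly in time;
  \<open>mainTheorem2\<close> derives it from the boundedness of the ground state.\<close>

locale fp_bounded = fp_operators +
  assumes expU_bounded: "\<exists>C. \<forall>x. \<forall>t\<in>{ti..tf}. expU x t \<le> C"
begin

lemma bdd_expU: "bdd expU"
proof -
  have "continuous_on spacetime (\<lambda>(x, t). exp (- \<beta> * U x t / 2))"
    by (rule continuous_spacetime_compose[OF smooth_continuous[OF smooth_U], of "\<lambda>v. exp (- \<beta> * v / 2)"])
       (intro continuous_intros, simp)
  moreover obtain C where "\<forall>x. \<forall>t\<in>{ti..tf}. expU x t \<le> C" using expU_bounded by blast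
  ultimately show ?thesis unfolding bdd_def using expU_pos
    by (auto simp: expU_def[abs_def] intro!: exI[of _ C])
qed

lemma dom_expU: "van f \<Longrightarrow> dom (\<lambda>x t. expU x t * f x t)"
  by (intro dom_mult_bdd bdd_expU van_dom)

text \<open>The \<open>L\<^sup>1\<close> contraction of the Fokker-Planck evolution: for \<open>r = exp (- \<beta> U / 2) w\<close>
  the flux \<open>J\<close> satisfies \<open>\<nabla>r \<bullet> J \<ge> - c r\<^sup>2 (\<nabla>U)\<^sup>2\<close>, and \<open>smooth_abs2 e r * r\<^sup>2\<close> is of order
  \<open>sqrt e\<close>.\<close>

theorem fokker_planck_unique:
  assumes w: "van w"
    and eq: "\<And>t. t \<in> {ti..tf} \<Longrightarrow> AE x in lborel. dt w x t - \<beta> / 2 * (dt U x t * w x t) = - ham w x t"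
    and init: "AE x in lborel. w x ti = 0"
    and t: "t \<in> {ti..tf}"
  shows "AE x in lborel. w x t = 0"
proof -
  define k where "k = 1 / (\<nu> * \<beta>)"
  have k: "0 < k" using nu_pos beta_pos by (simp add: k_def)
  \<comment> \<open>\<open>rt\<close> and \<open>rx i\<close> are the derivatives of
    \<open>r\<close>, \<open>J i\<close> are the components of the flux k grad r + (1 / \<nu>) r
    grad U, and \<open>G i\<close> is the derivative of \<open>J i\<close> in direction
    \<open>i\<close>. Written as \<open>expU\<close> times a rapidly vanishing function, each of
    them is dominated.\<close>
  define r where "r x t = expU x t * w x t" for x t
  define rt where "rt x t = expU x t * (dt w x t - \<beta> / 2 * (dt U x t * w x t))" for x t
  define rx where "rx i x t = expU x t * (dx i w x t - \<beta> / 2 * (dx i U x t * w x t))" for i x t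
  define J where "J i x t = expU x t * (k * dx i w x t + k * \<beta> / 2 * (dx i U x t * w x t))" for i x t
  define G where "G i x t = expU x t * (k * dx i (dx i w) x t
      + k * \<beta> / 2 * (dx i (dx i U) x t * w x t + dx i U x t * dx i w x t)
      - \<beta> / 2 * (dx i U x t * (k * dx i w x t + k * \<beta> / 2 * (dx i U x t * w x t))))" for i x t
  have dom_r: "dom r" unfolding r_def[abs_def] by (intro dom_expU w)
  have dom_rt: "dom rt" unfolding rt_def[abs_def]
    by (rule dom_expU) (intro van_diff van_cmult van_dt van_dtU w)
  have dom_rx: "dom (rx i)" for i unfolding rx_def[abs_def]
    by (rule dom_expU) (intro van_diff van_cmult van_dx van_dxU w)
  have dom_J: "dom (J i)" for i unfolding J_def[abs_def]
    by (rule dom_expU) (intro van_add van_cmult van_dx van_dxU w)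
  have dom_G: "dom (G i)" for i unfolding G_def[abs_def]
    by (rule dom_expU) (intro van_add van_diff van_cmult van_dxU van_add van_cmult van_dxxU van_dx van_dxU w)
  have r_t: "(r x has_real_derivative rt x t) (at t within {ti..tf})" if "t \<in> {ti..tf}" for x t
    using DERIV_mult[OF has_dt_expU[OF that] van_has_dt[OF w that], of x]
    unfolding r_def[abs_def] rt_def by (simp add: algebra_simps)
  have r_x: "has_partial i (\<lambda>y. r y t) x (rx i x t)" if "t \<in> {ti..tf}" for i x t
    using has_partial_expU_mult[where w = w, OF that van_has_dx[OF w that]] unfolding r_def rx_def by (simp add: mult.assoc)
  have J_x: "has_partial i (\<lambda>y. J i y t) x (G i x t)" if "t \<in> {ti..tf}" for i x t
  proof -
    have "has_partial i (\<lambda>y. k * dx i w y t + k * \<beta> / 2 * (dx i U y t * w y t)) x (k * dx i (dx i w) x t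
      + k * \<beta> / 2 * (dx i (dx i U) x t * w x t + dx i U x t * dx i w x t))"
      by (intro has_partial_add has_partial_cmult has_partial_mult smooth_has_dx smooth_dx smooth_U van_smooth w that)
    from has_partial_expU_mult[where w = "\<lambda>y t. k * dx i w y t + k * \<beta> / 2 * (dx i U y t * w y t)", OF that this]
    show ?thesis unfolding J_def G_def by (simp add: mult.assoc)
  qed
  have sumG: "(\<Sum>i\<in>UNIV. G i x t) = - (expU x t * ham w x t)" for x t
  proof -
    have k1: "k * \<beta> / 2 = 1 / (2 * \<nu>)" and k2: "1 / (2 * \<nu>) * (\<beta> / 2) = \<beta> / (4 * \<nu>)"
      using nu_pos beta_pos by (auto simp: k_def)
    have gen: "\<beta> / 2 * (a * (k * b + k * \<beta> / 2 * (a * c))) = (k * \<beta> / 2) * (a * b) + (k * \<beta> / 2 * (\<beta> / 2)) * (a * a * c)" for a b c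
      by (simp add: algebra_simps)
    have "G i x t = expU x t * (k * dx i (dx i w) x t + 1 / (2 * \<nu>) * (dx i (dx i U) x t * w x t)
        - \<beta> / (4 * \<nu>) * (dx i U x t * dx i U x t * w x t))" for i
      unfolding G_def gen unfolding k1 k2 by (simp add: algebra_simps)
    then have "(\<Sum>i\<in>UNIV. G i x t) = (\<Sum>i\<in>UNIV. expU x t * (k * dx i (dx i w) x t + 1 / (2 * \<nu>) * (dx i (dx i U) x t * w x t)
        - \<beta> / (4 * \<nu>) * (dx i U x t * dx i U x t * w x t)))" by simp
    also have "\<dots> = - (expU x t * ham w x t)" unfolding ham_eq k_def
      by (simp add: sum.distrib sum_subtractf sum_negf sum_distrib_left sum_distrib_right algebra_simps)
    finally show ?thesis .
  qed
  \<comment> \<open>After squaring, the claim concerns \<open>w\<close> times the fourth power of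
    \<open>dx i U\<close>. This is still rapidly vanishing, also after two divisions by
    \<open>weight\<close>, because the decay is measured relative to the potential.\<close>
  have "\<exists>K. \<forall>x. \<forall>t\<in>{ti..tf}. sqrt \<bar>r x t\<bar> * (dx i U x t)\<^sup>2 \<le> K * weight x" for i
  proof -
    obtain C where C: "\<forall>x. \<forall>t\<in>{ti..tf}.
        \<bar>dx i U x t * (dx i U x t * (dx i U x t * (dx i U x t * w x t))) / weight x / weight x\<bar> \<le> C"
      using van_bounded[OF van_divide_weight[OF van_divide_weight[OF van_dxU[OF van_dxU[OF van_dxU[OF van_dxU[OF w]]]]]]]
      by blast
    obtain B where B: "\<forall>x. \<forall>t\<in>{ti..tf}. expU x t \<le> B" using expU_bounded by blast
    have "sqrt \<bar>r x t\<bar> * (dx i U x t)\<^sup>2 \<le> sqrt (B * C) * weight x" if t: "t \<in> {ti..tf}" for x t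
    proof -
      let ?p = "\<bar>w x t\<bar> * ((dx i U x t)\<^sup>2)\<^sup>2"
      have "?p = \<bar>dx i U x t * (dx i U x t * (dx i U x t * (dx i U x t * w x t))) / weight x / weight x\<bar> * (weight x)\<^sup>2"
        using weight_pos[of x] by (simp add: abs_mult power2_eq_square abs_divide)
      also have "\<dots> \<le> C * (weight x)\<^sup>2" using C t by (intro mult_right_mono) auto
      finally have p: "?p \<le> C * (weight x)\<^sup>2" .
      have "\<bar>r x t\<bar> * ((dx i U x t)\<^sup>2)\<^sup>2 = expU x t * ?p"
        unfolding r_def using expU_pos[of x t] by (simp add: abs_mult)
      also have "\<dots> \<le> B * (C * (weight x)\<^sup>2)"
      proof (rule mult_mono[OF _ p])
        show "expU x t \<le> B" using B t by blast
        then show "0 \<le> B" using expU_pos[of x t] by linarith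
      qed simp
      finally have "sqrt (\<bar>r x t\<bar> * ((dx i U x t)\<^sup>2)\<^sup>2) \<le> sqrt (B * C * (weight x)\<^sup>2)"
        by (simp add: mult.assoc)
      then show ?thesis using weight_pos[of x] unfolding real_sqrt_mult real_sqrt_abs by simp
    qed
    then show ?thesis by blast
  qed
  then have "\<forall>i. \<exists>K. \<forall>x. \<forall>t\<in>{ti..tf}. sqrt \<bar>r x t\<bar> * (dx i U x t)\<^sup>2 \<le> K * weight x" ..
  from choice[OF this] obtain K where
    K': "\<forall>i x. \<forall>t\<in>{ti..tf}. sqrt \<bar>r x t\<bar> * (dx i U x t)\<^sup>2 \<le> K i * weight x" ..
  then have K: "sqrt \<bar>r x t\<bar> * (dx i U x t)\<^sup>2 \<le> K i * weight x" if "t \<in> {ti..tf}" for i x t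
    using that by simp
  \<comment> \<open>\<open>L\<close> is the integral over space of the bounds in \<open>Qle\<close>,
    summed over the directions, with the factor sqrt e taken out.\<close>
  define L where "L = (\<Sum>i\<in>UNIV. k * \<beta>\<^sup>2 / 4 * K i) * (LINT x::real^'a|lborel. weight x)"
  have decay: "(LINT x|lborel. smooth_abs e (r x t)) \<le> sqrt e * L * (t - ti)"
    if e: "0 < e" for e
  proof -
    have c0: "continuous_on UNIV (smooth_abs e)" and c1: "continuous_on UNIV (smooth_abs1 e)"
      using DERIV_smooth_abs[OF e] DERIV_smooth_abs1[OF e] by (auto intro!: DERIV_continuous_on)
    have c2: "continuous_on UNIV (smooth_abs2 e)"
      unfolding smooth_abs2_def[abs_def]
      by (intro continuous_intros ballI less_imp_neq[THEN not_sym] zero_less_power smooth_abs_sqrt(2)[OF e])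
    have dom0: "dom (\<lambda>x t. smooth_abs e (r x t))"
      by (rule dom_compose[OF dom_r c0 smooth_abs_bound[OF e]])
    have b1: "bdd (\<lambda>x t. smooth_abs1 e (r x t))"
      by (rule bdd_compose[OF dom_r c1 smooth_abs1_bound[OF e]])
    have b2: "bdd (\<lambda>x t. smooth_abs2 e (r x t))"
      by (rule bdd_compose[OF dom_r c2 smooth_abs2_bound[OF e]])
    have d: "((\<lambda>t. LINT x|lborel. smooth_abs e (r x t)) has_real_derivative
        (LINT x|lborel. smooth_abs1 e (r x s) * rt x s)) (at s within {ti..tf})" if "s \<in> {ti..tf}" for s
      by (rule dom_integral_derivative[OF dom0 dom_mult_bdd[OF dom_rt b1] that])
         (rule DERIV_chain2[OF DERIV_smooth_abs[OF e] r_t])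
    have le: "(LINT x|lborel. smooth_abs1 e (r x s) * rt x s) \<le> sqrt e * L" if s: "s \<in> {ti..tf}" for s
    proof -
      define Q where "Q i x t = smooth_abs2 e (r x t) * rx i x t * J i x t" for i x t
      have dom_Q: "dom (Q i)" for i unfolding Q_def[abs_def] mult.assoc
        by (rule dom_mult_bdd[OF dom_mult[OF dom_J dom_rx] b2])
      have dom_1G: "dom (\<lambda>x t. smooth_abs1 e (r x t) * G i x t)" for i
        by (rule dom_mult_bdd[OF dom_G b1])
      have ibp: "(LINT x|lborel. smooth_abs1 e (r x s) * G i x s) = - (LINT x|lborel. Q i x s)" for i
      proof -
        have "(LINT x|lborel. Q i x s + smooth_abs1 e (r x s) * G i x s) = 0"
        proof (rule dom_integral_partial[OF dom_mult_bdd[OF dom_J b1] dom_add[OF dom_Q dom_1G] s])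
          fix x
          have "has_partial i (\<lambda>y. smooth_abs1 e (r y s)) x (smooth_abs2 e (r x s) * rx i x s)"
            by (rule has_partial_compose[OF DERIV_smooth_abs1[OF e] r_x[OF s]])
          from has_partial_mult[OF this J_x[OF s]]
          show "has_partial i (\<lambda>y. smooth_abs1 e (r y s) * J i y s) x (Q i x s + smooth_abs1 e (r x s) * G i x s)"
            unfolding Q_def .
        qed
        moreover have "(LINT x|lborel. Q i x s + smooth_abs1 e (r x s) * G i x s)
            = (LINT x|lborel. Q i x s) + (LINT x|lborel. smooth_abs1 e (r x s) * G i x s)"
          by (intro Bochner_Integration.integral_add dom_integrable[OF dom_Q s] dom_integrable[OF dom_1G s])
        ultimately show ?thesis by simp
      qed
      have Qle: "- Q i x s \<le> sqrt e * (k * \<beta>\<^sup>2 / 4 * K i) * weight x" for i x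
      proof -
        \<comment> \<open>Gradient and flux are a difference and a multiple of a sum of the same two
          terms. Their product is thus a difference of squares, and only the square that contains
          the potential gradient has the wrong sign.\<close>
        have "- (rx i x s * J i x s) = k * ((\<beta> / 2 * dx i U x s)\<^sup>2 * (r x s)\<^sup>2 - (expU x s * dx i w x s)\<^sup>2)"
          unfolding rx_def J_def r_def by (simp add: power2_eq_square field_simps)
        also have "\<dots> \<le> k * ((\<beta> / 2 * dx i U x s)\<^sup>2 * (r x s)\<^sup>2)"
          using k by (intro mult_left_mono) auto
        finally have 1: "- (rx i x s * J i x s) \<le> k * ((\<beta> / 2 * dx i U x s)\<^sup>2 * (r x s)\<^sup>2)" .
        have "- Q i x s \<le> smooth_abs2 e (r x s) * (k * ((\<beta> / 2 * dx i U x s)\<^sup>2 * (r x s)\<^sup>2))"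
          using mult_left_mono[OF 1 smooth_abs2_nonneg[OF e, of "r x s"]] unfolding Q_def by (simp add: mult.assoc)
        also have "\<dots> = (k * \<beta>\<^sup>2 / 4 * (dx i U x s)\<^sup>2) * (smooth_abs2 e (r x s) * (r x s)\<^sup>2)"
          by (simp add: power2_eq_square)
        also have "\<dots> \<le> (k * \<beta>\<^sup>2 / 4 * (dx i U x s)\<^sup>2) * sqrt (e * \<bar>r x s\<bar>)"
          using k by (intro mult_left_mono smooth_abs2_square[OF e]) auto
        also have "\<dots> = sqrt e * (k * \<beta>\<^sup>2 / 4) * (sqrt \<bar>r x s\<bar> * (dx i U x s)\<^sup>2)"
          by (simp add: real_sqrt_mult)
        also have "\<dots> \<le> sqrt e * (k * \<beta>\<^sup>2 / 4) * (K i * weight x)"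
          using k e by (intro mult_left_mono K s) auto
        finally show ?thesis by (simp add: mult.assoc)
      qed
      have iG: "integrable lborel (\<lambda>x. smooth_abs1 e (r x s) * G i x s)" for i
        by (rule dom_integrable[OF dom_1G s])
      have "AE x in lborel. smooth_abs1 e (r x s) * rt x s = (\<Sum>i\<in>UNIV. smooth_abs1 e (r x s) * G i x s)"
        using eq[OF s]
      proof eventually_elim
        case (elim x)
        then have "rt x s = (\<Sum>i\<in>UNIV. G i x s)" unfolding rt_def sumG by simp
        then show ?case by (simp add: sum_distrib_left)
      qed
      then have "(LINT x|lborel. smooth_abs1 e (r x s) * rt x s)
          = (LINT x|lborel. (\<Sum>i\<in>UNIV. smooth_abs1 e (r x s) * G i x s))"
        by (intro integral_cong_AE dom_slice(2)[OF dom_mult_bdd[OF dom_rt b1] s]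
            borel_measurable_sum dom_slice(2)[OF dom_1G s])
      also have "\<dots> = (\<Sum>i\<in>UNIV. LINT x|lborel. smooth_abs1 e (r x s) * G i x s)"
        by (rule Bochner_Integration.integral_sum[OF iG])
      also have "\<dots> = (\<Sum>i\<in>UNIV. LINT x|lborel. - Q i x s)" unfolding ibp by simp
      also have "\<dots> \<le> (\<Sum>i\<in>UNIV. LINT x::real^'a|lborel. sqrt e * (k * \<beta>\<^sup>2 / 4 * K i) * weight x)"
        by (intro sum_mono integral_mono Qle integrable_mult_right integrable_weight
            Bochner_Integration.integrable_minus dom_integrable[OF dom_Q s])
      also have "\<dots> = sqrt e * L" unfolding L_def by (simp add: sum_distrib_left sum_distrib_right mult.assoc)
      finally show ?thesis .
    qed
    have 0: "(LINT x|lborel. smooth_abs e (r x ti)) = 0"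
    proof -
      have "AE x in lborel. smooth_abs e (r x ti) = 0"
        using init by eventually_elim (use e in \<open>simp add: r_def smooth_abs_def\<close>)
      then have "(LINT x|lborel. smooth_abs e (r x ti)) = (LINT x::real^'a|lborel. 0)"
        using ti_less_tf by (intro integral_cong_AE dom_slice(2)[OF dom0]) auto
      then show ?thesis by simp
    qed
    show ?thesis
    proof (cases "t = ti")
      case False
      then have tt: "ti < t" using t by simp
      have "\<exists>s\<in>{ti<..<t}. (LINT x|lborel. smooth_abs e (r x t)) - (LINT x|lborel. smooth_abs e (r x ti))
          = (LINT x|lborel. smooth_abs1 e (r x s) * rt x s) * (t - ti)"
      proof (rule mvt_simple[OF tt])
        fix s assume "ti \<le> s" "s \<le> t"
        then show "((\<lambda>t. LINT x|lborel. smooth_abs e (r x t)) has_derivative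
            (*) (LINT x|lborel. smooth_abs1 e (r x s) * rt x s)) (at s within {ti..t})"
          using t unfolding has_field_derivative_def[symmetric] by (intro DERIV_subset[OF d]) auto
      qed
      then obtain s where s: "s \<in> {ti<..<t}" "(LINT x|lborel. smooth_abs e (r x t))
          = (LINT x|lborel. smooth_abs1 e (r x s) * rt x s) * (t - ti)" unfolding 0 by auto
      then show ?thesis using tt t by (auto intro!: mult_right_mono le)
    qed (simp add: 0)
  qed
  have dom_rr: "dom (\<lambda>x t. r x t * r x t)" by (rule dom_mult[OF dom_r dom_r])
  \<comment> \<open>The square integral does not depend on \<open>e\<close>, while its upper bound,
    obtained from \<open>decay\<close> and \<open>smooth_abs_lower\<close>, is a multiple of sqrt e.
    Letting \<open>e\<close> tend to 0 requires no limit under an integral.\<close>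
  have "(LINT x|lborel. r x t * r x t) = 0"
  proof (rule antisym)
    show "0 \<le> (LINT x|lborel. r x t * r x t)" by (intro integral_nonneg_AE) simp
    obtain R where R: "\<And>x. \<bar>r x t\<bar> \<le> R" using dom_bdd[OF dom_r] t unfolding bdd_def by blast
    have R0: "0 \<le> R" using order_trans[OF abs_ge_zero R] .
    have "(LINT x|lborel. r x t * r x t) \<le> (R + 2) * (L * (t - ti)) * sqrt e" if e: "0 < e" "e \<le> 1" for e
    proof -
      have c0: "continuous_on UNIV (smooth_abs e)"
        using DERIV_smooth_abs[OF e(1)] by (auto intro!: DERIV_continuous_on)
      have "dom (\<lambda>x t. smooth_abs e (r x t))"
        by (rule dom_compose[OF dom_r c0 smooth_abs_bound[OF e(1)]])
      then have "(LINT x|lborel. r x t * r x t) \<le> (LINT x|lborel. (R + 2) * smooth_abs e (r x t))"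
        using smooth_abs_lower[OF e R] t
        by (intro integral_mono dom_integrable[OF dom_rr] integrable_mult_right dom_integrable)
           (simp_all add: power2_eq_square)
      also have "\<dots> \<le> (R + 2) * (sqrt e * L * (t - ti))"
        using R0 by (simp add: mult_left_mono decay[OF e(1)])
      finally show ?thesis by (simp add: ac_simps)
    qed
    note bound = this
    have ev: "eventually (\<lambda>e. (LINT x|lborel. r x t * r x t) \<le> (R + 2) * (L * (t - ti)) * sqrt e) (at_right 0)"
      unfolding eventually_at_right_field by (rule exI[of _ 1]) (use bound in simp)
    have lim: "((\<lambda>e. (R + 2) * (L * (t - ti)) * sqrt e) \<longlongrightarrow> (R + 2) * (L * (t - ti)) * sqrt 0) (at_right 0)"
      by (rule tendsto_mult[OF tendsto_const tendsto_real_sqrt[OF tendsto_ident_at]])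
    show "(LINT x|lborel. r x t * r x t) \<le> 0"
      using tendsto_lowerbound[OF lim ev trivial_limit_at_right_real] by simp
  qed
  then have "AE x in lborel. r x t * r x t = 0"
    using integral_nonneg_eq_0_iff_AE[OF dom_integrable[OF dom_rr t]] by simp
  then show ?thesis
    by eventually_elim (use expU_pos in \<open>simp add: r_def less_imp_neq[symmetric]\<close>)
qed

end

section \<open>Completeness\<close>

lemma complete_orthonormalD:
  assumes "complete_orthonormal Idx w"
  shows "\<And>n \<alpha>. \<alpha> \<in> Idx n \<Longrightarrow> square_integrable (w n \<alpha>)"
    and "\<And>n m \<alpha> \<gamma>. \<alpha> \<in> Idx n \<Longrightarrow> \<gamma> \<in> Idx m \<Longrightarrow>
      (LINT x|lborel. w n \<alpha> x * w m \<gamma> x) = (if n = m \<and> \<alpha> = \<gamma> then 1 else 0)"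
    and "\<And>f. square_integrable f \<Longrightarrow> (\<lambda>k. LINT x|lborel.
           (f x - (\<Sum>n<k. \<Sum>\<alpha>\<in>Idx n. (LINT y|lborel. w n \<alpha> y * f y) * w n \<alpha> x))\<^sup>2) \<longlonglongrightarrow> 0"
  using assms unfolding complete_orthonormal_def by blast+

lemma square_integrable_mult:
  assumes "square_integrable f" "square_integrable g"
  shows "integrable lborel (\<lambda>x. f x * g x)"
proof (rule Bochner_Integration.integrable_bound)
  show "integrable lborel (\<lambda>x. (f x)\<^sup>2 + (g x)\<^sup>2)" using assms unfolding square_integrable_def by auto
  show "(\<lambda>x. f x * g x) \<in> borel_measurable lborel" using assms unfolding square_integrable_def by auto
  have "\<bar>a * b\<bar> \<le> a\<^sup>2 + b\<^sup>2" for a b :: real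
    using sum_squares_bound[of "\<bar>a\<bar>" "\<bar>b\<bar>"] mult_nonneg_nonneg[of "\<bar>a\<bar>" "\<bar>b\<bar>"]
    unfolding abs_mult power2_abs by linarith
  then show "AE x in lborel. norm (f x * g x) \<le> norm ((f x)\<^sup>2 + (g x)\<^sup>2)" by simp
qed

lemma square_integrable_add:
  assumes "square_integrable f" "square_integrable g"
  shows "square_integrable (\<lambda>x. f x + g x)"
  using assms square_integrable_mult[OF assms] unfolding square_integrable_def
  by (auto simp: power2_sum mult.assoc)

lemma square_integrable_cmult: "square_integrable f \<Longrightarrow> square_integrable (\<lambda>x. c * f x)"
  unfolding square_integrable_def by (auto simp: power_mult_distrib)

lemma square_integrable_sum:
  "finite I \<Longrightarrow> (\<And>i. i \<in> I \<Longrightarrow> square_integrable (f i)) \<Longrightarrow> square_integrable (\<lambda>x. \<Sum>i\<in>I. f i x)"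
proof (induction I rule: finite_induct)
  case empty then show ?case by (simp add: square_integrable_def)
next
  case (insert i I) then show ?case by (auto intro!: square_integrable_add)
qed

lemma square_integrable_diff:
  assumes "square_integrable f" "square_integrable g"
  shows "square_integrable (\<lambda>x. f x - g x)"
  using square_integrable_add[OF assms(1) square_integrable_cmult[OF assms(2), of "-1"]] by simp

text \<open>Young's inequality with a small parameter does the work of the Cauchy-Schwarz
  inequality.\<close>

lemma L2_convergence_inner:
  fixes h :: "nat \<Rightarrow> real^'d::finite \<Rightarrow> real"
  assumes h: "\<And>k. square_integrable (h k)" and g: "square_integrable g"
    and lim: "(\<lambda>k. LINT x|lborel. (h k x)\<^sup>2) \<longlonglongrightarrow> 0"
  shows "(\<lambda>k. LINT x|lborel. h k x * g x) \<longlonglongrightarrow> 0"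
proof (rule LIMSEQ_I)
  fix e :: real assume e: "0 < e"
  define G where "G = (LINT x|lborel. (g x)\<^sup>2)"
  have G: "0 \<le> G" unfolding G_def by (intro integral_nonneg_AE) simp
  \<comment> \<open>Makes d / 2 * G smaller than \<open>e\<close>; the 1 in the denominator covers G
    = 0.\<close>
  define d where "d = e / (G + 1)"
  have d: "0 < d" using e G by (simp add: d_def)
  have bound: "\<bar>LINT x|lborel. h k x * g x\<bar> \<le> (1 / (2 * d)) * (LINT x|lborel. (h k x)\<^sup>2) + d / 2 * G" for k
  proof -
    have pt: "\<bar>a * b\<bar> \<le> (1 / (2 * d)) * a\<^sup>2 + d / 2 * b\<^sup>2" for a b :: real
    proof -
      have "0 \<le> (\<bar>a\<bar> - d * \<bar>b\<bar>)\<^sup>2" by simp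
      then have "2 * d * \<bar>a * b\<bar> \<le> a\<^sup>2 + d * d * b\<^sup>2"
        by (simp add: power2_eq_square algebra_simps abs_mult)
      then show ?thesis using d by (simp add: field_simps power2_eq_square)
    qed
    have ih: "integrable lborel (\<lambda>x. (h k x)\<^sup>2)" and ig: "integrable lborel (\<lambda>x. (g x)\<^sup>2)"
      using h g unfolding square_integrable_def by auto
    have "\<bar>LINT x|lborel. h k x * g x\<bar> \<le> (LINT x|lborel. \<bar>h k x * g x\<bar>)"
      by (rule integral_abs_bound)
    also have "\<dots> \<le> (LINT x|lborel. (1 / (2 * d)) * (h k x)\<^sup>2 + d / 2 * (g x)\<^sup>2)"
      using ih ig by (intro integral_mono pt integrable_abs square_integrable_mult h g
          Bochner_Integration.integrable_add integrable_mult_right)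
    also have "\<dots> = (1 / (2 * d)) * (LINT x|lborel. (h k x)\<^sup>2) + d / 2 * G"
      unfolding G_def using ih ig by simp
    finally show ?thesis .
  qed
  have "d / 2 * G < e"
  proof -
    have "d * G \<le> e" unfolding d_def using e G by (simp add: field_simps)
    then show ?thesis using e by simp
  qed
  moreover have "(\<lambda>k. (1 / (2 * d)) * (LINT x|lborel. (h k x)\<^sup>2) + d / 2 * G) \<longlonglongrightarrow> (1 / (2 * d)) * 0 + d / 2 * G"
    by (intro tendsto_add tendsto_mult tendsto_const lim)
  ultimately have "eventually (\<lambda>k. (1 / (2 * d)) * (LINT x|lborel. (h k x)\<^sup>2) + d / 2 * G < e) sequentially"
    by (intro order_tendstoD(2)) auto
  then obtain k0 where "\<And>k. k \<ge> k0 \<Longrightarrow> (1 / (2 * d)) * (LINT x|lborel. (h k x)\<^sup>2) + d / 2 * G < e"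
    unfolding eventually_sequentially by blast
  then have "norm ((LINT x|lborel. h k x * g x) - 0) < e" if "k \<ge> k0" for k
    using that bound[of k] by fastforce
  then show "\<exists>no. \<forall>k\<ge>no. norm ((LINT x|lborel. h k x * g x) - 0) < e" by blast
qed

text \<open>The coefficients \<open>c\<close> are arbitrary on purpose. Fourier coefficients give
  Parseval's identity; for the coefficients of an admissible series, testing with an eigenfunction
  recovers them.\<close>

lemma L2_sums_inner:
  fixes f g :: "real^'d::finite \<Rightarrow> real"
  assumes fin: "\<And>n. finite (Idx n)"
    and w: "\<And>n \<alpha>. \<alpha> \<in> Idx n \<Longrightarrow> square_integrable (w n \<alpha>)"
    and f: "square_integrable f" and g: "square_integrable g"
    and lim: "(\<lambda>k. LINT x|lborel. (f x - (\<Sum>n<k. \<Sum>\<alpha>\<in>Idx n. c n \<alpha> * w n \<alpha> x))\<^sup>2) \<longlonglongrightarrow> 0"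
  shows "(\<lambda>n. \<Sum>\<alpha>\<in>Idx n. c n \<alpha> * (LINT x|lborel. w n \<alpha> x * g x)) sums (LINT x|lborel. f x * g x)"
proof -
  define S where "S k x = (\<Sum>n<k. \<Sum>\<alpha>\<in>Idx n. c n \<alpha> * w n \<alpha> x)" for k x
  have sq: "square_integrable (S k)" for k
    unfolding S_def[abs_def] by (intro square_integrable_sum square_integrable_cmult w fin) auto
  have "(\<lambda>k. LINT x|lborel. (f x - S k x) * g x) \<longlonglongrightarrow> 0"
    using lim by (intro L2_convergence_inner square_integrable_diff f g sq) (simp add: S_def)
  moreover have "(LINT x|lborel. (f x - S k x) * g x)
      = (LINT x|lborel. f x * g x) - (\<Sum>n<k. \<Sum>\<alpha>\<in>Idx n. c n \<alpha> * (LINT x|lborel. w n \<alpha> x * g x))" for k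
  proof -
    have iw: "integrable lborel (\<lambda>x. c n \<alpha> * (w n \<alpha> x * g x))" if "\<alpha> \<in> Idx n" for n \<alpha>
      using that by (intro integrable_mult_right square_integrable_mult w g)
    have "(LINT x|lborel. S k x * g x) = (LINT x|lborel. (\<Sum>n<k. \<Sum>\<alpha>\<in>Idx n. c n \<alpha> * (w n \<alpha> x * g x)))"
      unfolding S_def by (simp add: sum_distrib_right mult.assoc)
    also have "\<dots> = (\<Sum>n<k. LINT x|lborel. (\<Sum>\<alpha>\<in>Idx n. c n \<alpha> * (w n \<alpha> x * g x)))"
      by (intro Bochner_Integration.integral_sum Bochner_Integration.integrable_sum iw)
    also have "\<dots> = (\<Sum>n<k. \<Sum>\<alpha>\<in>Idx n. c n \<alpha> * (LINT x|lborel. w n \<alpha> x * g x))"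
      by (simp add: Bochner_Integration.integral_sum[OF iw])
    finally show ?thesis
      by (simp add: left_diff_distrib square_integrable_mult f g sq)
  qed
  ultimately have "(\<lambda>k. (LINT x|lborel. f x * g x)
      - (\<Sum>n<k. \<Sum>\<alpha>\<in>Idx n. c n \<alpha> * (LINT x|lborel. w n \<alpha> x * g x))) \<longlonglongrightarrow> 0" by simp
  from tendsto_diff[OF tendsto_const[of "LINT x|lborel. f x * g x"] this]
  show ?thesis unfolding sums_def by simp
qed

section \<open>Matrices over a finite index set\<close>

text \<open>Gaussian elimination as an induction on the rows: a row with pivot \<open>p\<close> is
  removed together with column \<open>p\<close>, which keeps more columns than rows.\<close>

lemma underdetermined_kernel:
  fixes A :: "'a \<Rightarrow> 'b \<Rightarrow> real"
  assumes "finite I" "finite J" "card I < card J"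
  shows "\<exists>v. (\<exists>j\<in>J. v j \<noteq> 0) \<and> (\<forall>i\<in>I. (\<Sum>j\<in>J. A i j * v j) = 0)"
  using assms
proof (induction I arbitrary: J A rule: finite_induct)
  case empty
  then obtain j where "j \<in> J" by (metis card_gt_0_iff card.empty ex_in_conv)
  then show ?case by (intro exI[of _ "\<lambda>_. 1"]) auto
next
  case (insert i I)
  show ?case
  proof (cases "\<forall>j\<in>J. A i j = 0")
    case True
    have "card I < card J" using insert by simp
    from insert.IH[OF insert.prems(1) this, of A] obtain v where
      v: "\<exists>j\<in>J. v j \<noteq> 0" "\<forall>k\<in>I. (\<Sum>j\<in>J. A k j * v j) = 0" by auto
    then show ?thesis using True by (intro exI[of _ v]) simp
  next
    case False
    then obtain p where p: "p \<in> J" "A i p \<noteq> 0" by blast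
    \<comment> \<open>The row operation that clears column \<open>p\<close> with the help of row
      \<open>i\<close>.\<close>
    define B where "B k j = A k j - A k p * A i j / A i p" for k j
    have "card I < card (J - {p})" using insert p by simp
    from insert.IH[OF finite_Diff[OF insert.prems(1)] this, of B] obtain v where
      v1: "\<exists>j\<in>J - {p}. v j \<noteq> 0" and v2: "\<forall>k\<in>I. (\<Sum>j\<in>J - {p}. B k j * v j) = 0" by auto
    define s where "s = (\<Sum>j\<in>J - {p}. A i j * v j)"
    \<comment> \<open>The pivot entry is solved from row \<open>i\<close>; substituted into another
      row, it turns the entries of \<open>A\<close> into those of \<open>B\<close>.\<close>
    define u where "u = v(p := - s / A i p)"
    have u: "(\<Sum>j\<in>J. A k j * u j) = (\<Sum>j\<in>J - {p}. A k j * v j) - A k p * s / A i p" for k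
      unfolding u_def sum.remove[OF insert.prems(1) p(1)]
      by (auto intro!: sum.cong)
    have "(\<Sum>j\<in>J. A i j * u j) = 0" using p unfolding u by (simp add: s_def)
    moreover have "(\<Sum>j\<in>J. A k j * u j) = 0" if "k \<in> I" for k
    proof -
      have Bv: "B k j * v j = A k j * v j - A k p / A i p * (A i j * v j)" for j
        by (simp add: B_def left_diff_distrib mult.assoc)
      have "0 = (\<Sum>j\<in>J - {p}. B k j * v j)" using v2 that by simp
      also have "\<dots> = (\<Sum>j\<in>J - {p}. A k j * v j - A k p / A i p * (A i j * v j))" by (simp only: Bv)
      also have "\<dots> = (\<Sum>j\<in>J - {p}. A k j * v j) - A k p / A i p * s"
        by (simp add: sum_subtractf s_def sum_distrib_left)
      finally show ?thesis unfolding u by simp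
    qed
    moreover have "\<exists>j\<in>J. u j \<noteq> 0" using v1 by (auto simp: u_def)
    ultimately show ?thesis by (intro exI[of _ u]) auto
  qed
qed

text \<open>Append \<open>y\<close> as an extra column, indexed by \<open>None\<close>. There are
  now more columns than rows, and a kernel vector has a nonzero \<open>None\<close> entry by
  injectivity; dividing by its negative solves the system.\<close>

lemma injective_matrix_surjective:
  fixes A :: "'a \<Rightarrow> 'a \<Rightarrow> real"
  assumes fin: "finite I"
    and inj: "\<And>v. (\<forall>i\<in>I. (\<Sum>j\<in>I. A i j * v j) = 0) \<Longrightarrow> \<forall>j\<in>I. v j = 0"
  shows "\<exists>v. \<forall>i\<in>I. (\<Sum>j\<in>I. A i j * v j) = y i"
proof -
  define A' where "A' i o' = (case o' of None \<Rightarrow> y i | Some j \<Rightarrow> A i j)" for i o'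
  have card: "card I < card (insert None (Some ` I))"
    using fin by (simp add: card_image)
  have finS: "finite (insert None (Some ` I))" using fin by simp
  obtain v where v1: "\<exists>j\<in>insert None (Some ` I). v j \<noteq> 0"
    and v2: "\<forall>i\<in>I. (\<Sum>j\<in>insert None (Some ` I). A' i j * v j) = 0"
    using underdetermined_kernel[OF fin finS card, of A'] by (elim exE conjE) (rule that)
  have eq: "(\<Sum>j\<in>insert None (Some ` I). A' i j * v j) = y i * v None + (\<Sum>j\<in>I. A i j * v (Some j))" for i
  proof -
    have "(\<Sum>j\<in>insert None (Some ` I). A' i j * v j) = A' i None * v None + (\<Sum>j\<in>Some ` I. A' i j * v j)"
      by (rule sum.insert) (use fin in auto)
    also have "(\<Sum>j\<in>Some ` I. A' i j * v j) = (\<Sum>j\<in>I. A' i (Some j) * v (Some j))"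
      by (subst sum.reindex) (simp_all add: o_def)
    finally show ?thesis unfolding A'_def by simp
  qed
  have nz: "v None \<noteq> 0"
  proof
    assume 0: "v None = 0"
    have "\<forall>j\<in>I. v (Some j) = 0"
      by (rule inj[of "\<lambda>j. v (Some j)"]) (use v2 0 in \<open>simp add: eq\<close>)
    then show False using v1 0 by auto
  qed
  have "(\<Sum>j\<in>I. A i j * (- v (Some j) / v None)) = y i" if "i \<in> I" for i
  proof -
    have "(\<Sum>j\<in>I. A i j * (- v (Some j) / v None)) = - (\<Sum>j\<in>I. A i j * v (Some j)) / v None"
      by (simp add: sum_negf sum_divide_distrib)
    also have "\<dots> = y i" using v2 that nz unfolding eq by (simp add: field_simps add_eq_0_iff)
    finally show ?thesis .
  qed
  then show ?thesis by (intro exI[of _ "\<lambda>j. - v (Some j) / v None"] ballI)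
qed

text \<open>The predicate described by \<open>matrix_inv_on\<close>. Prescribing 0 outside
  \<open>I\<close> makes the inverse unique as a total function, as the definite description
  requires.\<close>

definition "is_inverse_on I A B \<longleftrightarrow>
     (\<forall>\<alpha> \<gamma>. \<alpha> \<notin> I \<or> \<gamma> \<notin> I \<longrightarrow> B \<alpha> \<gamma> = 0) \<and>
     (\<forall>\<alpha>\<in>I. \<forall>\<gamma>\<in>I.
        (\<Sum>\<delta>\<in>I. A \<alpha> \<delta> * B \<delta> \<gamma>) = (if \<alpha> = \<gamma> then 1 else (0::real)) \<and>
        (\<Sum>\<delta>\<in>I. B \<alpha> \<delta> * A \<delta> \<gamma>) = (if \<alpha> = \<gamma> then 1 else 0))"

lemma sum_mult_assoc:
  fixes A B :: "'a \<Rightarrow> 'a \<Rightarrow> real"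
  shows "(\<Sum>\<delta>\<in>I. A \<alpha> \<delta> * (\<Sum>\<epsilon>\<in>I. B \<delta> \<epsilon> * v \<epsilon>)) = (\<Sum>\<epsilon>\<in>I. (\<Sum>\<delta>\<in>I. A \<alpha> \<delta> * B \<delta> \<epsilon>) * v \<epsilon>)"
  by (simp add: sum_distrib_left sum_distrib_right mult.assoc) (rule sum.swap)

lemma is_inverse_on_exists:
  assumes fin: "finite I"
    and inj: "\<And>v. (\<forall>i\<in>I. (\<Sum>j\<in>I. A i j * v j) = 0) \<Longrightarrow> \<forall>j\<in>I. v j = 0"
  shows "\<exists>B. is_inverse_on I A B"
proof -
  have "\<forall>\<gamma>. \<exists>v. \<forall>i\<in>I. (\<Sum>j\<in>I. A i j * v j) = (if i = \<gamma> then 1 else 0)"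
  proof
    fix \<gamma>
    have "\<forall>j\<in>I. v j = 0" if "\<forall>i\<in>I. (\<Sum>j\<in>I. A i j * v j) = 0" for v
      using inj[of v] that by simp
    from injective_matrix_surjective[OF fin this, where y = "\<lambda>i. if i = \<gamma> then 1 else 0"]
    show "\<exists>v. \<forall>i\<in>I. (\<Sum>j\<in>I. A i j * v j) = (if i = \<gamma> then 1 else 0)" by simp
  qed
  from choice[OF this] obtain C where
    C': "\<forall>\<gamma>. \<forall>i\<in>I. (\<Sum>j\<in>I. A i j * C \<gamma> j) = (if i = \<gamma> then 1 else 0)" ..
  then have C: "(\<Sum>j\<in>I. A i j * C \<gamma> j) = (if i = \<gamma> then 1 else 0)" if "i \<in> I" for \<gamma> i
    using that by simp
  define B where "B \<alpha> \<gamma> = (if \<alpha> \<in> I \<and> \<gamma> \<in> I then C \<gamma> \<alpha> else 0)" for \<alpha> \<gamma>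
  have AB: "(\<Sum>\<delta>\<in>I. A \<alpha> \<delta> * B \<delta> \<gamma>) = (if \<alpha> = \<gamma> then 1 else 0)" if "\<alpha> \<in> I" "\<gamma> \<in> I" for \<alpha> \<gamma>
    using C[OF that(1), of \<gamma>] that by (simp add: B_def cong: sum.cong)
  have "(\<Sum>\<delta>\<in>I. B \<alpha> \<delta> * A \<delta> \<gamma>) = (if \<alpha> = \<gamma> then 1 else 0)" if "\<alpha> \<in> I" "\<gamma> \<in> I" for \<alpha> \<gamma>
  proof -
    \<comment> \<open>A right inverse is also a left inverse: \<open>A\<close> maps each column of B
      A - 1 to A - A = 0, and injectivity finishes.\<close>
    define v where "v \<alpha> = (\<Sum>\<delta>\<in>I. B \<alpha> \<delta> * A \<delta> \<gamma>) - (if \<alpha> = \<gamma> then 1 else 0)" for \<alpha>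
    have "(\<Sum>j\<in>I. A i j * v j) = 0" if i: "i \<in> I" for i
    proof -
      have "(\<Sum>j\<in>I. A i j * v j) = (\<Sum>j\<in>I. A i j * (\<Sum>\<delta>\<in>I. B j \<delta> * A \<delta> \<gamma>)) - (\<Sum>j\<in>I. A i j * (if j = \<gamma> then 1 else 0))"
        unfolding v_def by (simp add: right_diff_distrib sum_subtractf)
      also have "(\<Sum>j\<in>I. A i j * (\<Sum>\<delta>\<in>I. B j \<delta> * A \<delta> \<gamma>)) = (\<Sum>\<delta>\<in>I. (if i = \<delta> then 1 else 0) * A \<delta> \<gamma>)"
        unfolding sum_mult_assoc[where A = A and B = B and v = "\<lambda>\<delta>. A \<delta> \<gamma>"]
        by (intro sum.cong refl) (simp add: AB i)
      also have "\<dots> = A i \<gamma>" using fin i by (simp add: if_distrib[of "\<lambda>c. c * _"] sum.delta' cong: if_cong)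
      also have "(\<Sum>j\<in>I. A i j * (if j = \<gamma> then 1 else 0)) = A i \<gamma>"
        using fin \<open>\<gamma> \<in> I\<close> by (simp add: if_distrib sum.delta cong: if_cong)
      finally show ?thesis by simp
    qed
    then have "\<forall>j\<in>I. v j = 0" by (intro inj[of v]) blast
    then have "v \<alpha> = 0" using that(1) by blast
    then show ?thesis unfolding v_def by simp
  qed
  then have "is_inverse_on I A B" unfolding is_inverse_on_def using AB by (auto simp: B_def)
  then show ?thesis by (rule exI[of "is_inverse_on I A" B])
qed

lemma is_inverse_on_unique:
  assumes fin: "finite I" and B: "is_inverse_on I A B" and C: "is_inverse_on I A C"
  shows "B = C"
proof (intro ext)
  fix \<alpha> \<gamma>
  show "B \<alpha> \<gamma> = C \<alpha> \<gamma>"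
  proof (cases "\<alpha> \<in> I \<and> \<gamma> \<in> I")
    case True
    have "B \<alpha> \<gamma> = (\<Sum>\<delta>\<in>I. B \<alpha> \<delta> * (if \<delta> = \<gamma> then 1 else 0))"
      using True fin by (simp add: if_distrib sum.delta cong: if_cong)
    also have "\<dots> = (\<Sum>\<delta>\<in>I. B \<alpha> \<delta> * (\<Sum>\<epsilon>\<in>I. A \<delta> \<epsilon> * C \<epsilon> \<gamma>))"
      using C True unfolding is_inverse_on_def by (intro sum.cong) auto
    also have "\<dots> = (\<Sum>\<epsilon>\<in>I. (if \<alpha> = \<epsilon> then 1 else 0) * C \<epsilon> \<gamma>)"
      unfolding sum_mult_assoc[where A = B and B = A and v = "\<lambda>\<epsilon>. C \<epsilon> \<gamma>"] using B True unfolding is_inverse_on_def by (intro sum.cong) auto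
    also have "\<dots> = C \<alpha> \<gamma>"
      using True fin by (simp add: if_distrib[of "\<lambda>c. c * _"] sum.delta' cong: if_cong)
    finally show ?thesis .
  next
    case False
    then show ?thesis using B C unfolding is_inverse_on_def by auto
  qed
qed

lemma matrix_inv_on_is_inverse:
  assumes "finite I" "\<And>v. (\<forall>i\<in>I. (\<Sum>j\<in>I. A i j * v j) = 0) \<Longrightarrow> \<forall>j\<in>I. v j = 0"
  shows "is_inverse_on I A (matrix_inv_on I A)"
proof -
  have "\<exists>!B. is_inverse_on I A B"
    using is_inverse_on_exists[OF assms] is_inverse_on_unique[OF assms(1)] by blast
  moreover have "matrix_inv_on I A = (THE B. is_inverse_on I A B)"
    unfolding matrix_inv_on_def is_inverse_on_def ..
  ultimately show ?thesis using theI'[of "is_inverse_on I A"] by simp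
qed

section \<open>Linear matrix differential equations\<close>

context time_interval
begin

lemma bdd_on_time:
  assumes "continuous_on {ti..tf} (f :: real \<Rightarrow> real)"
  obtains C where "0 \<le> C" "\<And>t. t \<in> {ti..tf} \<Longrightarrow> \<bar>f t\<bar> \<le> C"
proof -
  have "bounded (f ` {ti..tf})" using assms by (intro compact_imp_bounded compact_continuous_image) auto
  then obtain C where C: "\<forall>t\<in>{ti..tf}. \<bar>f t\<bar> \<le> C" by (auto simp: bounded_real)
  moreover have "0 \<le> C" using order_trans[OF abs_ge_zero] C ti_less_tf by (meson atLeastAtMost_iff less_imp_le order_refl)
  ultimately show ?thesis using that by blast
qed

lemma nondecreasing_on:
  assumes "\<And>t. t \<in> {ti..tf} \<Longrightarrow> (z has_real_derivative z' t) (at t within {ti..tf})"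
    and "\<And>t. t \<in> {ti..tf} \<Longrightarrow> 0 \<le> z' t" and t: "t \<in> {ti..tf}"
  shows "z ti \<le> z t"
proof (cases "t = ti")
  case False
  then have tt: "ti < t" using t by simp
  have "\<exists>s\<in>{ti<..<t}. z t - z ti = z' s * (t - ti)"
  proof (rule mvt_simple[OF tt])
    fix s assume "ti \<le> s" "s \<le> t"
    then show "(z has_derivative (*) (z' s)) (at s within {ti..t})"
      using t unfolding has_field_derivative_def[symmetric] by (intro DERIV_subset[OF assms(1)]) auto
  qed
  then obtain s where "s \<in> {ti<..<t}" "z t - z ti = z' s * (t - ti)" ..
  moreover from this have "0 \<le> z' s * (t - ti)" using assms(2)[of s] t tt by (intro mult_nonneg_nonneg) auto
  ultimately show ?thesis by linarith
qed simp

end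

locale matrix_flow = time_interval ti tf for ti tf +
  fixes I :: "'i set" and M G :: "real \<Rightarrow> 'i \<Rightarrow> 'i \<Rightarrow> real"
  assumes fin: "finite I"
    and G_cont: "\<And>\<alpha> \<gamma>. \<alpha> \<in> I \<Longrightarrow> \<gamma> \<in> I \<Longrightarrow> continuous_on {ti..tf} (\<lambda>t. G t \<alpha> \<gamma>)"
    and M_deriv: "\<And>\<alpha> \<eta> t. \<alpha> \<in> I \<Longrightarrow> \<eta> \<in> I \<Longrightarrow> t \<in> {ti..tf} \<Longrightarrow>
       ((\<lambda>s. M s \<alpha> \<eta>) has_real_derivative - (\<Sum>\<gamma>\<in>I. G t \<alpha> \<gamma> * M t \<gamma> \<eta>)) (at t within {ti..tf})"
    and M_init: "\<And>\<alpha> \<eta>. \<alpha> \<in> I \<Longrightarrow> \<eta> \<in> I \<Longrightarrow> M ti \<alpha> \<eta> = (if \<alpha> = \<eta> then 1 else 0)"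
begin

text \<open>Gronwall's inequality, backwards in time: the flow cannot contract faster than exponentially.\<close>

lemma lower_bound:
  "\<exists>c>0. \<forall>t\<in>{ti..tf}. \<forall>v. c * (\<Sum>j\<in>I. (v j)\<^sup>2) \<le> (\<Sum>i\<in>I. (\<Sum>j\<in>I. M t i j * v j)\<^sup>2)"
proof -
  have ex: "\<exists>b. b \<ge> 0 \<and> (\<forall>t\<in>{ti..tf}. \<bar>G t i k\<bar> \<le> b)" if ik: "i \<in> I" "k \<in> I" for i k
  proof -
    obtain C where "0 \<le> C" "\<And>t. t \<in> {ti..tf} \<Longrightarrow> \<bar>G t i k\<bar> \<le> C"
      by (rule bdd_on_time[OF G_cont[OF ik]]) (rule that)
    then show ?thesis by (intro exI[of _ C]) simp
  qed
  define b where "b i k = (SOME c. c \<ge> 0 \<and> (\<forall>t\<in>{ti..tf}. \<bar>G t i k\<bar> \<le> c))" for i k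
  have b': "b i k \<ge> 0 \<and> (\<forall>t\<in>{ti..tf}. \<bar>G t i k\<bar> \<le> b i k)" if "i \<in> I" "k \<in> I" for i k
    unfolding b_def by (rule someI_ex[OF ex[OF that]])
  have b: "\<bar>G t i k\<bar> \<le> b i k" if "i \<in> I" "k \<in> I" "t \<in> {ti..tf}" for i k t
    using b'[OF that(1,2)] that(3) by blast
  have b0: "0 \<le> b i k" if "i \<in> I" "k \<in> I" for i k using b'[OF that] by blast
  \<comment> \<open>The 2 comes from differentiating squares, and every product |w i w k| is at most
    \<open>y\<close>; so K y bounds the rate at which \<open>y\<close> can decrease.\<close>
  define K where "K = 2 * (\<Sum>i\<in>I. \<Sum>k\<in>I. b i k)"
  have K: "0 \<le> K" unfolding K_def using b0 by (auto intro!: sum_nonneg)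
  have "exp (- K * (tf - ti)) * (\<Sum>j\<in>I. (v j)\<^sup>2) \<le> (\<Sum>i\<in>I. (\<Sum>j\<in>I. M t i j * v j)\<^sup>2)"
    if t: "t \<in> {ti..tf}" for t v
  proof -
    define w where "w i s = (\<Sum>j\<in>I. M s i j * v j)" for i s
    define y where "y s = (\<Sum>i\<in>I. w i s * w i s)" for s
    define w' where "w' i s = - (\<Sum>k\<in>I. G s i k * w k s)" for i s
    have dw: "(w i has_real_derivative w' i s) (at s within {ti..tf})" if "i \<in> I" "s \<in> {ti..tf}" for i s
    proof -
      have "((\<lambda>s. \<Sum>j\<in>I. M s i j * v j) has_real_derivative
          (\<Sum>j\<in>I. (- (\<Sum>\<gamma>\<in>I. G s i \<gamma> * M s \<gamma> j)) * v j)) (at s within {ti..tf})"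
        using that by (intro DERIV_sum DERIV_cmult_right M_deriv)
      moreover have "(\<Sum>j\<in>I. (- (\<Sum>\<gamma>\<in>I. G s i \<gamma> * M s \<gamma> j)) * v j) = w' i s"
        unfolding w'_def w_def sum_mult_assoc[where A = "G s" and B = "M s" and v = v] by (simp add: sum_negf)
      ultimately show ?thesis unfolding w_def[abs_def] by simp
    qed
    define y' where "y' s = (\<Sum>i\<in>I. w' i s * w i s + w' i s * w i s)" for s
    have dy: "(y has_real_derivative y' s) (at s within {ti..tf})" if "s \<in> {ti..tf}" for s
      unfolding y_def[abs_def] y'_def by (intro DERIV_sum DERIV_mult dw that)
    have y'_ge: "0 \<le> y' s + K * y s" if s: "s \<in> {ti..tf}" for s
    proof -
      have ww: "\<bar>w i s * w k s\<bar> \<le> y s" if "i \<in> I" "k \<in> I" for i k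
      proof -
        have "w i s * w i s \<le> y s" "w k s * w k s \<le> y s"
          unfolding y_def using that fin by (auto intro: member_le_sum)
        moreover have "2 * \<bar>w i s * w k s\<bar> \<le> w i s * w i s + w k s * w k s"
          using sum_squares_bound[of "\<bar>w i s\<bar>" "\<bar>w k s\<bar>"] by (simp add: abs_mult power2_eq_square)
        ultimately show ?thesis by simp
      qed
      have "- y' s = (\<Sum>i\<in>I. \<Sum>k\<in>I. 2 * (G s i k * (w i s * w k s)))"
        unfolding y'_def w'_def
        by (simp add: sum_negf[symmetric] sum_distrib_left sum_distrib_right algebra_simps sum.distrib[symmetric])
      also have "\<dots> \<le> (\<Sum>i\<in>I. \<Sum>k\<in>I. 2 * (b i k * y s))"
      proof (intro sum_mono mult_left_mono)
        fix i k assume ik: "i \<in> I" "k \<in> I"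
        have "G s i k * (w i s * w k s) \<le> \<bar>G s i k\<bar> * \<bar>w i s * w k s\<bar>"
          unfolding abs_mult[symmetric] by simp
        also have "\<dots> \<le> b i k * y s"
          by (rule mult_mono[OF b[OF ik s] ww[OF ik] b0[OF ik]]) simp
        finally show "G s i k * (w i s * w k s) \<le> b i k * y s" .
      qed simp
      also have "\<dots> = K * y s" unfolding K_def by (simp add: sum_distrib_left sum_distrib_right mult.assoc)
      finally show ?thesis by simp
    qed
    have "exp (K * (ti - ti)) * y ti \<le> exp (K * (t - ti)) * y t"
    proof (rule nondecreasing_on[where z' = "\<lambda>s. exp (K * (s - ti)) * (y' s + K * y s)", OF _ _ t])
      fix s assume s: "s \<in> {ti..tf}"
      have "((\<lambda>s. exp (K * (s - ti))) has_real_derivative exp (K * (s - ti)) * K) (at s within {ti..tf})"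
        by (auto intro!: derivative_eq_intros)
      from DERIV_mult[OF this dy[OF s]]
      show "((\<lambda>s. exp (K * (s - ti)) * y s) has_real_derivative exp (K * (s - ti)) * (y' s + K * y s))
          (at s within {ti..tf})" by (simp add: algebra_simps)
      show "0 \<le> exp (K * (s - ti)) * (y' s + K * y s)" using y'_ge[OF s] by simp
    qed
    then have "exp (- (K * (t - ti))) * y ti \<le> exp (- (K * (t - ti))) * (exp (K * (t - ti)) * y t)"
      by (intro mult_left_mono) auto
    then have le: "exp (- (K * (t - ti))) * y ti \<le> y t" by (simp add: mult.assoc[symmetric] exp_add[symmetric])
    have y0: "0 \<le> y ti" unfolding y_def by (intro sum_nonneg) simp
    have "exp (- K * (tf - ti)) * y ti \<le> exp (- (K * (t - ti))) * y ti"
      using y0 t K by (intro mult_right_mono) (auto intro: mult_left_mono)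
    moreover have "w i ti = v i" if "i \<in> I" for i
    proof -
      have "w i ti = (\<Sum>j\<in>I. if i = j then v j else 0)"
        unfolding w_def by (intro sum.cong refl) (simp add: M_init that)
      then show ?thesis using that fin by simp
    qed
    then have "y ti = (\<Sum>j\<in>I. (v j)\<^sup>2)" unfolding y_def by (simp add: power2_eq_square)
    ultimately show ?thesis using le unfolding y_def w_def by (simp add: power2_eq_square)
  qed
  then show ?thesis by (intro exI[of _ "exp (- K * (tf - ti))"]) auto
qed

definition "B t = matrix_inv_on I (M t)"

lemma B_inverse: assumes t: "t \<in> {ti..tf}" shows "is_inverse_on I (M t) (B t)"
  unfolding B_def
proof (rule matrix_inv_on_is_inverse[OF fin])
  fix v assume v: "\<forall>i\<in>I. (\<Sum>j\<in>I. M t i j * v j) = 0"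
  obtain c where "0 < c" and c: "c * (\<Sum>j\<in>I. (v j)\<^sup>2) \<le> (\<Sum>i\<in>I. (\<Sum>j\<in>I. M t i j * v j)\<^sup>2)"
    using lower_bound t by blast
  have "(\<Sum>j\<in>I. (v j)\<^sup>2) \<le> 0" using c v \<open>0 < c\<close> by (simp add: mult_le_0_iff)
  moreover have "0 \<le> (\<Sum>j\<in>I. (v j)\<^sup>2)" by (intro sum_nonneg) simp
  ultimately have "(\<Sum>j\<in>I. (v j)\<^sup>2) = 0" by simp
  then show "\<forall>j\<in>I. v j = 0" using fin by (simp add: sum_nonneg_eq_0_iff)
qed

lemma MB: "t \<in> {ti..tf} \<Longrightarrow> \<alpha> \<in> I \<Longrightarrow> \<gamma> \<in> I \<Longrightarrow> (\<Sum>\<delta>\<in>I. M t \<alpha> \<delta> * B t \<delta> \<gamma>) = (if \<alpha> = \<gamma> then 1 else 0)"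
  using B_inverse unfolding is_inverse_on_def by blast

lemma BM: "t \<in> {ti..tf} \<Longrightarrow> \<alpha> \<in> I \<Longrightarrow> \<gamma> \<in> I \<Longrightarrow> (\<Sum>\<delta>\<in>I. B t \<alpha> \<delta> * M t \<delta> \<gamma>) = (if \<alpha> = \<gamma> then 1 else 0)"
  using B_inverse unfolding is_inverse_on_def by blast

lemma B_left:
  assumes "t \<in> {ti..tf}" "\<alpha> \<in> I"
  shows "(\<Sum>\<delta>\<in>I. B t \<alpha> \<delta> * (\<Sum>\<epsilon>\<in>I. M t \<delta> \<epsilon> * v \<epsilon>)) = v \<alpha>"
proof -
  have "(\<Sum>\<delta>\<in>I. B t \<alpha> \<delta> * (\<Sum>\<epsilon>\<in>I. M t \<delta> \<epsilon> * v \<epsilon>)) = (\<Sum>\<epsilon>\<in>I. if \<alpha> = \<epsilon> then v \<epsilon> else 0)"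
    unfolding sum_mult_assoc[where A = "B t" and B = "M t" and v = v]
    by (intro sum.cong refl) (simp add: BM[OF assms(1)] assms(2))
  then show ?thesis using fin assms by simp
qed

lemma M_left:
  assumes "t \<in> {ti..tf}" "\<alpha> \<in> I"
  shows "(\<Sum>\<delta>\<in>I. M t \<alpha> \<delta> * (\<Sum>\<epsilon>\<in>I. B t \<delta> \<epsilon> * v \<epsilon>)) = v \<alpha>"
proof -
  have "(\<Sum>\<delta>\<in>I. M t \<alpha> \<delta> * (\<Sum>\<epsilon>\<in>I. B t \<delta> \<epsilon> * v \<epsilon>)) = (\<Sum>\<epsilon>\<in>I. if \<alpha> = \<epsilon> then v \<epsilon> else 0)"
    unfolding sum_mult_assoc[where A = "M t" and B = "B t" and v = v]
    by (intro sum.cong refl) (simp add: MB[OF assms(1)] assms(2))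
  then show ?thesis using fin assms by simp
qed

lemma B_init: assumes "\<alpha> \<in> I" "\<gamma> \<in> I" shows "B ti \<alpha> \<gamma> = (if \<alpha> = \<gamma> then 1 else 0)"
proof -
  have "(\<Sum>\<delta>\<in>I. M ti \<alpha> \<delta> * B ti \<delta> \<gamma>) = (\<Sum>\<delta>\<in>I. if \<alpha> = \<delta> then B ti \<delta> \<gamma> else 0)"
    by (intro sum.cong refl) (simp add: M_init assms)
  then show ?thesis using MB[of ti \<alpha> \<gamma>] assms ti_less_tf fin by simp
qed

text \<open>Apply \<open>lower_bound\<close> to a column of the inverse, which \<open>M t\<close>
  maps to a unit vector.\<close>

lemma B_bounded: "\<exists>C\<ge>0. \<forall>t\<in>{ti..tf}. \<forall>\<alpha>\<in>I. \<forall>\<gamma>\<in>I. \<bar>B t \<alpha> \<gamma>\<bar> \<le> C"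
proof -
  obtain c where c0: "0 < c"
    and c: "\<forall>t\<in>{ti..tf}. \<forall>v. c * (\<Sum>j\<in>I. (v j)\<^sup>2) \<le> (\<Sum>i\<in>I. (\<Sum>j\<in>I. M t i j * v j)\<^sup>2)"
    using lower_bound by blast
  have "\<bar>B t \<alpha> \<gamma>\<bar> \<le> sqrt (1 / c)" if t: "t \<in> {ti..tf}" and ag: "\<alpha> \<in> I" "\<gamma> \<in> I" for t \<alpha> \<gamma>
  proof -
    have "c * (\<Sum>j\<in>I. (B t j \<gamma>)\<^sup>2) \<le> (\<Sum>i\<in>I. (\<Sum>j\<in>I. M t i j * B t j \<gamma>)\<^sup>2)"
      using bspec[OF c t] by (rule spec[where x = "\<lambda>j. B t j \<gamma>"])
    also have "\<dots> = (\<Sum>i\<in>I. if i = \<gamma> then 1 else 0)"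
      by (intro sum.cong refl) (simp add: MB[OF t] ag)
    also have "\<dots> = 1" using fin ag by simp
    finally have "(\<Sum>j\<in>I. (B t j \<gamma>)\<^sup>2) \<le> 1 / c" using c0 by (simp add: field_simps)
    moreover have "(B t \<alpha> \<gamma>)\<^sup>2 \<le> (\<Sum>j\<in>I. (B t j \<gamma>)\<^sup>2)"
      using fin ag by (intro member_le_sum[where f = "\<lambda>j. (B t j \<gamma>)\<^sup>2"]) auto
    ultimately have "\<bar>B t \<alpha> \<gamma>\<bar>\<^sup>2 \<le> 1 / c" by simp
    then show ?thesis by (rule real_le_rsqrt)
  qed
  moreover have "0 \<le> sqrt (1 / c)" using c0 by simp
  ultimately show ?thesis by blast
qed

text \<open>The resolvent identity. It transfers continuity, and after division by
  \<open>s - t\<close> differentiability, from \<open>M\<close> to its inverse.\<close>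

lemma B_difference:
  assumes s: "s \<in> {ti..tf}" and t: "t \<in> {ti..tf}" and ag: "\<alpha> \<in> I" "\<gamma> \<in> I"
  shows "B s \<alpha> \<gamma> - B t \<alpha> \<gamma> = - (\<Sum>\<delta>\<in>I. \<Sum>\<epsilon>\<in>I. B s \<alpha> \<delta> * (M s \<delta> \<epsilon> - M t \<delta> \<epsilon>) * B t \<epsilon> \<gamma>)"
proof -
  have "(\<Sum>\<delta>\<in>I. \<Sum>\<epsilon>\<in>I. B s \<alpha> \<delta> * (M s \<delta> \<epsilon> - M t \<delta> \<epsilon>) * B t \<epsilon> \<gamma>)
      = (\<Sum>\<delta>\<in>I. B s \<alpha> \<delta> * (\<Sum>\<epsilon>\<in>I. M s \<delta> \<epsilon> * B t \<epsilon> \<gamma>)) - (\<Sum>\<delta>\<in>I. B s \<alpha> \<delta> * (\<Sum>\<epsilon>\<in>I. M t \<delta> \<epsilon> * B t \<epsilon> \<gamma>))"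
    by (simp add: sum_subtractf[symmetric] sum_distrib_left algebra_simps)
  also have "\<dots> = B t \<alpha> \<gamma> - (\<Sum>\<delta>\<in>I. if \<delta> = \<gamma> then B s \<alpha> \<delta> else 0)"
  proof -
    have "(\<Sum>\<delta>\<in>I. B s \<alpha> \<delta> * (\<Sum>\<epsilon>\<in>I. M t \<delta> \<epsilon> * B t \<epsilon> \<gamma>)) = (\<Sum>\<delta>\<in>I. if \<delta> = \<gamma> then B s \<alpha> \<delta> else 0)"
      by (intro sum.cong refl) (simp add: MB[OF t] ag)
    then show ?thesis using B_left[OF s ag(1), of "\<lambda>\<epsilon>. B t \<epsilon> \<gamma>"] by simp
  qed
  finally show ?thesis using fin ag by simp
qed

lemma M_continuous: "\<alpha> \<in> I \<Longrightarrow> \<gamma> \<in> I \<Longrightarrow> continuous_on {ti..tf} (\<lambda>t. M t \<alpha> \<gamma>)"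
  using M_deriv by (meson DERIV_continuous_on)

lemma B_continuous:
  assumes ag: "\<alpha> \<in> I" "\<gamma> \<in> I" shows "continuous_on {ti..tf} (\<lambda>t. B t \<alpha> \<gamma>)"
  unfolding continuous_on_def
proof
  fix t assume t: "t \<in> {ti..tf}"
  obtain C where C0: "0 \<le> C" and C: "\<forall>t\<in>{ti..tf}. \<forall>\<alpha>\<in>I. \<forall>\<gamma>\<in>I. \<bar>B t \<alpha> \<gamma>\<bar> \<le> C" using B_bounded by blast
  have Mt: "((\<lambda>s. M s \<delta> \<epsilon>) \<longlongrightarrow> M t \<delta> \<epsilon>) (at t within {ti..tf})" if "\<delta> \<in> I" "\<epsilon> \<in> I" for \<delta> \<epsilon>
    using M_continuous[OF that] t unfolding continuous_on_def by blast
  have "((\<lambda>s. \<Sum>\<delta>\<in>I. \<Sum>\<epsilon>\<in>I. C * \<bar>M s \<delta> \<epsilon> - M t \<delta> \<epsilon>\<bar> * C) \<longlongrightarrow> (\<Sum>\<delta>\<in>I. \<Sum>\<epsilon>\<in>I. C * \<bar>M t \<delta> \<epsilon> - M t \<delta> \<epsilon>\<bar> * C)) (at t within {ti..tf})"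
    by (intro tendsto_sum tendsto_mult tendsto_const tendsto_rabs tendsto_diff Mt)
  then have lim: "((\<lambda>s. \<Sum>\<delta>\<in>I. \<Sum>\<epsilon>\<in>I. C * \<bar>M s \<delta> \<epsilon> - M t \<delta> \<epsilon>\<bar> * C) \<longlongrightarrow> 0) (at t within {ti..tf})" by simp
  have "\<bar>B s \<alpha> \<gamma> - B t \<alpha> \<gamma>\<bar> \<le> (\<Sum>\<delta>\<in>I. \<Sum>\<epsilon>\<in>I. C * \<bar>M s \<delta> \<epsilon> - M t \<delta> \<epsilon>\<bar> * C)" if s: "s \<in> {ti..tf}" for s
  proof -
    have "\<bar>B s \<alpha> \<gamma> - B t \<alpha> \<gamma>\<bar> \<le> (\<Sum>\<delta>\<in>I. \<Sum>\<epsilon>\<in>I. \<bar>B s \<alpha> \<delta> * (M s \<delta> \<epsilon> - M t \<delta> \<epsilon>) * B t \<epsilon> \<gamma>\<bar>)"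
      unfolding B_difference[OF s t ag] abs_minus_cancel
      by (intro order_trans[OF sum_abs] sum_mono sum_abs)
    also have "\<dots> \<le> (\<Sum>\<delta>\<in>I. \<Sum>\<epsilon>\<in>I. C * \<bar>M s \<delta> \<epsilon> - M t \<delta> \<epsilon>\<bar> * C)"
      unfolding abs_mult using C s t ag C0 by (intro sum_mono mult_mono) auto
    finally show ?thesis .
  qed
  then have "eventually (\<lambda>s. norm (B s \<alpha> \<gamma> - B t \<alpha> \<gamma>) \<le> (\<Sum>\<delta>\<in>I. \<Sum>\<epsilon>\<in>I. C * \<bar>M s \<delta> \<epsilon> - M t \<delta> \<epsilon>\<bar> * C))
      (at t within {ti..tf})"
    unfolding eventually_at_filter by (intro always_eventually) simp
  from Lim_null_comparison[OF this lim]
  show "((\<lambda>t. B t \<alpha> \<gamma>) \<longlongrightarrow> B t \<alpha> \<gamma>) (at t within {ti..tf})" by (rule LIM_zero_cancel)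
qed

text \<open>The limit of the resolvent identity is B' = - B M' B, and M' = - G M turns this into B
  G.\<close>

lemma B_deriv:
  assumes t: "t \<in> {ti..tf}" and ag: "\<alpha> \<in> I" "\<gamma> \<in> I"
  shows "((\<lambda>s. B s \<alpha> \<gamma>) has_real_derivative (\<Sum>\<delta>\<in>I. B t \<alpha> \<delta> * G t \<delta> \<gamma>)) (at t within {ti..tf})"
  unfolding has_field_derivative_iff
proof -
  have Bt: "((\<lambda>s. B s \<alpha> \<delta>) \<longlongrightarrow> B t \<alpha> \<delta>) (at t within {ti..tf})" if "\<delta> \<in> I" for \<delta>
    using B_continuous[OF ag(1) that] t unfolding continuous_on_def by blast
  have Mt: "((\<lambda>s. (M s \<delta> \<epsilon> - M t \<delta> \<epsilon>) / (s - t)) \<longlongrightarrow> - (\<Sum>\<kappa>\<in>I. G t \<delta> \<kappa> * M t \<kappa> \<epsilon>)) (at t within {ti..tf})"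
    if "\<delta> \<in> I" "\<epsilon> \<in> I" for \<delta> \<epsilon>
    using M_deriv[OF that t] unfolding has_field_derivative_iff .
  have "((\<lambda>s. - (\<Sum>\<delta>\<in>I. \<Sum>\<epsilon>\<in>I. B s \<alpha> \<delta> * ((M s \<delta> \<epsilon> - M t \<delta> \<epsilon>) / (s - t)) * B t \<epsilon> \<gamma>)) \<longlongrightarrow>
      - (\<Sum>\<delta>\<in>I. \<Sum>\<epsilon>\<in>I. B t \<alpha> \<delta> * (- (\<Sum>\<kappa>\<in>I. G t \<delta> \<kappa> * M t \<kappa> \<epsilon>)) * B t \<epsilon> \<gamma>)) (at t within {ti..tf})"
    by (intro tendsto_minus tendsto_sum tendsto_mult tendsto_const Bt Mt)
  moreover have "- (\<Sum>\<delta>\<in>I. \<Sum>\<epsilon>\<in>I. B t \<alpha> \<delta> * (- (\<Sum>\<kappa>\<in>I. G t \<delta> \<kappa> * M t \<kappa> \<epsilon>)) * B t \<epsilon> \<gamma>)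
      = (\<Sum>\<delta>\<in>I. B t \<alpha> \<delta> * G t \<delta> \<gamma>)"
  proof -
    have "(\<Sum>\<epsilon>\<in>I. (\<Sum>\<kappa>\<in>I. G t \<delta> \<kappa> * M t \<kappa> \<epsilon>) * B t \<epsilon> \<gamma>) = G t \<delta> \<gamma>" if "\<delta> \<in> I" for \<delta>
    proof -
      have "(\<Sum>\<epsilon>\<in>I. (\<Sum>\<kappa>\<in>I. G t \<delta> \<kappa> * M t \<kappa> \<epsilon>) * B t \<epsilon> \<gamma>) = (\<Sum>\<kappa>\<in>I. if \<kappa> = \<gamma> then G t \<delta> \<kappa> else 0)"
        unfolding sum_mult_assoc[where A = "G t" and B = "M t" and v = "\<lambda>\<epsilon>. B t \<epsilon> \<gamma>", symmetric]
        by (intro sum.cong refl) (simp add: MB[OF t] ag)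
      then show ?thesis using fin ag by simp
    qed
    then show ?thesis by (simp add: sum_negf mult.assoc sum_distrib_left[symmetric])
  qed
  ultimately have lim: "((\<lambda>s. - (\<Sum>\<delta>\<in>I. \<Sum>\<epsilon>\<in>I. B s \<alpha> \<delta> * ((M s \<delta> \<epsilon> - M t \<delta> \<epsilon>) / (s - t)) * B t \<epsilon> \<gamma>)) \<longlongrightarrow>
      (\<Sum>\<delta>\<in>I. B t \<alpha> \<delta> * G t \<delta> \<gamma>)) (at t within {ti..tf})" by (simp only:)
  have "(B s \<alpha> \<gamma> - B t \<alpha> \<gamma>) / (s - t)
      = - (\<Sum>\<delta>\<in>I. \<Sum>\<epsilon>\<in>I. B s \<alpha> \<delta> * ((M s \<delta> \<epsilon> - M t \<delta> \<epsilon>) / (s - t)) * B t \<epsilon> \<gamma>)" if "s \<in> {ti..tf}" for s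
    unfolding B_difference[OF that t ag] by (simp add: sum_divide_distrib sum_negf)
  then have "eventually (\<lambda>s. (B s \<alpha> \<gamma> - B t \<alpha> \<gamma>) / (s - t)
      = - (\<Sum>\<delta>\<in>I. \<Sum>\<epsilon>\<in>I. B s \<alpha> \<delta> * ((M s \<delta> \<epsilon> - M t \<delta> \<epsilon>) / (s - t)) * B t \<epsilon> \<gamma>)) (at t within {ti..tf})"
    unfolding eventually_at_filter by (intro always_eventually) simp
  from tendsto_cong[OF this] lim
  show "((\<lambda>s. (B s \<alpha> \<gamma> - B t \<alpha> \<gamma>) / (s - t)) \<longlongrightarrow> (\<Sum>\<delta>\<in>I. B t \<alpha> \<delta> * G t \<delta> \<gamma>)) (at t within {ti..tf})"
    by (simp only:)
qed

end

section \<open>The expansion in foot and head states\<close>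

text \<open>\<open>w\<close> stands for the eigenfunctions along the protocol and \<open>sN\<close>
  for the square roots of the normalisation factors, so that foot and head states are
  \<open>sN\<close> and its reciprocal times the conjugated eigenfunctions.\<close>

locale spectral = fp_bounded ti tf U \<nu> \<beta> for ti tf and U :: "real^'d::finite \<Rightarrow> real \<Rightarrow> real" and \<nu> \<beta> +
  fixes Idx :: "nat \<Rightarrow> 'i::zero set"
    and lam lam' :: "nat \<Rightarrow> real \<Rightarrow> real"
    and w :: "nat \<Rightarrow> 'i \<Rightarrow> real^'d \<Rightarrow> real \<Rightarrow> real"
    and sN sN' :: "nat \<Rightarrow> 'i \<Rightarrow> real \<Rightarrow> real"
  assumes Idx_finite: "finite (Idx n)"
    and lam_deriv: "t \<in> {ti..tf} \<Longrightarrow> (lam n has_real_derivative lam' n t) (at t within {ti..tf})"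
    and lam_mono: "t \<in> {ti..tf} \<Longrightarrow> strict_mono (\<lambda>n. lam n t)"
    and w_van: "\<alpha> \<in> Idx n \<Longrightarrow> van (w n \<alpha>)"
    and w_eigen: "\<alpha> \<in> Idx n \<Longrightarrow> t \<in> {ti..tf} \<Longrightarrow> ham (w n \<alpha>) x t = lam n t * w n \<alpha> x t"
    and w_complete: "t \<in> {ti..tf} \<Longrightarrow> complete_orthonormal Idx (\<lambda>n \<alpha> x. w n \<alpha> x t)"
    and sN_deriv: "\<alpha> \<in> Idx n \<Longrightarrow> t \<in> {ti..tf} \<Longrightarrow> (sN n \<alpha> has_real_derivative sN' n \<alpha> t) (at t within {ti..tf})"
    and sN'_cont: "\<alpha> \<in> Idx n \<Longrightarrow> continuous_on {ti..tf} (sN' n \<alpha>)"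
    and sN_pos: "\<alpha> \<in> Idx n \<Longrightarrow> t \<in> {ti..tf} \<Longrightarrow> 0 < sN n \<alpha> t"
begin

section \<open>Time derivatives of foot states and matrix elements of the operator
  derivative\<close>

definition "foot n \<alpha> x t = sN n \<alpha> t * (expU x t * w n \<alpha> x t)"
definition "head n \<alpha> x t = 1 / sN n \<alpha> t * (exp (\<beta> * U x t / 2) * w n \<alpha> x t)"
definition "Gam n t \<alpha> \<gamma> = (LINT x|lborel. head n \<alpha> x t * time_deriv {ti..tf} (foot n \<gamma> x) t)"
definition "Ldot n m t \<alpha> \<gamma> = (LINT x|lborel. head n \<alpha> x t *
    fokker_planck_dot \<nu> (\<lambda>y. dt U y t) (\<lambda>y. foot m \<gamma> y t) x)"

lemma sN_cont: "\<alpha> \<in> Idx n \<Longrightarrow> continuous_on {ti..tf} (sN n \<alpha>)"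
  using sN_deriv by (meson DERIV_continuous_on)

lemma lam_cont: "continuous_on {ti..tf} (lam n)"
  using lam_deriv by (meson DERIV_continuous_on)

lemma lam_neq: "t \<in> {ti..tf} \<Longrightarrow> n \<noteq> m \<Longrightarrow> lam n t \<noteq> lam m t"
  using strict_mono_eq[OF lam_mono] by blast

lemma van_square_integrable: assumes "van f" "t \<in> {ti..tf}" shows "square_integrable (\<lambda>x. f x t)"
  unfolding square_integrable_def power2_eq_square
  using dom_slice(2)[OF van_dom[OF assms(1)] assms(2)] van_mult_integrable[OF assms(1) assms(1) assms(2)] by blast

lemma ip_w_w:
  assumes "t \<in> {ti..tf}" "\<alpha> \<in> Idx n" "\<gamma> \<in> Idx m"
  shows "ip (w n \<alpha>) (w m \<gamma>) t = (if n = m \<and> \<alpha> = \<gamma> then 1 else 0)"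
  unfolding ip_def using complete_orthonormalD(2)[OF w_complete[OF assms(1)] assms(2,3)] .

text \<open>The vectors \<open>exp (\<beta> U / 2) (exp (- \<beta> U / 2) w)'\<close> and \<open>exp (- \<beta> U / 2) (exp (\<beta> U / 2) w)'\<close>.\<close>

definition "gf n \<alpha> x t = dt (w n \<alpha>) x t - \<beta> / 2 * (dt U x t * w n \<alpha> x t)"
definition "gh n \<alpha> x t = dt (w n \<alpha>) x t + \<beta> / 2 * (dt U x t * w n \<alpha> x t)"

lemma van_gf: "\<alpha> \<in> Idx n \<Longrightarrow> van (gf n \<alpha>)"
  unfolding gf_def[abs_def] by (intro van_diff van_dt van_cmult van_dtU w_van)

lemma van_gh: "\<alpha> \<in> Idx n \<Longrightarrow> van (gh n \<alpha>)"
  unfolding gh_def[abs_def] by (intro van_add van_dt van_cmult van_dtU w_van)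

lemma ip_dtU_move: "ip f (\<lambda>x t. c * (dt U x t * h x t)) t = ip (\<lambda>x t. c * (dt U x t * f x t)) h t"
  unfolding ip_def by (simp add: ac_simps)

text \<open>Differentiate the orthonormality relation in time. The terms with \<open>dt U\<close> in
  \<open>gf\<close> and \<open>gh\<close> have opposite signs and cancel, because the multiplication
  moves across the inner product.\<close>

lemma ip_w_gf:
  assumes t: "t \<in> {ti..tf}" and a: "\<alpha> \<in> Idx n" and c: "\<gamma> \<in> Idx m"
  shows "ip (w n \<alpha>) (gf m \<gamma>) t = - ip (gh n \<alpha>) (w m \<gamma>) t"
proof -
  let ?d = "if n = m \<and> \<alpha> = \<gamma> then 1 else 0 :: real"
  have "((\<lambda>s. ?d) has_real_derivative ip (dt (w n \<alpha>)) (w m \<gamma>) t + ip (w n \<alpha>) (dt (w m \<gamma>)) t) (at t within {ti..tf})"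
    using has_derivative_transform[of t "{ti..tf}" "\<lambda>s. ?d" "ip (w n \<alpha>) (w m \<gamma>)", OF t ip_w_w[OF _ a c, symmetric]]
      ip_has_derivative[OF w_van[OF a] w_van[OF c] t] unfolding has_field_derivative_def by blast
  from time_deriv_eq[OF this t] time_deriv_eq[OF DERIV_const t]
  have 0: "ip (dt (w n \<alpha>)) (w m \<gamma>) t + ip (w n \<alpha>) (dt (w m \<gamma>)) t = 0" by simp
  have "ip (w n \<alpha>) (gf m \<gamma>) t = ip (w n \<alpha>) (dt (w m \<gamma>)) t - ip (w n \<alpha>) (\<lambda>x t. \<beta> / 2 * (dt U x t * w m \<gamma> x t)) t"
    unfolding gf_def[abs_def] by (intro ip_diff_right van_dt van_cmult van_dtU w_van a c t)
  moreover have "ip (w m \<gamma>) (gh n \<alpha>) t = ip (w m \<gamma>) (dt (w n \<alpha>)) t + ip (w m \<gamma>) (\<lambda>x t. \<beta> / 2 * (dt U x t * w n \<alpha> x t)) t"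
    unfolding gh_def[abs_def] by (intro ip_add_right van_dt van_cmult van_dtU w_van a c t)
  moreover have "ip (w m \<gamma>) (\<lambda>x t. \<beta> / 2 * (dt U x t * w n \<alpha> x t)) t = ip (w n \<alpha>) (\<lambda>x t. \<beta> / 2 * (dt U x t * w m \<gamma> x t)) t"
    unfolding ip_dtU_move[of "w n \<alpha>"] by (simp add: ip_commute)
  ultimately show ?thesis using 0 by (simp add: ip_commute[of "w m \<gamma>"])
qed

lemma has_dt_foot:
  assumes t: "t \<in> {ti..tf}" and c: "\<gamma> \<in> Idx m"
  shows "(foot m \<gamma> x has_real_derivative expU x t * (sN' m \<gamma> t * w m \<gamma> x t + sN m \<gamma> t * gf m \<gamma> x t)) (at t within {ti..tf})"
proof -
  have "((\<lambda>t. sN m \<gamma> t * (expU x t * w m \<gamma> x t)) has_real_derivative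
     sN' m \<gamma> t * (expU x t * w m \<gamma> x t) +
     (expU x t * (- \<beta> / 2 * dt U x t) * w m \<gamma> x t + dt (w m \<gamma>) x t * expU x t) * sN m \<gamma> t) (at t within {ti..tf})"
    by (intro DERIV_mult sN_deriv has_dt_expU van_has_dt w_van t c)
  then show ?thesis unfolding foot_def[abs_def] gf_def by (simp add: algebra_simps)
qed

lemma head_dt_foot:
  assumes t: "t \<in> {ti..tf}" and a: "\<alpha> \<in> Idx n" and c: "\<gamma> \<in> Idx m"
  shows "(LINT x|lborel. head n \<alpha> x t * time_deriv {ti..tf} (foot m \<gamma> x) t)
    = (if n = m \<and> \<alpha> = \<gamma> then sN' m \<gamma> t / sN n \<alpha> t else 0) - sN m \<gamma> t / sN n \<alpha> t * ip (gh n \<alpha>) (w m \<gamma>) t"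
proof -
  have "head n \<alpha> x t * time_deriv {ti..tf} (foot m \<gamma> x) t
      = sN' m \<gamma> t / sN n \<alpha> t * (w n \<alpha> x t * w m \<gamma> x t) + sN m \<gamma> t / sN n \<alpha> t * (w n \<alpha> x t * gf m \<gamma> x t)" for x
  proof -
    have "head n \<alpha> x t * time_deriv {ti..tf} (foot m \<gamma> x) t = 1 / sN n \<alpha> t * w n \<alpha> x t *
        (exp (\<beta> * U x t / 2) * (expU x t * (sN' m \<gamma> t * w m \<gamma> x t + sN m \<gamma> t * gf m \<gamma> x t)))"
      unfolding head_def time_deriv_eq[OF has_dt_foot[OF t c] t] by (simp add: ac_simps)
    then show ?thesis unfolding expU_inverse by (simp add: algebra_simps)
  qed
  then have "(LINT x|lborel. head n \<alpha> x t * time_deriv {ti..tf} (foot m \<gamma> x) t)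
      = (LINT x|lborel. sN' m \<gamma> t / sN n \<alpha> t * (w n \<alpha> x t * w m \<gamma> x t) + sN m \<gamma> t / sN n \<alpha> t * (w n \<alpha> x t * gf m \<gamma> x t))"
    by simp
  also have "\<dots> = sN' m \<gamma> t / sN n \<alpha> t * ip (w n \<alpha>) (w m \<gamma>) t + sN m \<gamma> t / sN n \<alpha> t * ip (w n \<alpha>) (gf m \<gamma>) t"
    unfolding ip_def
    by (subst Bochner_Integration.integral_add)
       (auto intro!: integrable_mult_right van_mult_integrable w_van van_gf a c t simp del: times_divide_eq_left)
  finally show ?thesis using ip_w_w[OF t a c] ip_w_gf[OF t a c] by simp
qed

lemma Gam_eq:
  assumes "t \<in> {ti..tf}" "\<alpha> \<in> Idx n" "\<gamma> \<in> Idx n"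
  shows "Gam n t \<alpha> \<gamma> = (if \<alpha> = \<gamma> then sN' n \<gamma> t / sN n \<alpha> t else 0) - sN n \<gamma> t / sN n \<alpha> t * ip (gh n \<alpha>) (w n \<gamma>) t"
  unfolding Gam_def head_dt_foot[OF assms] by simp

lemma Gam_cont:
  assumes "\<alpha> \<in> Idx n" "\<gamma> \<in> Idx n" shows "continuous_on {ti..tf} (\<lambda>t. Gam n t \<alpha> \<gamma>)"
proof -
  have nz: "\<forall>t\<in>{ti..tf}. sN n \<alpha> t \<noteq> 0" using sN_pos[OF assms(1)] by fastforce
  have "continuous_on {ti..tf} (\<lambda>t. (if \<alpha> = \<gamma> then sN' n \<gamma> t / sN n \<alpha> t else 0) - sN n \<gamma> t / sN n \<alpha> t * ip (gh n \<alpha>) (w n \<gamma>) t)"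
  proof (intro continuous_on_diff continuous_on_mult continuous_on_divide sN_cont ip_continuous van_gh w_van assms nz)
    have "continuous_on {ti..tf} (\<lambda>t. sN' n \<gamma> t / sN n \<alpha> t)"
      by (intro continuous_on_divide sN_cont sN'_cont assms nz)
    then show "continuous_on {ti..tf} (\<lambda>t. if \<alpha> = \<gamma> then sN' n \<gamma> t / sN n \<alpha> t else 0)"
      by (cases "\<alpha> = \<gamma>") auto
  qed
  then show ?thesis by (rule continuous_on_eq) (simp add: Gam_eq[OF _ assms])
qed

lemma fokker_planck_dot_cmult:
  assumes u: "smooth f" and t: "t \<in> {ti..tf}"
  shows "fokker_planck_dot \<nu> (\<lambda>y. dt U y t) (\<lambda>y. c * (expU y t * f y t)) x
    = c * fokker_planck_dot \<nu> (\<lambda>y. dt U y t) (\<lambda>y. expU y t * f y t) x"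
proof -
  have "\<exists>d. has_partial i (\<lambda>y. expU y t * f y t * dx i (dt U) y t) x d" for i
    using has_partial_mult[OF has_partial_mult[OF has_partial_expU[OF t] smooth_has_dx[OF u t]]
        smooth_has_dx[OF smooth_dx[OF smooth_dt[OF smooth_U]] t]] by blast
  then obtain d where d: "has_partial i (\<lambda>y. expU y t * f y t * dx i (dt U) y t) x (d i)" for i by metis
  have "partial_deriv i (\<lambda>y. c * (expU y t * f y t) * dx i (dt U) y t) x
      = c * partial_deriv i (\<lambda>y. expU y t * f y t * dx i (dt U) y t) x" for i
    using has_partial_imp_partial_deriv[OF d] has_partial_imp_partial_deriv[OF has_partial_cmult[OF d, where c = c]]
    by (simp add: mult.assoc)
  then show ?thesis
    unfolding fokker_planck_dot_def divergence_def grad_def dx_def by (simp add: sum_distrib_left mult.left_commute)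
qed

text \<open>The off-diagonal Hellmann-Feynman relation. Test the differentiated eigenvalue equation
  of \<open>w m\<close> with \<open>w n\<close>: symmetry of the Hamiltonian produces
  \<open>lam n\<close>, and the term with the derivative of \<open>lam m\<close> dies by
  orthogonality. By \<open>head_dt_foot\<close>, the last factor is the integral of the head state
  against the derivative of the foot state.\<close>

lemma Ldot_eq:
  assumes t: "t \<in> {ti..tf}" and a: "\<alpha> \<in> Idx n" and c: "\<gamma> \<in> Idx m" and nm: "n \<noteq> m"
  shows "Ldot n m t \<alpha> \<gamma> = (lam n t - lam m t) * (- (sN m \<gamma> t / sN n \<alpha> t) * ip (gh n \<alpha>) (w m \<gamma>) t)"
proof -
  define k where "k = sN m \<gamma> t / sN n \<alpha> t"
  have H: "ham (gf m \<gamma>) x t = lam m t * gf m \<gamma> x t + lam' m t * w m \<gamma> x t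
      + exp (\<beta> * U x t / 2) * fokker_planck_dot \<nu> (\<lambda>y. dt U y t) (\<lambda>y. expU y t * w m \<gamma> y t) x" for x
    unfolding gf_def[abs_def] by (rule ham_eigen_dt[OF w_van[OF c] t w_eigen[OF c] lam_deriv[OF t]])
  have "head n \<alpha> x t * fokker_planck_dot \<nu> (\<lambda>y. dt U y t) (\<lambda>y. foot m \<gamma> y t) x
     = k * (w n \<alpha> x t * (ham (gf m \<gamma>) x t - lam m t * gf m \<gamma> x t - lam' m t * w m \<gamma> x t))" for x
    unfolding foot_def fokker_planck_dot_cmult[OF van_smooth[OF w_van[OF c]] t] head_def H k_def by simp
  then have "Ldot n m t \<alpha> \<gamma> = (LINT x|lborel. k *
      (w n \<alpha> x t * (ham (gf m \<gamma>) x t - lam m t * gf m \<gamma> x t - lam' m t * w m \<gamma> x t)))"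
    unfolding Ldot_def by (intro Bochner_Integration.integral_cong) auto
  also have "\<dots> = k * ip (w n \<alpha>) (\<lambda>x s. ham (gf m \<gamma>) x s - lam m t * gf m \<gamma> x s - lam' m t * w m \<gamma> x s) t"
    unfolding integral_mult_right_zero ip_def ..
  also have "ip (w n \<alpha>) (\<lambda>x s. ham (gf m \<gamma>) x s - lam m t * gf m \<gamma> x s - lam' m t * w m \<gamma> x s) t
     = ip (w n \<alpha>) (ham (gf m \<gamma>)) t - lam m t * ip (w n \<alpha>) (gf m \<gamma>) t - lam' m t * ip (w n \<alpha>) (w m \<gamma>) t"
    using ip_diff_right[OF van_diff[OF van_ham[OF van_gf[OF c]] van_cmult[OF van_gf[OF c]]] van_cmult[OF w_van[OF c]] w_van[OF a] t]
      ip_diff_right[OF van_ham[OF van_gf[OF c]] van_cmult[OF van_gf[OF c]] w_van[OF a] t]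
    unfolding ip_cmult_right by simp
  also have "ip (w n \<alpha>) (ham (gf m \<gamma>)) t = ip (ham (w n \<alpha>)) (gf m \<gamma>) t"
    by (rule ham_symmetric[OF w_van[OF a] van_gf[OF c] t])
  also have "ip (ham (w n \<alpha>)) (gf m \<gamma>) t = lam n t * ip (w n \<alpha>) (gf m \<gamma>) t"
    unfolding ip_def w_eigen[OF a t] mult.assoc by simp
  finally show ?thesis
    unfolding k_def[symmetric] ip_w_w[OF t a c] ip_w_gf[OF t a c] using nm by (simp add: algebra_simps)
qed

text \<open>The components of \<open>exp (- \<beta> U / 2) \<psi>\<close> with respect to the foot states.\<close>

definition "C \<psi> n \<alpha> t = ip (w n \<alpha>) \<psi> t / sN n \<alpha> t"

text \<open>Closed form of the series over \<open>m \<noteq> n\<close>: the complete Parseval sum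
  minus its block \<open>m = n\<close>. That block is expressed through \<open>Gam\<close>, and
  since \<open>Gam\<close> also contains the derivative of the normalisation, the last term puts it
  back.\<close>

definition "X \<psi> n \<alpha> t = - ip (gh n \<alpha>) \<psi> t / sN n \<alpha> t - (\<Sum>\<gamma>\<in>Idx n. Gam n t \<alpha> \<gamma> * C \<psi> n \<gamma> t)
    + sN' n \<alpha> t / sN n \<alpha> t * C \<psi> n \<alpha> t"

lemma C_cont: "van \<psi> \<Longrightarrow> \<alpha> \<in> Idx n \<Longrightarrow> continuous_on {ti..tf} (C \<psi> n \<alpha>)"
  unfolding C_def[abs_def] using sN_pos[of \<alpha> n]
  by (intro continuous_on_divide ip_continuous w_van sN_cont ballI less_imp_neq[THEN not_sym]) auto

lemma X_cont: assumes "van \<psi>" "\<alpha> \<in> Idx n" shows "continuous_on {ti..tf} (X \<psi> n \<alpha>)"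
proof -
  have nz: "\<forall>t\<in>{ti..tf}. sN n \<alpha> t \<noteq> 0" using sN_pos[OF assms(2)] by fastforce
  show ?thesis unfolding X_def[abs_def]
    by (intro continuous_on_add continuous_on_diff continuous_on_divide continuous_on_minus continuous_on_sum
        continuous_on_mult ip_continuous van_gh C_cont Gam_cont sN_cont sN'_cont assms nz)
qed

lemma parseval:
  assumes "van f" "van g" "t \<in> {ti..tf}"
  shows "(\<lambda>n. \<Sum>\<alpha>\<in>Idx n. ip (w n \<alpha>) f t * ip (w n \<alpha>) g t) sums ip f g t"
  unfolding ip_def
  by (rule L2_sums_inner[OF Idx_finite])
     (use assms complete_orthonormalD(3)[OF w_complete[OF assms(3)] van_square_integrable[OF assms(1,3)]]
      in \<open>auto intro: van_square_integrable w_van\<close>)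

text \<open>By \<open>Ldot_eq\<close> each summand is a sum of products of Fourier coefficients of
  \<psi> and of \<open>gh n \<eta>\<close>, so this is Parseval's identity with one block left
  out.\<close>

lemma coupling_sums_X:
  assumes p: "van \<psi>" and t: "t \<in> {ti..tf}" and e: "\<eta> \<in> Idx n"
  shows "(\<lambda>m. if m = n then 0 else \<Sum>\<gamma>\<in>Idx m. (Ldot n m t \<eta> \<gamma> / (lam n t - lam m t)) * C \<psi> m \<gamma> t) sums X \<psi> n \<eta> t"
proof -
  define s where "s m = (\<Sum>\<gamma>\<in>Idx m. (- (sN m \<gamma> t / sN n \<eta> t) * ip (gh n \<eta>) (w m \<gamma>) t) * C \<psi> m \<gamma> t)" for m
  have s: "s m = - (1 / sN n \<eta> t) * (\<Sum>\<gamma>\<in>Idx m. ip (w m \<gamma>) \<psi> t * ip (w m \<gamma>) (gh n \<eta>) t)" for m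
    unfolding s_def sum_distrib_left
  proof (intro sum.cong refl)
    fix \<gamma> assume c: "\<gamma> \<in> Idx m"
    show "- (sN m \<gamma> t / sN n \<eta> t) * ip (gh n \<eta>) (w m \<gamma>) t * C \<psi> m \<gamma> t
        = - (1 / sN n \<eta> t) * (ip (w m \<gamma>) \<psi> t * ip (w m \<gamma>) (gh n \<eta>) t)"
      unfolding C_def ip_commute[of "w m \<gamma>" "gh n \<eta>"] using sN_pos[OF c t] by simp
  qed
  have "s sums (- (1 / sN n \<eta> t) * ip \<psi> (gh n \<eta>) t)"
    unfolding s by (intro sums_mult parseval p van_gh e t)
  moreover have "(\<lambda>m. if m = n then s m else 0) sums s n" by (rule sums_single)
  ultimately have "(\<lambda>m. s m - (if m = n then s m else 0)) sums (- (1 / sN n \<eta> t) * ip \<psi> (gh n \<eta>) t - s n)"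
    by (rule sums_diff)
  moreover have "(\<lambda>m. s m - (if m = n then s m else 0))
      = (\<lambda>m. if m = n then 0 else \<Sum>\<gamma>\<in>Idx m. (Ldot n m t \<eta> \<gamma> / (lam n t - lam m t)) * C \<psi> m \<gamma> t)"
  proof
    fix m
    show "s m - (if m = n then s m else 0)
      = (if m = n then 0 else \<Sum>\<gamma>\<in>Idx m. (Ldot n m t \<eta> \<gamma> / (lam n t - lam m t)) * C \<psi> m \<gamma> t)"
    proof (cases "m = n")
      case False
      then have "lam n t - lam m t \<noteq> 0" using lam_neq[OF t] by simp
      then show ?thesis using False unfolding s_def
        by (auto intro!: sum.cong simp: Ldot_eq[OF t e])
    qed simp
  qed
  moreover have "- (1 / sN n \<eta> t) * ip \<psi> (gh n \<eta>) t - s n = X \<psi> n \<eta> t"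
  proof -
    have "(\<Sum>\<gamma>\<in>Idx n. Gam n t \<eta> \<gamma> * C \<psi> n \<gamma> t)
        = (\<Sum>\<gamma>\<in>Idx n. (if \<eta> = \<gamma> then sN' n \<gamma> t / sN n \<eta> t * C \<psi> n \<gamma> t else 0)
           + (- (sN n \<gamma> t / sN n \<eta> t) * ip (gh n \<eta>) (w n \<gamma>) t) * C \<psi> n \<gamma> t)"
      by (intro sum.cong refl) (simp add: Gam_eq[OF t e] left_diff_distrib)
    also have "\<dots> = sN' n \<eta> t / sN n \<eta> t * C \<psi> n \<eta> t + s n"
      unfolding sum.distrib s_def using Idx_finite[of n] e by simp
    finally show ?thesis unfolding X_def by (simp add: ip_commute[of \<psi>])
  qed
  ultimately show ?thesis by simp
qed

text \<open>For \<rho> = \<open>expU\<close> \<psi>, the residual times \<open>expU\<close> is the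
  defect of \<rho> in the Fokker-Planck equation.\<close>

definition "residual \<psi> x t = dt \<psi> x t - \<beta> / 2 * (dt U x t * \<psi> x t) + ham \<psi> x t"

lemma van_residual: "van \<psi> \<Longrightarrow> van (residual \<psi>)"
  unfolding residual_def[abs_def] by (intro van_add van_diff van_dt van_cmult van_dtU van_ham)

text \<open>Stated for every rapidly vanishing \<psi>, with the residual as error term, because it
  is used in both directions: the residual vanishes for the true solution, and has to be shown to
  vanish for an admissible family.\<close>

lemma C_deriv:
  assumes p: "van \<psi>" and t: "t \<in> {ti..tf}" and a: "\<alpha> \<in> Idx n"
  shows "(C \<psi> n \<alpha> has_real_derivative - X \<psi> n \<alpha> t - (\<Sum>\<gamma>\<in>Idx n. Gam n t \<alpha> \<gamma> * C \<psi> n \<gamma> t) - lam n t * C \<psi> n \<alpha> t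
      + ip (w n \<alpha>) (residual \<psi>) t / sN n \<alpha> t) (at t within {ti..tf})"
proof -
  have s: "sN n \<alpha> t \<noteq> 0" using sN_pos[OF a t] by simp
  have R: "ip (w n \<alpha>) (residual \<psi>) t = ip (w n \<alpha>) (dt \<psi>) t - ip (w n \<alpha>) (\<lambda>x t. \<beta> / 2 * (dt U x t * \<psi> x t)) t + ip (w n \<alpha>) (ham \<psi>) t"
    unfolding residual_def[abs_def]
    using ip_add_right[OF van_diff[OF van_dt[OF p] van_cmult[OF van_dtU[OF p], of "\<beta> / 2"]] van_ham[OF p] w_van[OF a] t]
      ip_diff_right[OF van_dt[OF p] van_cmult[OF van_dtU[OF p], of "\<beta> / 2"] w_van[OF a] t] by simp
  have H: "ip (w n \<alpha>) (ham \<psi>) t = lam n t * ip (w n \<alpha>) \<psi> t"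
    unfolding ham_symmetric[OF w_van[OF a] p t] unfolding ip_def w_eigen[OF a t] mult.assoc by simp
  have G: "ip (gh n \<alpha>) \<psi> t = ip (dt (w n \<alpha>)) \<psi> t + ip (w n \<alpha>) (\<lambda>x t. \<beta> / 2 * (dt U x t * \<psi> x t)) t"
    using ip_add_right[OF van_dt[OF w_van[OF a]] van_cmult[OF van_dtU[OF w_van[OF a]], of "\<beta> / 2"] p t]
    unfolding gh_def[abs_def] ip_dtU_move[of "w n \<alpha>"] by (simp add: ip_commute[of \<psi>])
  have "(C \<psi> n \<alpha> has_real_derivative ((ip (dt (w n \<alpha>)) \<psi> t + ip (w n \<alpha>) (dt \<psi>) t) * sN n \<alpha> t
      - ip (w n \<alpha>) \<psi> t * sN' n \<alpha> t) / (sN n \<alpha> t * sN n \<alpha> t)) (at t within {ti..tf})"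
    unfolding C_def[abs_def] by (intro DERIV_divide ip_has_derivative w_van p a t sN_deriv s)
  moreover have "((ip (dt (w n \<alpha>)) \<psi> t + ip (w n \<alpha>) (dt \<psi>) t) * sN n \<alpha> t
      - ip (w n \<alpha>) \<psi> t * sN' n \<alpha> t) / (sN n \<alpha> t * sN n \<alpha> t)
     = - X \<psi> n \<alpha> t - (\<Sum>\<gamma>\<in>Idx n. Gam n t \<alpha> \<gamma> * C \<psi> n \<gamma> t) - lam n t * C \<psi> n \<alpha> t
      + ip (w n \<alpha>) (residual \<psi>) t / sN n \<alpha> t"
  proof -
    have e: "ip (dt (w n \<alpha>)) \<psi> t + ip (w n \<alpha>) (dt \<psi>) t
      = ip (gh n \<alpha>) \<psi> t + ip (w n \<alpha>) (residual \<psi>) t - lam n t * ip (w n \<alpha>) \<psi> t" using R H G by simp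
    show ?thesis unfolding e X_def C_def using s by (simp add: field_simps)
  qed
  ultimately show ?thesis by simp
qed

lemma ip_zero_imp_AE_zero:
  assumes f: "van f" and t: "t \<in> {ti..tf}" and 0: "\<And>n \<alpha>. \<alpha> \<in> Idx n \<Longrightarrow> ip (w n \<alpha>) f t = 0"
  shows "AE x in lborel. f x t = 0"
proof -
  have "(\<lambda>n. \<Sum>\<alpha>\<in>Idx n. ip (w n \<alpha>) f t * ip (w n \<alpha>) f t) sums ip f f t" by (rule parseval[OF f f t])
  then have "(\<lambda>n. 0) sums ip f f t" using 0 by simp
  then have "(LINT x|lborel. f x t * f x t) = 0" unfolding ip_def using sums_unique2[OF sums_zero] by metis
  then have "AE x in lborel. f x t * f x t = 0"
    using integral_nonneg_eq_0_iff_AE[OF van_mult_integrable[OF f f t]] by simp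
  then show ?thesis by eventually_elim simp
qed

end

context fp_operators
begin

lemma dx_diff:
  assumes "smooth f" "smooth g" "t \<in> {ti..tf}"
  shows "dx i (\<lambda>x t. f x t - g x t) x t = dx i f x t - dx i g x t"
  by (intro dx_eq has_partial_diff smooth_has_dx assms)

lemma ham_diff:
  assumes "van f" "van g" "t \<in> {ti..tf}"
  shows "ham (\<lambda>x t. f x t - g x t) x t = ham f x t - ham g x t"
proof -
  have d: "dx i (dx i (\<lambda>x t. f x t - g x t)) x t = dx i (dx i f) x t - dx i (dx i g) x t" for i
  proof -
    have "dx i (dx i (\<lambda>x t. f x t - g x t)) x t = dx i (\<lambda>x t. dx i f x t - dx i g x t) x t"
      by (rule dx_cong) (intro dx_diff van_smooth assms)
    also have "\<dots> = dx i (dx i f) x t - dx i (dx i g) x t"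
      by (intro dx_diff van_smooth van_dx assms)
    finally show ?thesis .
  qed
  show ?thesis unfolding ham_eq d sum_subtractf by (simp add: algebra_simps diff_divide_distrib)
qed

lemma dt_diff:
  assumes "van f" "van g" "t \<in> {ti..tf}"
  shows "dt (\<lambda>x t. f x t - g x t) x t = dt f x t - dt g x t"
  by (intro dt_eq DERIV_diff van_has_dt assms)

end

context spectral
begin

lemma residual_diff:
  assumes "van f" "van g" "t \<in> {ti..tf}"
  shows "residual (\<lambda>x t. f x t - g x t) x t = residual f x t - residual g x t"
  unfolding residual_def ham_diff[OF assms] dt_diff[OF assms] by (simp add: algebra_simps)

text \<open>Completeness at time \<open>ti\<close> turns equal initial coefficients into a
  difference that is 0 almost everywhere, and \<open>fokker_planck_unique\<close> propagates
  this.\<close>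

lemma ip_eq_if_residual_zero:
  assumes f: "van f" and g: "van g"
    and Rf: "\<And>s. s \<in> {ti..tf} \<Longrightarrow> AE x in lborel. residual f x s = 0"
    and Rg: "\<And>s. s \<in> {ti..tf} \<Longrightarrow> AE x in lborel. residual g x s = 0"
    and init: "\<And>n \<alpha>. \<alpha> \<in> Idx n \<Longrightarrow> ip (w n \<alpha>) f ti = ip (w n \<alpha>) g ti"
    and t: "t \<in> {ti..tf}" and a: "\<alpha> \<in> Idx n"
  shows "ip (w n \<alpha>) f t = ip (w n \<alpha>) g t"
proof -
  define d where "d = (\<lambda>x t. f x t - g x t)"
  have d: "van d" unfolding d_def by (intro van_diff f g)
  have ti: "ti \<in> {ti..tf}" using ti_less_tf by simp
  have "AE x in lborel. d x t = 0"
  proof (rule fokker_planck_unique[OF d _ _ t])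
    fix s assume s: "s \<in> {ti..tf}"
    show "AE x in lborel. dt d x s - \<beta> / 2 * (dt U x s * d x s) = - ham d x s"
      using Rf[OF s] Rg[OF s]
    proof eventually_elim
      case (elim x)
      then have "residual d x s = 0" unfolding d_def residual_diff[OF f g s] by simp
      then show ?case unfolding residual_def by simp
    qed
  next
    show "AE x in lborel. d x ti = 0"
    proof (rule ip_zero_imp_AE_zero[OF d ti])
      fix n \<alpha> assume a: "\<alpha> \<in> Idx n"
      show "ip (w n \<alpha>) d ti = 0"
        unfolding d_def ip_diff_right[OF f g w_van[OF a] ti] using init[OF a] by simp
    qed
  qed
  then have "AE x in lborel. w n \<alpha> x t * d x t = 0" by eventually_elim simp
  then have "ip (w n \<alpha>) d t = (LINT x::real^'d|lborel. 0)"
    unfolding ip_def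
    by (intro integral_cong_AE borel_measurable_integrable[OF van_mult_integrable[OF w_van[OF a] d t]]) auto
  then show ?thesis unfolding d_def ip_diff_right[OF f g w_van[OF a] t] by simp
qed

end

section \<open>The coefficients with decay and diagonal coupling removed\<close>

locale spectral_flow = spectral +
  fixes M :: "nat \<Rightarrow> real \<Rightarrow> 'b \<Rightarrow> 'b \<Rightarrow> real"
  assumes M_deriv: "\<alpha> \<in> Idx n \<Longrightarrow> \<eta> \<in> Idx n \<Longrightarrow> t \<in> {ti..tf} \<Longrightarrow>
       ((\<lambda>s. M n s \<alpha> \<eta>) has_real_derivative - (\<Sum>\<gamma>\<in>Idx n. Gam n t \<alpha> \<gamma> * M n t \<gamma> \<eta>)) (at t within {ti..tf})"
    and M_init: "\<alpha> \<in> Idx n \<Longrightarrow> \<eta> \<in> Idx n \<Longrightarrow> M n ti \<alpha> \<eta> = (if \<alpha> = \<eta> then 1 else 0)"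
begin

lemma flow: "matrix_flow ti tf (Idx n) (M n) (Gam n)"
  by unfold_locales (simp_all add: Idx_finite Gam_cont M_deriv M_init del: atLeastAtMost_iff)

definition "B n t = matrix_inv_on (Idx n) (M n t)"

lemma B_eq: "B n = matrix_flow.B (Idx n) (M n)"
  by (rule ext) (simp add: B_def matrix_flow.B_def[OF flow])

lemmas B_left = matrix_flow.B_left[OF flow, folded B_eq]
  and M_left = matrix_flow.M_left[OF flow, folded B_eq]
  and B_init = matrix_flow.B_init[OF flow, folded B_eq]
  and B_continuous = matrix_flow.B_continuous[OF flow, folded B_eq]
  and B_deriv = matrix_flow.B_deriv[OF flow, folded B_eq]

definition "Lam n t = integral {ti..t} (lam n)"

lemma Lam_deriv: "t \<in> {ti..tf} \<Longrightarrow> (Lam n has_real_derivative lam n t) (at t within {ti..tf})"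
  unfolding Lam_def[abs_def] by (rule integral_has_real_derivative[OF lam_cont])

lemma Lam_init: "Lam n ti = 0"
  unfolding Lam_def by simp

lemma Lam_diff: assumes "t \<in> {ti..tf}" shows "integral {ti..t} (\<lambda>s. lam n s - lam m s) = Lam n t - Lam m t"
  unfolding Lam_def using assms
  by (intro Henstock_Kurzweil_Integration.integral_diff integrable_continuous_interval
      continuous_on_subset[OF lam_cont]) auto

lemma exp_Lam_cont: "continuous_on {ti..tf} (\<lambda>t. exp (Lam n t))"
proof -
  have "continuous_on {ti..tf} (Lam n)" using Lam_deriv by (meson DERIV_continuous_on)
  then show ?thesis by (intro continuous_on_exp)
qed

text \<open>\<open>D\<close> are the coefficients of \<open>exp (- \<beta> U / 2) \<psi>\<close>.\<close>

definition "coeffs_of D \<psi> \<longleftrightarrow> van \<psi> \<and> (\<forall>t\<in>{ti..tf}. \<forall>n. \<forall>\<gamma>\<in>Idx n.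
    (\<Sum>\<delta>\<in>Idx n. exp (- Lam n t) * M n t \<gamma> \<delta> * D n \<delta> t) = C \<psi> n \<gamma> t)"

text \<open>The relation in \<open>coeffs_of\<close> solved for \<open>D\<close>, by inverting
  \<open>M n t\<close> and the exponential factor.\<close>

definition "Dc \<psi> n \<alpha> t = exp (Lam n t) * (\<Sum>\<gamma>\<in>Idx n. B n t \<alpha> \<gamma> * C \<psi> n \<gamma> t)"

text \<open>\<open>X\<close> under the same transformation; it is the integrand of the equation for
  \<open>D\<close> (\<open>coupling_sum_eq_Y\<close>).\<close>

definition "Y \<psi> n \<alpha> t = exp (Lam n t) * (\<Sum>\<eta>\<in>Idx n. B n t \<alpha> \<eta> * X \<psi> n \<eta> t)"

lemma coeffs_of_Dc: assumes "van \<psi>" shows "coeffs_of (Dc \<psi>) \<psi>"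
  unfolding coeffs_of_def
proof (intro conjI assms ballI allI)
  fix t n \<gamma> assume t: "t \<in> {ti..tf}" and c: "\<gamma> \<in> Idx n"
  have "(\<Sum>\<delta>\<in>Idx n. exp (- Lam n t) * M n t \<gamma> \<delta> * Dc \<psi> n \<delta> t)
      = (\<Sum>\<delta>\<in>Idx n. M n t \<gamma> \<delta> * (\<Sum>\<epsilon>\<in>Idx n. B n t \<delta> \<epsilon> * C \<psi> n \<epsilon> t))"
    unfolding Dc_def by (intro sum.cong refl) (simp add: exp_minus)
  then show "(\<Sum>\<delta>\<in>Idx n. exp (- Lam n t) * M n t \<gamma> \<delta> * Dc \<psi> n \<delta> t) = C \<psi> n \<gamma> t"
    using M_left[OF t c, of "\<lambda>\<epsilon>. C \<psi> n \<epsilon> t"] by simp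
qed

lemma coeffs_of_eq_Dc:
  assumes D: "coeffs_of D \<psi>" and t: "t \<in> {ti..tf}" and a: "\<alpha> \<in> Idx n"
  shows "D n \<alpha> t = Dc \<psi> n \<alpha> t"
proof -
  have "C \<psi> n \<gamma> t = exp (- Lam n t) * (\<Sum>\<delta>\<in>Idx n. M n t \<gamma> \<delta> * D n \<delta> t)" if "\<gamma> \<in> Idx n" for \<gamma>
    using D t that unfolding coeffs_of_def by (simp add: sum_distrib_left mult.assoc)
  then have "Dc \<psi> n \<alpha> t = exp (Lam n t) * (\<Sum>\<gamma>\<in>Idx n. B n t \<alpha> \<gamma> * (exp (- Lam n t) * (\<Sum>\<delta>\<in>Idx n. M n t \<gamma> \<delta> * D n \<delta> t)))"
    unfolding Dc_def by simp
  also have "\<dots> = (\<Sum>\<gamma>\<in>Idx n. B n t \<alpha> \<gamma> * (\<Sum>\<delta>\<in>Idx n. M n t \<gamma> \<delta> * D n \<delta> t))"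
    unfolding sum_distrib_left[of "exp (Lam n t)"] by (intro sum.cong refl) (simp add: exp_minus)
  also have "\<dots> = D n \<alpha> t" by (rule B_left[OF t a])
  finally show ?thesis ..
qed

text \<open>The exponential of the difference splits. Its part in \<open>m\<close>, together with
  the sum over \<delta>, rebuilds \<open>C \<psi> m \<gamma> t\<close>; its part in \<open>n\<close>
  leaves the series, and \<open>coupling_sums_X\<close> remains.\<close>

lemma coupling_sums:
  assumes D: "coeffs_of D \<psi>" and t: "t \<in> {ti..tf}" and e: "\<eta> \<in> Idx n"
  shows "coupling ti Idx lam M Ldot D n \<alpha> \<eta> t sums (exp (Lam n t) * B n t \<alpha> \<eta> * X \<psi> n \<eta> t)"
proof -
  have E: "coupling ti Idx lam M Ldot D n \<alpha> \<eta> t m = exp (Lam n t) * B n t \<alpha> \<eta> *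
      (if m = n then 0 else \<Sum>\<gamma>\<in>Idx m. (Ldot n m t \<eta> \<gamma> / (lam n t - lam m t)) * C \<psi> m \<gamma> t)" for m
  proof (cases "m = n")
    case False
    have Cm: "C \<psi> m \<gamma> t = (\<Sum>\<delta>\<in>Idx m. exp (- Lam m t) * M m t \<gamma> \<delta> * D m \<delta> t)" if "\<gamma> \<in> Idx m" for \<gamma>
      using D t that unfolding coeffs_of_def by simp
    have F: "exp (integral {ti..t} (\<lambda>s'. lam n s' - lam m s')) * (B n t \<alpha> \<eta> * Ldot n m t \<eta> \<gamma> * M m t \<gamma> \<delta>
             / (lam n t - lam m t)) * D m \<delta> t
        = exp (Lam n t) * B n t \<alpha> \<eta> * ((Ldot n m t \<eta> \<gamma> / (lam n t - lam m t)) * (exp (- Lam m t) * M m t \<gamma> \<delta> * D m \<delta> t))" for \<gamma> \<delta>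
      unfolding Lam_diff[OF t] exp_diff exp_minus by (simp add: divide_inverse ac_simps)
    have "coupling ti Idx lam M Ldot D n \<alpha> \<eta> t m = (\<Sum>\<gamma>\<in>Idx m. \<Sum>\<delta>\<in>Idx m.
        exp (Lam n t) * B n t \<alpha> \<eta> * ((Ldot n m t \<eta> \<gamma> / (lam n t - lam m t)) * (exp (- Lam m t) * M m t \<gamma> \<delta> * D m \<delta> t)))"
      unfolding coupling_def B_def[symmetric] by (simp only: False if_False F)
    also have "\<dots> = exp (Lam n t) * B n t \<alpha> \<eta> * (\<Sum>\<gamma>\<in>Idx m. (Ldot n m t \<eta> \<gamma> / (lam n t - lam m t)) * C \<psi> m \<gamma> t)"
      unfolding sum_distrib_left[symmetric] using Cm by simp
    finally show ?thesis using False by simp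
  qed (simp add: coupling_def)
  have p: "van \<psi>" using D unfolding coeffs_of_def by blast
  show ?thesis unfolding ext[of "coupling ti Idx lam M Ldot D n \<alpha> \<eta> t", OF E]
    by (rule sums_mult[OF coupling_sums_X[OF p t e]])
qed

lemma coupling_sum_eq_Y:
  assumes D: "coeffs_of D \<psi>" and t: "t \<in> {ti..tf}"
  shows "(\<Sum>\<eta>\<in>Idx n. \<Sum>m. coupling ti Idx lam M Ldot D n \<alpha> \<eta> t m) = Y \<psi> n \<alpha> t"
proof -
  have "(\<Sum>m. coupling ti Idx lam M Ldot D n \<alpha> \<eta> t m) = exp (Lam n t) * B n t \<alpha> \<eta> * X \<psi> n \<eta> t" if "\<eta> \<in> Idx n" for \<eta>
    using sums_unique[OF coupling_sums[OF D t that]] by simp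
  then show ?thesis unfolding Y_def by (simp add: sum_distrib_left mult.assoc)
qed

lemma Y_cont: "van \<psi> \<Longrightarrow> \<alpha> \<in> Idx n \<Longrightarrow> continuous_on {ti..tf} (Y \<psi> n \<alpha>)"
  unfolding Y_def[abs_def] by (intro continuous_on_mult exp_Lam_cont continuous_on_sum B_continuous X_cont)

text \<open>Variation of constants: the derivative B Gam of the inverse cancels the diagonal
  coupling and that of \<open>exp (Lam n t)\<close> cancels the decay, so that the off-diagonal part
  and the residual are all that survives.\<close>

lemma Dc_deriv:
  assumes p: "van \<psi>" and t: "t \<in> {ti..tf}" and a: "\<alpha> \<in> Idx n"
  shows "(Dc \<psi> n \<alpha> has_real_derivative - Y \<psi> n \<alpha> t
    + exp (Lam n t) * (\<Sum>\<gamma>\<in>Idx n. B n t \<alpha> \<gamma> * (ip (w n \<gamma>) (residual \<psi>) t / sN n \<gamma> t))) (at t within {ti..tf})"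
proof -
  define C' where "C' \<gamma> = - X \<psi> n \<gamma> t - (\<Sum>\<delta>\<in>Idx n. Gam n t \<gamma> \<delta> * C \<psi> n \<delta> t) - lam n t * C \<psi> n \<gamma> t
      + ip (w n \<gamma>) (residual \<psi>) t / sN n \<gamma> t" for \<gamma>
  have E: "((\<lambda>t. exp (Lam n t)) has_real_derivative exp (Lam n t) * lam n t) (at t within {ti..tf})"
    using Lam_deriv[OF t, of n] by (auto intro!: derivative_eq_intros)
  have S: "((\<lambda>t. \<Sum>\<gamma>\<in>Idx n. B n t \<alpha> \<gamma> * C \<psi> n \<gamma> t) has_real_derivative
      (\<Sum>\<gamma>\<in>Idx n. (\<Sum>\<delta>\<in>Idx n. B n t \<alpha> \<delta> * Gam n t \<delta> \<gamma>) * C \<psi> n \<gamma> t + C' \<gamma> * B n t \<alpha> \<gamma>)) (at t within {ti..tf})"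
    unfolding C'_def by (intro DERIV_sum DERIV_mult B_deriv C_deriv p t a)
  have val: "(\<Sum>\<gamma>\<in>Idx n. (\<Sum>\<delta>\<in>Idx n. B n t \<alpha> \<delta> * Gam n t \<delta> \<gamma>) * C \<psi> n \<gamma> t + C' \<gamma> * B n t \<alpha> \<gamma>)
     = (\<Sum>\<gamma>\<in>Idx n. B n t \<alpha> \<gamma> * (ip (w n \<gamma>) (residual \<psi>) t / sN n \<gamma> t)) - (\<Sum>\<gamma>\<in>Idx n. B n t \<alpha> \<gamma> * X \<psi> n \<gamma> t)
       - lam n t * (\<Sum>\<gamma>\<in>Idx n. B n t \<alpha> \<gamma> * C \<psi> n \<gamma> t)"
  proof -
    have "(\<Sum>\<gamma>\<in>Idx n. (\<Sum>\<delta>\<in>Idx n. B n t \<alpha> \<delta> * Gam n t \<delta> \<gamma>) * C \<psi> n \<gamma> t)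
      = (\<Sum>\<gamma>\<in>Idx n. B n t \<alpha> \<gamma> * (\<Sum>\<delta>\<in>Idx n. Gam n t \<gamma> \<delta> * C \<psi> n \<delta> t))"
      by (rule sum_mult_assoc[symmetric])
    moreover have "C' \<gamma> * B n t \<alpha> \<gamma> = B n t \<alpha> \<gamma> * (ip (w n \<gamma>) (residual \<psi>) t / sN n \<gamma> t) - B n t \<alpha> \<gamma> * X \<psi> n \<gamma> t
        - lam n t * (B n t \<alpha> \<gamma> * C \<psi> n \<gamma> t) - B n t \<alpha> \<gamma> * (\<Sum>\<delta>\<in>Idx n. Gam n t \<gamma> \<delta> * C \<psi> n \<delta> t)" for \<gamma>
      unfolding C'_def by (simp add: algebra_simps)
    ultimately show ?thesis by (simp only: sum.distrib sum_subtractf sum_distrib_left[of "lam n t"])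
  qed
  show ?thesis unfolding Dc_def[abs_def] Y_def
    by (rule DERIV_cong[OF DERIV_mult[OF E S]], unfold val) (simp add: algebra_simps)
qed

lemma C_init_imp_Dc_init:
  assumes "\<And>\<gamma>. \<gamma> \<in> Idx n \<Longrightarrow> C \<psi> n \<gamma> ti = (if n = 0 \<and> \<gamma> = 0 then 1 else 0)" "\<alpha> \<in> Idx n"
  shows "Dc \<psi> n \<alpha> ti = (if n = 0 \<and> \<alpha> = 0 then 1 else 0)"
proof -
  have "Dc \<psi> n \<alpha> ti = (\<Sum>\<gamma>\<in>Idx n. if \<alpha> = \<gamma> then C \<psi> n \<gamma> ti else 0)"
    unfolding Dc_def by (auto simp: Lam_init B_init assms(2) intro!: sum.cong)
  then show ?thesis using assms Idx_finite by simp
qed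

lemma coeff_equation_Dc:
  assumes p: "van \<psi>" and R: "\<And>x t. t \<in> {ti..tf} \<Longrightarrow> residual \<psi> x t = 0"
    and init: "\<And>n \<gamma>. \<gamma> \<in> Idx n \<Longrightarrow> C \<psi> n \<gamma> ti = (if n = 0 \<and> \<gamma> = 0 then 1 else 0)"
  shows "coeff_equation ti tf Idx lam M Ldot (Dc \<psi>)"
  unfolding coeff_equation_def
proof (intro conjI allI ballI)
  note D = coeffs_of_Dc[OF p]
  fix n \<alpha> assume a: "\<alpha> \<in> Idx n"
  show "Dc \<psi> n \<alpha> ti = (if n = 0 \<and> \<alpha> = 0 then 1 else 0)" by (rule C_init_imp_Dc_init[OF init a])
  show "summable (coupling ti Idx lam M Ldot (Dc \<psi>) n \<alpha> \<eta> s)" if "\<eta> \<in> Idx n" "s \<in> {ti..tf}" for \<eta> s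
    using coupling_sums[OF D that(2,1)] by (rule sums_summable)
  fix t assume t: "t \<in> {ti..tf}"
  have "((\<lambda>s. - Y \<psi> n \<alpha> s) has_integral (Dc \<psi> n \<alpha> t - Dc \<psi> n \<alpha> ti)) {ti..t}"
  proof (rule fundamental_theorem_of_calculus)
    fix s assume s: "s \<in> {ti..t}"
    then have s': "s \<in> {ti..tf}" using t by auto
    have "ip (w n \<gamma>) (residual \<psi>) s = 0" for \<gamma> unfolding ip_def R[OF s'] by simp
    then have "(Dc \<psi> n \<alpha> has_real_derivative - Y \<psi> n \<alpha> s) (at s within {ti..tf})"
      using Dc_deriv[OF p s' a] by simp
    then have "(Dc \<psi> n \<alpha> has_real_derivative - Y \<psi> n \<alpha> s) (at s within {ti..t})"
      by (rule DERIV_subset) (use t in auto)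
    then show "(Dc \<psi> n \<alpha> has_vector_derivative - Y \<psi> n \<alpha> s) (at s within {ti..t})"
      unfolding has_real_derivative_iff_has_vector_derivative .
  qed (use t in simp)
  from has_integral_neg[OF this]
  have "(Y \<psi> n \<alpha> has_integral (Dc \<psi> n \<alpha> ti - Dc \<psi> n \<alpha> t)) {ti..t}" by simp
  then have I: "((\<lambda>s. \<Sum>\<eta>\<in>Idx n. \<Sum>m. coupling ti Idx lam M Ldot (Dc \<psi>) n \<alpha> \<eta> s m) has_integral
      (Dc \<psi> n \<alpha> ti - Dc \<psi> n \<alpha> t)) {ti..t}"
    by (rule has_integral_eq[rotated]) (use t in \<open>simp add: coupling_sum_eq_Y[OF D]\<close>)
  then show "(\<lambda>s. \<Sum>\<eta>\<in>Idx n. \<Sum>m. coupling ti Idx lam M Ldot (Dc \<psi>) n \<alpha> \<eta> s m) integrable_on {ti..t}" by blast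
  show "Dc \<psi> n \<alpha> t = Dc \<psi> n \<alpha> ti - integral {ti..t} (\<lambda>s. \<Sum>\<eta>\<in>Idx n. \<Sum>m. coupling ti Idx lam M Ldot (Dc \<psi>) n \<alpha> \<eta> s m)"
    unfolding integral_unique[OF I] by simp
qed

text \<open>Conversely, the equation for \<open>D\<close> is the weak form of the Fokker-Planck equation.\<close>

lemma coeff_equation_imp_residual_zero:
  assumes D: "coeffs_of D \<psi>" and eq: "coeff_equation ti tf Idx lam M Ldot D"
    and t: "t \<in> {ti..tf}" and a: "\<alpha> \<in> Idx n"
  shows "ip (w n \<alpha>) (residual \<psi>) t = 0"
proof -
  have p: "van \<psi>" using D unfolding coeffs_of_def by blast
  define R where "R \<gamma> = ip (w n \<gamma>) (residual \<psi>) t / sN n \<gamma> t" for \<gamma>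
  have BR: "(\<Sum>\<gamma>\<in>Idx n. B n t \<alpha> \<gamma> * R \<gamma>) = 0" if a: "\<alpha> \<in> Idx n" for \<alpha>
  proof -
    have DY: "Dc \<psi> n \<alpha> s = Dc \<psi> n \<alpha> ti - integral {ti..s} (Y \<psi> n \<alpha>)" if s: "s \<in> {ti..tf}" for s
    proof -
      have "integral {ti..s} (\<lambda>s. \<Sum>\<eta>\<in>Idx n. \<Sum>m. coupling ti Idx lam M Ldot D n \<alpha> \<eta> s m) = integral {ti..s} (Y \<psi> n \<alpha>)"
        using s by (intro Henstock_Kurzweil_Integration.integral_cong coupling_sum_eq_Y[OF D]) auto
      moreover have "D n \<alpha> s = D n \<alpha> ti - integral {ti..s} (\<lambda>s. \<Sum>\<eta>\<in>Idx n. \<Sum>m. coupling ti Idx lam M Ldot D n \<alpha> \<eta> s m)"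
        using eq a s unfolding coeff_equation_def by blast
      ultimately show ?thesis
        using coeffs_of_eq_Dc[OF D s a] coeffs_of_eq_Dc[OF D _ a, of ti] ti_less_tf by simp
    qed
    \<comment> \<open>The integral equation may be differentiated because \<open>Y\<close> is
      continuous; comparison with \<open>Dc_deriv\<close> isolates the residual term.\<close>
    have "((\<lambda>s. integral {ti..s} (Y \<psi> n \<alpha>)) has_real_derivative Y \<psi> n \<alpha> t) (at t within {ti..tf})"
      by (rule integral_has_real_derivative[OF Y_cont[OF p a] t])
    from DERIV_diff[OF DERIV_const[of "Dc \<psi> n \<alpha> ti"] this]
    have "(Dc \<psi> n \<alpha> has_real_derivative 0 - Y \<psi> n \<alpha> t) (at t within {ti..tf})"
      unfolding has_field_derivative_def
      using has_derivative_transform[of t "{ti..tf}" "Dc \<psi> n \<alpha>"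
          "\<lambda>s. Dc \<psi> n \<alpha> ti - integral {ti..s} (Y \<psi> n \<alpha>)", OF t DY] by blast
    from time_deriv_eq[OF this t] time_deriv_eq[OF Dc_deriv[OF p t a] t]
    have "exp (Lam n t) * (\<Sum>\<gamma>\<in>Idx n. B n t \<alpha> \<gamma> * R \<gamma>) = 0" unfolding R_def by linarith
    then show ?thesis by simp
  qed
  have "R \<alpha> = (\<Sum>\<delta>\<in>Idx n. M n t \<alpha> \<delta> * (\<Sum>\<epsilon>\<in>Idx n. B n t \<delta> \<epsilon> * R \<epsilon>))"
    using M_left[OF t a] by simp
  also have "\<dots> = 0" using BR by simp
  finally show ?thesis unfolding R_def using sN_pos[OF a t] by simp
qed

text \<open>Multiplication by \<open>exp (\<beta> * U x t / 2)\<close> is an isometry of the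
  weighted space onto the ordinary \<open>L\<^sup>2\<close> space, and it takes foot states to
  multiples of the orthonormal functions.\<close>

lemma foot_square:
  "exp (\<beta> * U x t) * (r - (\<Sum>n<k. \<Sum>\<alpha>\<in>Idx n. \<Sum>\<gamma>\<in>Idx n. e n * M n t \<alpha> \<gamma> * d n \<gamma> * foot n \<alpha> x t))\<^sup>2
   = (exp (\<beta> * U x t / 2) * r - (\<Sum>n<k. \<Sum>\<alpha>\<in>Idx n. (\<Sum>\<gamma>\<in>Idx n. e n * M n t \<alpha> \<gamma> * d n \<gamma>) * sN n \<alpha> t * w n \<alpha> x t))\<^sup>2"
proof -
  let ?e = "exp (\<beta> * U x t / 2)"
  have sq: "exp (\<beta> * U x t) = ?e\<^sup>2" by (simp add: power2_eq_square exp_add[symmetric])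
  have ef: "?e * (c * foot n \<alpha> x t) = c * sN n \<alpha> t * w n \<alpha> x t" for c n \<alpha>
  proof -
    have "?e * (c * foot n \<alpha> x t) = c * sN n \<alpha> t * (?e * (expU x t * w n \<alpha> x t))"
      unfolding foot_def by (simp add: ac_simps)
    then show ?thesis unfolding expU_inverse .
  qed
  have "?e * (r - (\<Sum>n<k. \<Sum>\<alpha>\<in>Idx n. \<Sum>\<gamma>\<in>Idx n. e n * M n t \<alpha> \<gamma> * d n \<gamma> * foot n \<alpha> x t))
     = ?e * r - (\<Sum>n<k. \<Sum>\<alpha>\<in>Idx n. (\<Sum>\<gamma>\<in>Idx n. e n * M n t \<alpha> \<gamma> * d n \<gamma>) * sN n \<alpha> t * w n \<alpha> x t)"
    unfolding right_diff_distrib sum_distrib_left sum_distrib_right ef ..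
  then show ?thesis unfolding sq power_mult_distrib[symmetric] by simp
qed

lemma coeffs_of_imp_admissible:
  assumes D: "coeffs_of D \<psi>"
  shows "admissible_coeffs ti tf \<beta> U Idx lam M foot D"
  unfolding admissible_coeffs_def
proof (intro exI conjI ballI)
  have p: "van \<psi>" using D unfolding coeffs_of_def by blast
  show "vanishing_on {ti..tf} U (\<lambda>x t. exp (\<beta> * U x t / 2) * (expU x t * \<psi> x t))"
    using p unfolding expU_inverse van_def .
  fix t assume t: "t \<in> {ti..tf}"
  have "(\<Sum>\<gamma>\<in>Idx n. exp (- integral {ti..t} (lam n)) * M n t \<alpha> \<gamma> * D n \<gamma> t) * sN n \<alpha> t = ip (w n \<alpha>) \<psi> t"
    if "\<alpha> \<in> Idx n" for n \<alpha>
    using D t that sN_pos[OF that t] unfolding coeffs_of_def C_def Lam_def by simp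
  then show "(\<lambda>k. LINT x|lborel. exp (\<beta> * U x t) * (expU x t * \<psi> x t -
       (\<Sum>n<k. \<Sum>\<alpha>\<in>Idx n. \<Sum>\<gamma>\<in>Idx n. exp (- integral {ti..t} (lam n)) * M n t \<alpha> \<gamma> * D n \<gamma> t * foot n \<alpha> x t))\<^sup>2) \<longlonglongrightarrow> 0"
    using complete_orthonormalD(3)[OF w_complete[OF t] van_square_integrable[OF p t]]
    unfolding foot_square expU_inverse ip_def by simp
qed

text \<open>The function is the limit of the series times \<open>exp (\<beta> U / 2)\<close>;
  testing the convergent series with \<open>w m \<eta>\<close> singles out one coefficient.\<close>

lemma admissible_imp_coeffs_of:
  assumes "admissible_coeffs ti tf \<beta> U Idx lam M foot D"
  shows "\<exists>\<psi>. coeffs_of D \<psi>"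
proof -
  obtain r where r: "vanishing_on {ti..tf} U (\<lambda>x t. exp (\<beta> * U x t / 2) * r x t)"
    and lim: "\<forall>t\<in>{ti..tf}. (\<lambda>k. LINT x|lborel. exp (\<beta> * U x t) * (r x t -
       (\<Sum>n<k. \<Sum>\<alpha>\<in>Idx n. \<Sum>\<gamma>\<in>Idx n. exp (- integral {ti..t} (lam n)) * M n t \<alpha> \<gamma> * D n \<gamma> t * foot n \<alpha> x t))\<^sup>2) \<longlonglongrightarrow> 0"
    using assms unfolding admissible_coeffs_def by (elim exE conjE)
  define \<psi> where "\<psi> x t = exp (\<beta> * U x t / 2) * r x t" for x t
  have p: "van \<psi>" using r unfolding van_def \<psi>_def[abs_def] .
  have "(\<Sum>\<delta>\<in>Idx m. exp (- Lam m t) * M m t \<eta> \<delta> * D m \<delta> t) = C \<psi> m \<eta> t"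
    if t: "t \<in> {ti..tf}" and e: "\<eta> \<in> Idx m" for t m \<eta>
  proof -
    define c where "c n \<alpha> = (\<Sum>\<gamma>\<in>Idx n. exp (- integral {ti..t} (lam n)) * M n t \<alpha> \<gamma> * D n \<gamma> t) * sN n \<alpha> t" for n \<alpha>
    have "(\<lambda>k. LINT x|lborel. (\<psi> x t - (\<Sum>n<k. \<Sum>\<alpha>\<in>Idx n. c n \<alpha> * w n \<alpha> x t))\<^sup>2) \<longlonglongrightarrow> 0"
      using bspec[OF lim t] unfolding foot_square \<psi>_def c_def .
    from L2_sums_inner[OF Idx_finite van_square_integrable[OF w_van t] van_square_integrable[OF p t]
        van_square_integrable[OF w_van[OF e] t] this]
    have "(\<lambda>n. \<Sum>\<alpha>\<in>Idx n. c n \<alpha> * ip (w n \<alpha>) (w m \<eta>) t) sums ip \<psi> (w m \<eta>) t"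
      unfolding ip_def by simp
    moreover have "(\<Sum>\<alpha>\<in>Idx n. c n \<alpha> * ip (w n \<alpha>) (w m \<eta>) t) = (if n = m then c n \<eta> else 0)" for n
    proof -
      have "(\<Sum>\<alpha>\<in>Idx n. c n \<alpha> * ip (w n \<alpha>) (w m \<eta>) t) = (\<Sum>\<alpha>\<in>Idx n. if \<alpha> = \<eta> then if n = m then c n \<eta> else 0 else 0)"
        by (intro sum.cong refl) (simp add: ip_w_w[OF t _ e])
      then show ?thesis using e Idx_finite[of n] by auto
    qed
    ultimately have "(\<lambda>n. if n = m then c n \<eta> else 0) sums ip \<psi> (w m \<eta>) t" by simp
    then have "ip \<psi> (w m \<eta>) t = c m \<eta>"
      by (rule sums_unique2[OF _ sums_single[of m "\<lambda>n. c n \<eta>"]])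
    then show ?thesis unfolding C_def ip_commute[of "w m \<eta>"] c_def Lam_def using sN_pos[OF e t] by simp
  qed
  then show ?thesis unfolding coeffs_of_def using p by (intro exI[of _ \<psi>]) blast
qed

theorem coefficients_unique:
  assumes p: "van \<psi>" and R: "\<And>x t. t \<in> {ti..tf} \<Longrightarrow> residual \<psi> x t = 0"
    and init: "\<And>n \<gamma>. \<gamma> \<in> Idx n \<Longrightarrow> C \<psi> n \<gamma> ti = (if n = 0 \<and> \<gamma> = 0 then 1 else 0)"
    and D: "admissible_coeffs ti tf \<beta> U Idx lam M foot D" "coeff_equation ti tf Idx lam M Ldot D"
    and t: "t \<in> {ti..tf}" and a: "\<alpha> \<in> Idx n"
  shows "D n \<alpha> t = Dc \<psi> n \<alpha> t"
proof -
  obtain \<phi> where \<phi>: "coeffs_of D \<phi>" using admissible_imp_coeffs_of[OF D(1)] ..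
  have v: "van \<phi>" using \<phi> unfolding coeffs_of_def by blast
  have ti: "ti \<in> {ti..tf}" using ti_less_tf by simp
  have Cinit: "C \<phi> m \<gamma> ti = C \<psi> m \<gamma> ti" if c: "\<gamma> \<in> Idx m" for m \<gamma>
  proof -
    have "C \<phi> m \<gamma> ti = (\<Sum>\<delta>\<in>Idx m. exp (- Lam m ti) * M m ti \<gamma> \<delta> * D m \<delta> ti)"
      using \<phi> ti c unfolding coeffs_of_def by simp
    also have "\<dots> = (\<Sum>\<delta>\<in>Idx m. if \<gamma> = \<delta> then D m \<delta> ti else 0)"
      by (intro sum.cong refl) (simp add: Lam_init M_init c)
    also have "\<dots> = D m \<gamma> ti" using c Idx_finite by simp
    also have "\<dots> = C \<psi> m \<gamma> ti" using D(2) c init[OF c] unfolding coeff_equation_def by simp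
    finally show ?thesis .
  qed
  have "ip (w m \<gamma>) \<phi> t = ip (w m \<gamma>) \<psi> t" if c: "\<gamma> \<in> Idx m" for m \<gamma>
  proof (rule ip_eq_if_residual_zero[OF v p _ _ _ t c])
    \<comment> \<open>Completeness turns vanishing residual coefficients into an equation that holds
      almost everywhere, which is the form that \<open>fokker_planck_unique\<close> accepts.\<close>
    show "AE x in lborel. residual \<phi> x s = 0" if s: "s \<in> {ti..tf}" for s
      using coeff_equation_imp_residual_zero[OF \<phi> D(2) s] by (intro ip_zero_imp_AE_zero van_residual v s)
    show "AE x in lborel. residual \<psi> x s = 0" if "s \<in> {ti..tf}" for s using R[OF that] by simp
    show "ip (w n \<alpha>) \<phi> ti = ip (w n \<alpha>) \<psi> ti" if "\<alpha> \<in> Idx n" for n \<alpha>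
      using Cinit[OF that] sN_pos[OF that ti] unfolding C_def by simp
  qed
  then have "Dc \<phi> n \<alpha> t = Dc \<psi> n \<alpha> t" unfolding Dc_def C_def by simp
  then show ?thesis using coeffs_of_eq_Dc[OF \<phi> t a] by simp
qed

text \<open>Parseval's identity for \<psi> and \<open>expU\<close> times \<open>dt U\<close>.
  Writing \<open>expU\<close> as a multiple of the ground state makes the second function rapidly
  vanishing; the constant \<open>k\<close> of the initial head state factors out of all
  integrals.\<close>

lemma work_sums:
  assumes D: "coeffs_of D \<psi>" and t: "t \<in> {ti..tf}" and z: "\<And>x. expU x t = z * w 0 0 x t" and 0: "0 \<in> Idx 0"
    and k: "\<And>x. head 0 0 x ti = k"
  shows "(\<lambda>n. \<Sum>\<alpha>\<in>Idx n. \<Sum>\<eta>\<in>Idx n. exp (- integral {ti..t} (lam n)) * M n t \<alpha> \<eta> * D n \<eta> t *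
      (LINT x|lborel. head 0 0 x ti * dt U x t * foot n \<alpha> x t)) sums (LINT x|lborel. k * (expU x t * \<psi> x t) * dt U x t)"
proof -
  have p: "van \<psi>" using D unfolding coeffs_of_def by blast
  \<comment> \<open>The factor \<open>z\<close> belongs to the fixed time \<open>t\<close>, so
    \<open>g\<close> is \<open>expU\<close> times \<open>dt U\<close> at this time only, while
    \<open>van\<close> concerns all times.\<close>
  define g where "g x t = z * (dt U x t * w 0 0 x t)" for x t
  have g: "van g" unfolding g_def[abs_def] by (intro van_cmult van_dtU w_van 0)
  have gt: "g x t = expU x t * dt U x t" for x unfolding g_def z by simp
  have F: "(LINT x|lborel. head 0 0 x ti * dt U x t * foot n \<alpha> x t) = k * sN n \<alpha> t * ip (w n \<alpha>) g t" for n \<alpha>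
  proof -
    have "head 0 0 x ti * dt U x t * foot n \<alpha> x t = k * sN n \<alpha> t * (w n \<alpha> x t * g x t)" for x
      unfolding k foot_def gt by (simp add: ac_simps)
    then show ?thesis unfolding ip_def by simp
  qed
  have "(\<lambda>n. k * (\<Sum>\<alpha>\<in>Idx n. ip (w n \<alpha>) \<psi> t * ip (w n \<alpha>) g t)) sums (k * ip \<psi> g t)"
    by (intro sums_mult parseval p g t)
  moreover have "(\<Sum>\<alpha>\<in>Idx n. \<Sum>\<eta>\<in>Idx n. exp (- integral {ti..t} (lam n)) * M n t \<alpha> \<eta> * D n \<eta> t *
      (LINT x|lborel. head 0 0 x ti * dt U x t * foot n \<alpha> x t)) = k * (\<Sum>\<alpha>\<in>Idx n. ip (w n \<alpha>) \<psi> t * ip (w n \<alpha>) g t)" for n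
    unfolding sum_distrib_left[of k] sum_distrib_right[symmetric]
  proof (intro sum.cong refl)
    fix \<alpha> assume a: "\<alpha> \<in> Idx n"
    have "(\<Sum>\<eta>\<in>Idx n. exp (- integral {ti..t} (lam n)) * M n t \<alpha> \<eta> * D n \<eta> t) = C \<psi> n \<alpha> t"
      using D t a unfolding coeffs_of_def Lam_def by simp
    then show "(\<Sum>\<eta>\<in>Idx n. exp (- integral {ti..t} (lam n)) * M n t \<alpha> \<eta> * D n \<eta> t) *
        (LINT x|lborel. head 0 0 x ti * dt U x t * foot n \<alpha> x t) = k * (ip (w n \<alpha>) \<psi> t * ip (w n \<alpha>) g t)"
      unfolding F C_def using sN_pos[OF a t] by simp
  qed
  moreover have "k * ip \<psi> g t = (LINT x|lborel. k * (expU x t * \<psi> x t) * dt U x t)"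
    unfolding ip_def gt integral_mult_right_zero[symmetric] by (simp add: ac_simps)
  ultimately show ?thesis by simp
qed

lemma work_continuous:
  assumes "van \<psi>" shows "continuous_on {ti..tf} (\<lambda>t. LINT x|lborel. k * (expU x t * \<psi> x t) * dt U x t)"
proof -
  have "continuous_on {ti..tf} (\<lambda>t. LINT x|lborel. expU x t * (k * (dt U x t * \<psi> x t)))"
    by (rule dom_integral_continuous[OF dom_expU[OF van_cmult[OF van_dtU[OF assms]]]])
  then show ?thesis by (simp add: ac_simps)
qed

end

section \<open>Smooth functions of time and the residual of a solution\<close>

lemma (in time_interval) smooth_on_time:
  assumes "smooth_on {ti..tf} (f :: real \<Rightarrow> real)"
  shows "t \<in> {ti..tf} \<Longrightarrow> (f has_real_derivative time_deriv {ti..tf} f t) (at t within {ti..tf})"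
    and "continuous_on {ti..tf} (time_deriv {ti..tf} f)"
proof -
  obtain f' where f': "\<And>t. t \<in> {ti..tf} \<Longrightarrow> (f has_derivative f' t) (at t within {ti..tf})"
    and sm: "smooth_on {ti..tf} (\<lambda>t. f' t 1)"
    using assms by (rule smooth_onE_real) (rule that)
  have d: "(f has_real_derivative f' t 1) (at t within {ti..tf})" if "t \<in> {ti..tf}" for t
  proof -
    have "f' t = (*) (f' t 1)"
    proof
      show "f' t h = f' t 1 * h" for h
        using linear_simps(5)[OF has_derivative_bounded_linear[OF f'[OF that]], of h 1] by simp
    qed
    then show ?thesis using f'[OF that] unfolding has_field_derivative_def by (simp only:)
  qed
  have e: "time_deriv {ti..tf} f t = f' t 1" if "t \<in> {ti..tf}" for t
    by (rule time_deriv_eq[OF d[OF that] that])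
  show "t \<in> {ti..tf} \<Longrightarrow> (f has_real_derivative time_deriv {ti..tf} f t) (at t within {ti..tf})"
    using d e by simp
  obtain f'' where "\<And>t. t \<in> {ti..tf} \<Longrightarrow> ((\<lambda>t. f' t 1) has_derivative f'' t) (at t within {ti..tf})"
    using sm by (rule smooth_onE_real) (rule that)
  then have "continuous_on {ti..tf} (\<lambda>t. f' t 1)"
    by (meson continuous_on_eq_continuous_within has_derivative_continuous)
  then show "continuous_on {ti..tf} (time_deriv {ti..tf} f)"
    by (rule continuous_on_eq) (simp add: e)
qed

context spectral
begin

lemma residual_cmult:
  assumes f: "van f" and t: "t \<in> {ti..tf}"
  shows "residual (\<lambda>x t. c * f x t) x t = c * residual f x t"
proof -
  have dx: "dx i (\<lambda>x t. c * g x t) x t = c * dx i g x t" if "van g" for g i x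
    by (intro dx_eq has_partial_cmult van_has_dx that t)
  have "dx i (dx i (\<lambda>x t. c * f x t)) x t = c * dx i (dx i f) x t" for i
  proof -
    have "dx i (dx i (\<lambda>x t. c * f x t)) x t = dx i (\<lambda>x t. c * dx i f x t) x t"
      by (rule dx_cong) (rule dx[OF f])
    also have "\<dots> = c * dx i (dx i f) x t" by (rule dx[OF van_dx[OF f]])
    finally show ?thesis .
  qed
  moreover have "dt (\<lambda>x t. c * f x t) x t = c * dt f x t"
    by (intro dt_eq DERIV_cmult van_has_dt f t)
  ultimately show ?thesis
    unfolding residual_def ham_eq by (simp add: sum_distrib_left[symmetric] algebra_simps)
qed

lemma residual_of_solution:
  assumes p: "van \<psi>" and t: "t \<in> {ti..tf}"
    and FP: "((\<lambda>s. expU x s * \<psi> x s) has_real_derivative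
      fokker_planck \<nu> \<beta> (\<lambda>y. U y t) (\<lambda>y. expU y t * \<psi> y t) x) (at t within {ti..tf})"
  shows "residual \<psi> x t = 0"
proof -
  have "((\<lambda>s. expU x s * \<psi> x s) has_real_derivative
      expU x t * (- \<beta> / 2 * dt U x t) * \<psi> x t + dt \<psi> x t * expU x t) (at t within {ti..tf})"
    by (rule DERIV_mult[OF has_dt_expU[OF t] van_has_dt[OF p t]])
  from time_deriv_eq[OF this t] time_deriv_eq[OF FP t] fokker_planck_expU[OF van_smooth[OF p] t]
  have "expU x t * residual \<psi> x t = 0" unfolding residual_def by (simp add: algebra_simps)
  then show ?thesis using expU_pos[of x t] by simp
qed

end

section \<open>The mean work\<close>

theorem mainTheorem2:
  fixes \<nu> \<beta> ti tf W :: real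
    and A :: "'p::euclidean_space set"
    and V :: "real^'d::finite \<Rightarrow> 'p \<Rightarrow> real"
    and a :: "real \<Rightarrow> 'p"
    and Vt dtV \<rho> :: "real^'d \<Rightarrow> real \<Rightarrow> real"
    and Idx :: "nat \<Rightarrow> 'i::zero set"
    and lam :: "nat \<Rightarrow> real \<Rightarrow> real"
    and u :: "nat \<Rightarrow> 'i \<Rightarrow> real^'d \<Rightarrow> 'p \<Rightarrow> real"
    and N :: "nat \<Rightarrow> 'i \<Rightarrow> 'p \<Rightarrow> real"
    and foot head :: "nat \<Rightarrow> 'i \<Rightarrow> real^'d \<Rightarrow> real \<Rightarrow> real"
    and M :: "nat \<Rightarrow> real \<Rightarrow> 'i \<Rightarrow> 'i \<Rightarrow> real"
    and Ldot :: "nat \<Rightarrow> nat \<Rightarrow> real \<Rightarrow> 'i \<Rightarrow> 'i \<Rightarrow> real"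
  assumes "\<nu> > 0" and "\<beta> > 0" and "ti < tf"
    \<comment> \<open>potential and protocol\<close>
    and "open A" and "smooth_on (UNIV \<times> A) (\<lambda>(x, b). V x b)"
    and "\<forall>b\<in>A. confining (\<lambda>x. V x b)"
    and "smooth_on {ti..tf} a" and "a ` {ti..tf} \<subseteq> A"
    and "\<forall>x t. Vt x t = V x (a t)"
    and "\<forall>x t. dtV x t = time_deriv {ti..tf} (Vt x) t"
    \<comment> \<open>spectral data\<close>
    and "\<forall>n. finite (Idx n) \<and> Idx n \<noteq> {}" and "Idx 0 = {0}"
    and "\<forall>n. smooth_on {ti..tf} (lam n)"
    and "\<forall>t\<in>{ti..tf}. lam 0 t = 0 \<and> strict_mono (\<lambda>n. lam n t)"
    and "\<forall>n. \<forall>\<alpha>\<in>Idx n. vanishing_on {ti..tf} Vt (\<lambda>x t. u n \<alpha> x (a t))"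
    and "\<forall>n. \<forall>\<alpha>\<in>Idx n. \<forall>t\<in>{ti..tf}. \<forall>x.
           hamiltonian \<nu> \<beta> (\<lambda>y. Vt y t) (\<lambda>y. u n \<alpha> y (a t)) x = lam n t * u n \<alpha> x (a t)"
    and "\<forall>t\<in>{ti..tf}. complete_orthonormal Idx (\<lambda>n \<alpha> x. u n \<alpha> x (a t))"
    and "\<forall>t\<in>{ti..tf}. \<forall>x.
           u 0 0 x (a t) = exp (- \<beta> * Vt x t / 2) / sqrt (partition_fun \<beta> (\<lambda>y. Vt y t))"
    \<comment> \<open>foot and head states\<close>
    and "\<forall>n. \<forall>\<alpha>\<in>Idx n. smooth_on {ti..tf} (\<lambda>t. N n \<alpha> (a t)) \<and> (\<forall>t\<in>{ti..tf}. N n \<alpha> (a t) > 0)"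
    and "\<forall>n \<alpha> x t. foot n \<alpha> x t = sqrt (N n \<alpha> (a t)) * exp (- \<beta> * Vt x t / 2) * u n \<alpha> x (a t)"
    and "\<forall>n \<alpha> x t. head n \<alpha> x t = 1 / sqrt (N n \<alpha> (a t)) * exp (\<beta> * Vt x t / 2) * u n \<alpha> x (a t)"
    \<comment> \<open>the matrices \<open>M\<close> and \<open>Ldot\<close>\<close>
    and "\<forall>n. \<forall>\<alpha>\<in>Idx n. \<forall>\<eta>\<in>Idx n. \<forall>t\<in>{ti..tf}.
           ((\<lambda>s. M n s \<alpha> \<eta>) has_real_derivative
             - (\<Sum>\<gamma>\<in>Idx n.
                  (LINT x|lborel. head n \<alpha> x t * time_deriv {ti..tf} (foot n \<gamma> x) t) * M n t \<gamma> \<eta>))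
           (at t within {ti..tf})"
    and "\<forall>n. \<forall>\<alpha>\<in>Idx n. \<forall>\<eta>\<in>Idx n. M n ti \<alpha> \<eta> = (if \<alpha> = \<eta> then 1 else 0)"
    and "\<forall>n m t \<alpha> \<gamma>. Ldot n m t \<alpha> \<gamma> =
           (LINT x|lborel. head n \<alpha> x t *
              fokker_planck_dot \<nu> (\<lambda>y. dtV y t) (\<lambda>y. foot m \<gamma> y t) x)"
    \<comment> \<open>the solution of the Fokker-Planck equation and the mean work\<close>
    and "vanishing_on {ti..tf} Vt (\<lambda>x t. exp (\<beta> * Vt x t / 2) * \<rho> x t)"
    and "\<forall>t\<in>{ti..tf}. \<forall>x.
           (\<rho> x has_real_derivative fokker_planck \<nu> \<beta> (\<lambda>y. Vt y t) (\<lambda>y. \<rho> y t) x)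
           (at t within {ti..tf})"
    and "\<forall>x. \<rho> x ti = exp (- \<beta> * Vt x ti) / partition_fun \<beta> (\<lambda>y. Vt y ti)"
    and "W = integral {ti..tf} (\<lambda>t. LINT x|lborel. \<rho> x t * dtV x t)"
  shows "\<exists>D.
      admissible_coeffs ti tf \<beta> Vt Idx lam M foot D \<and>
      coeff_equation ti tf Idx lam M Ldot D \<and>
      (\<forall>D'. admissible_coeffs ti tf \<beta> Vt Idx lam M foot D' \<and>
            coeff_equation ti tf Idx lam M Ldot D' \<longrightarrow>
            (\<forall>n. \<forall>\<alpha>\<in>Idx n. \<forall>t\<in>{ti..tf}. D' n \<alpha> t = D n \<alpha> t)) \<and>
      (\<forall>t\<in>{ti..tf}. summable (\<lambda>n. \<Sum>\<alpha>\<in>Idx n. \<Sum>\<eta>\<in>Idx n.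
         exp (- integral {ti..t} (lam n)) * M n t \<alpha> \<eta> * D n \<eta> t *
         (LINT x|lborel. head 0 0 x ti * dtV x t * foot n \<alpha> x t))) \<and>
      ((\<lambda>t. \<Sum>n. \<Sum>\<alpha>\<in>Idx n. \<Sum>\<eta>\<in>Idx n.
         exp (- integral {ti..t} (lam n)) * M n t \<alpha> \<eta> * D n \<eta> t *
         (LINT x|lborel. head 0 0 x ti * dtV x t * foot n \<alpha> x t)) has_integral W) {ti..tf}"
proof -
  note nu = assms(1) and beta = assms(2) and titf = assms(3) and Idx = assms(11) and Idx0 = assms(12)
  interpret T: time_interval ti tf by unfold_locales (rule titf)
  have ti: "ti \<in> {ti..tf}" using titf by simp
  have Vt: "Vt = (\<lambda>x t. V x (a t))" using assms(9) by (intro ext) simp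
  have "T.smooth Vt"
    unfolding Vt T.smooth_def by (rule smooth_on_compose[OF assms(5,7,8)])
  then interpret P: fp_operators ti tf Vt \<nu> \<beta>
    by unfold_locales (use nu beta in auto)
  have dtV: "dtV = T.dt Vt" using assms(10) unfolding T.dt_def by (intro ext) simp
  define w where "w n \<alpha> x t = u n \<alpha> x (a t)" for n \<alpha> x t
  have w_van: "P.van (w n \<alpha>)" if "\<alpha> \<in> Idx n" for n \<alpha>
    using assms(15) that unfolding P.van_def w_def[abs_def] by simp
  define Z where "Z t = partition_fun \<beta> (\<lambda>y. Vt y t)" for t
  have u0: "w 0 0 x t = exp (- \<beta> * Vt x t / 2) / sqrt (Z t)" if "t \<in> {ti..tf}" for x t
    using assms(18) that unfolding w_def Z_def by simp
  \<comment> \<open>An integral that does not exist would have value 0, so integrability is not read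
    off the definition. If \<open>Z t\<close> were 0, division by 0 would make the ground state
    vanish, against its norm 1.\<close>
  have Zpos: "0 < Z t" if t: "t \<in> {ti..tf}" for t
  proof -
    have "0 \<le> Z t" unfolding Z_def partition_fun_def by (intro integral_nonneg_AE) simp
    moreover have "Z t \<noteq> 0"
    proof
      assume 0: "Z t = 0"
      have "(LINT x|lborel. w 0 0 x t * w 0 0 x t) = 1"
        using complete_orthonormalD(2)[OF bspec[OF assms(17) t], of 0 0 0 0] Idx0 unfolding w_def by simp
      then show False using u0[OF t] 0 by simp
    qed
    ultimately show ?thesis by simp
  qed
  have expV: "exp (- \<beta> * Vt x t / 2) = sqrt (Z t) * w 0 0 x t" if "t \<in> {ti..tf}" for x t
    using u0[OF that] Zpos[OF that] by simp
  have "\<exists>C. \<forall>x. \<forall>t\<in>{ti..tf}. P.expU x t \<le> C"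
  proof -
    obtain C where C: "\<forall>x. \<forall>t\<in>{ti..tf}. \<bar>w 0 0 x t\<bar> \<le> C"
      using P.van_bounded[OF w_van[of 0 0]] Idx0 by auto
    \<comment> \<open>The ground state at the spatial origin shows that 1 / sqrt (Z t) is continuous
      in time, without any continuity argument for the partition function; its positive minimum
      bounds sqrt (Z t).\<close>
    define f where "f t = w 0 0 0 t * exp (\<beta> * Vt 0 t / 2)" for t
    have f: "f t = 1 / sqrt (Z t)" if "t \<in> {ti..tf}" for t
      unfolding f_def u0[OF that] by (simp add: exp_add[symmetric])
    have "continuous_on {ti..tf} (w 0 0 0)"
      using T.smooth_continuous_t[OF P.van_smooth[OF w_van[of 0 0]]] Idx0 by simp
    then have "continuous_on {ti..tf} f"
      unfolding f_def by (intro continuous_intros T.smooth_continuous_t[OF P.smooth_U]) simp_all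
    then obtain t0 where t0: "t0 \<in> {ti..tf}" "\<forall>t\<in>{ti..tf}. f t0 \<le> f t"
      using continuous_attains_inf[of "{ti..tf}" f] titf by auto
    have "P.expU x t \<le> sqrt (Z t0) * C" if t: "t \<in> {ti..tf}" for x t
    proof -
      have "f t0 \<le> f t" using t0(2) t by blast
      then have "1 / sqrt (Z t0) \<le> 1 / sqrt (Z t)" unfolding f[OF t] f[OF t0(1)] .
      then have "sqrt (Z t) \<le> sqrt (Z t0)" using Zpos[OF t] Zpos[OF t0(1)] by (simp add: divide_le_eq le_divide_eq)
      moreover have "\<bar>w 0 0 x t\<bar> \<le> C" using C t by blast
      ultimately have "sqrt (Z t) * \<bar>w 0 0 x t\<bar> \<le> sqrt (Z t0) * C"
        using Zpos[OF t0(1)] by (intro mult_mono) auto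
      moreover have "sqrt (Z t) * w 0 0 x t \<le> sqrt (Z t) * \<bar>w 0 0 x t\<bar>"
        using Zpos[OF t] by (intro mult_left_mono abs_ge_self) simp
      ultimately show ?thesis unfolding P.expU_def expV[OF t] by linarith
    qed
    then show ?thesis by blast
  qed
  define sN where "sN n \<alpha> t = sqrt (N n \<alpha> (a t))" for n \<alpha> t
  define sN' where "sN' n \<alpha> t = time_deriv {ti..tf} (\<lambda>s. N n \<alpha> (a s)) t / (2 * sqrt (N n \<alpha> (a t)))" for n \<alpha> t
  have Npos: "0 < N n \<alpha> (a t)" if "\<alpha> \<in> Idx n" "t \<in> {ti..tf}" for n \<alpha> t
    using assms(19) that by blast
  have sN_deriv: "(sN n \<alpha> has_real_derivative sN' n \<alpha> t) (at t within {ti..tf})"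
    if "\<alpha> \<in> Idx n" "t \<in> {ti..tf}" for n \<alpha> t
  proof -
    have "((\<lambda>s. N n \<alpha> (a s)) has_real_derivative time_deriv {ti..tf} (\<lambda>s. N n \<alpha> (a s)) t) (at t within {ti..tf})"
      using assms(19) that by (intro T.smooth_on_time(1)) auto
    from DERIV_chain2[OF DERIV_real_sqrt[OF Npos[OF that]] this]
    show ?thesis unfolding sN_def[abs_def] sN'_def by (simp add: field_simps)
  qed
  have sN'_cont: "continuous_on {ti..tf} (sN' n \<alpha>)" if a: "\<alpha> \<in> Idx n" for n \<alpha>
  proof -
    have sm: "smooth_on {ti..tf} (\<lambda>s. N n \<alpha> (a s))" using assms(19) a by blast
    have "continuous_on {ti..tf} (\<lambda>s. N n \<alpha> (a s))"
      using T.smooth_on_time(1)[OF sm] by (meson DERIV_continuous_on)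
    moreover have "\<forall>t\<in>{ti..tf}. 2 * sqrt (N n \<alpha> (a t)) \<noteq> 0" using Npos[OF a] by fastforce
    ultimately show ?thesis unfolding sN'_def[abs_def]
      by (intro continuous_on_divide continuous_on_mult continuous_on_const continuous_on_real_sqrt
          T.smooth_on_time(2)[OF sm])
  qed
  interpret S: spectral ti tf Vt \<nu> \<beta> Idx lam "\<lambda>n. time_deriv {ti..tf} (lam n)" w sN sN'
  proof (unfold_locales, goal_cases)
    case 1 then show ?case by fact
  next
    case (2 n) then show ?case using Idx by blast
  next
    case (3 t n) then show ?case using assms(13) by (intro T.smooth_on_time(1)) auto
  next
    case (4 t) then show ?case using assms(14) by blast
  next
    case (5 \<alpha> n) then show ?case by (rule w_van)
  next
    case (6 \<alpha> n t x) then show ?case using assms(16) unfolding P.ham_def w_def by blast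
  next
    case (7 t) then show ?case using assms(17) unfolding w_def by blast
  next
    case (8 \<alpha> n t) then show ?case by (rule sN_deriv)
  next
    case (9 \<alpha> n) then show ?case by (rule sN'_cont)
  next
    case (10 \<alpha> n t) then show ?case using Npos unfolding sN_def by simp
  qed
  have foot: "foot = S.foot"
    using assms(20) unfolding S.foot_def[abs_def] P.expU_def sN_def w_def by (intro ext) (simp add: mult.assoc)
  have head: "head = S.head"
    using assms(21) unfolding S.head_def[abs_def] sN_def w_def by (intro ext) (simp add: mult.assoc)
  have Ldot: "Ldot = S.Ldot"
    using assms(24) unfolding S.Ldot_def[abs_def] head foot dtV by (intro ext) simp
  interpret F: spectral_flow ti tf Vt \<nu> \<beta> Idx lam "\<lambda>n. time_deriv {ti..tf} (lam n)" w sN sN' M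
  proof (unfold_locales, goal_cases)
    case (1 \<alpha> n \<eta> t)
    then show ?case using assms(22) unfolding S.Gam_def head foot by blast
  next
    case (2 \<alpha> n \<eta>)
    then show ?case using assms(23) by blast
  qed
  have z0: "0 \<in> Idx 0" using Idx0 by simp
  define \<kappa> where "\<kappa> = 1 / (sN 0 0 ti * sqrt (Z ti))"
  have \<kappa>: "0 < \<kappa>" unfolding \<kappa>_def using S.sN_pos[OF z0 ti] Zpos[OF ti] by simp
  have head0: "S.head 0 0 x ti = \<kappa>" for x
  proof -
    have "exp (\<beta> * Vt x ti / 2) * w 0 0 x ti = 1 / sqrt (Z ti)"
      unfolding u0[OF ti] by (simp add: exp_add[symmetric])
    then show ?thesis unfolding S.head_def \<kappa>_def by simp
  qed
  define \<phi> where "\<phi> x t = exp (\<beta> * Vt x t / 2) * \<rho> x t" for x t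
  have \<phi>: "P.van \<phi>" using assms(25) unfolding P.van_def \<phi>_def[abs_def] .
  have \<rho>: "P.expU x t * \<phi> x t = \<rho> x t" for x t
    unfolding \<phi>_def P.expU_def by (simp add: mult.assoc[symmetric] exp_add[symmetric])
  have R\<phi>: "S.residual \<phi> x t = 0" if "t \<in> {ti..tf}" for x t
    by (rule S.residual_of_solution[OF \<phi> that]) (use assms(26) that in \<open>simp add: \<rho>\<close>)
  define \<psi> where "\<psi> = (\<lambda>x t. 1 / \<kappa> * \<phi> x t)"
  have \<psi>: "P.van \<psi>" unfolding \<psi>_def by (rule P.van_cmult[OF \<phi>])
  have R: "S.residual \<psi> x t = 0" if "t \<in> {ti..tf}" for x t
    unfolding \<psi>_def S.residual_cmult[OF \<phi> that] R\<phi>[OF that] by simp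
  have \<psi>_ti: "\<psi> x ti = sN 0 0 ti * w 0 0 x ti" for x
  proof -
    have "\<phi> x ti = exp (- \<beta> * Vt x ti / 2) / Z ti"
    proof -
      have "exp (\<beta> * Vt x ti / 2) * exp (- \<beta> * Vt x ti) = exp (- \<beta> * Vt x ti / 2)"
        by (simp add: exp_add[symmetric])
      then show ?thesis unfolding \<phi>_def using assms(27) by (simp add: Z_def)
    qed
    moreover have "Z ti = sqrt (Z ti) * sqrt (Z ti)" using Zpos[OF ti] by simp
    ultimately have \<phi>_ti: "\<phi> x ti = exp (- \<beta> * Vt x ti / 2) / (sqrt (Z ti) * sqrt (Z ti))" by simp
    have "1 / (1 / (s * q)) * (e / (q * q)) = s * (e / q)" if "0 < q" for s q e :: real
      using that by simp
    from this[of "sqrt (Z ti)"] show ?thesis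
      unfolding \<psi>_def \<kappa>_def u0[OF ti] \<phi>_ti using Zpos[OF ti] by (simp only: real_sqrt_gt_0_iff)
  qed
  have init: "S.C \<psi> n \<gamma> ti = (if n = 0 \<and> \<gamma> = 0 then 1 else 0)" if c: "\<gamma> \<in> Idx n" for n \<gamma>
  proof -
    have "T.ip (w n \<gamma>) \<psi> ti = sN 0 0 ti * T.ip (w n \<gamma>) (w 0 0) ti"
      unfolding T.ip_def \<psi>_ti by (simp add: mult.left_commute)
    then show ?thesis unfolding S.C_def S.ip_w_w[OF ti c z0] using S.sN_pos[OF z0 ti] by auto
  qed
  have D: "F.coeffs_of (F.Dc \<psi>) \<psi>" by (rule F.coeffs_of_Dc[OF \<psi>])
  have work: "(\<lambda>n. \<Sum>\<alpha>\<in>Idx n. \<Sum>\<eta>\<in>Idx n. exp (- integral {ti..t} (lam n)) * M n t \<alpha> \<eta> * F.Dc \<psi> n \<eta> t *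
      (LINT x|lborel. head 0 0 x ti * dtV x t * foot n \<alpha> x t)) sums (LINT x|lborel. \<rho> x t * dtV x t)"
    if t: "t \<in> {ti..tf}" for t
  proof -
    have "\<kappa> * (P.expU x t * \<psi> x t) = \<rho> x t" for x
      using \<kappa> \<rho>[of x t] unfolding \<psi>_def by simp
    then show ?thesis
      using F.work_sums[OF D t expV[OF t, folded P.expU_def] z0 head0] unfolding head foot dtV by simp
  qed
  have W: "((\<lambda>t. LINT x|lborel. \<rho> x t * dtV x t) has_integral W) {ti..tf}"
  proof -
    have "continuous_on {ti..tf} (\<lambda>t. LINT x|lborel. 1 * (P.expU x t * \<phi> x t) * T.dt Vt x t)"
      by (rule F.work_continuous[OF \<phi>])
    then have "continuous_on {ti..tf} (\<lambda>t. LINT x|lborel. \<rho> x t * dtV x t)" unfolding \<rho> dtV by simp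
    then show ?thesis unfolding assms(28) by (intro integrable_integral integrable_continuous_interval)
  qed
  show ?thesis
  proof (intro exI[of _ "F.Dc \<psi>"] conjI allI impI ballI)
    show "admissible_coeffs ti tf \<beta> Vt Idx lam M foot (F.Dc \<psi>)"
      unfolding foot by (rule F.coeffs_of_imp_admissible[OF D])
    show "coeff_equation ti tf Idx lam M Ldot (F.Dc \<psi>)"
      unfolding Ldot by (rule F.coeff_equation_Dc[OF \<psi> R init])
    show "D' n \<alpha> t = F.Dc \<psi> n \<alpha> t"
      if "admissible_coeffs ti tf \<beta> Vt Idx lam M foot D' \<and> coeff_equation ti tf Idx lam M Ldot D'"
        "\<alpha> \<in> Idx n" "t \<in> {ti..tf}" for D' n \<alpha> t
      using F.coefficients_unique[OF \<psi> R init _ _ that(3,2), of D'] that(1) unfolding foot Ldot by blast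
    show "summable (\<lambda>n. \<Sum>\<alpha>\<in>Idx n. \<Sum>\<eta>\<in>Idx n. exp (- integral {ti..t} (lam n)) * M n t \<alpha> \<eta> * F.Dc \<psi> n \<eta> t *
      (LINT x|lborel. head 0 0 x ti * dtV x t * foot n \<alpha> x t))" if "t \<in> {ti..tf}" for t
      using work[OF that] by (rule sums_summable)
    show "((\<lambda>t. \<Sum>n. \<Sum>\<alpha>\<in>Idx n. \<Sum>\<eta>\<in>Idx n. exp (- integral {ti..t} (lam n)) * M n t \<alpha> \<eta> * F.Dc \<psi> n \<eta> t *
      (LINT x|lborel. head 0 0 x ti * dtV x t * foot n \<alpha> x t)) has_integral W) {ti..tf}"
      by (rule has_integral_eq[OF _ W]) (rule sums_unique[OF work])
  qed
qed

end
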